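(* Let $K_n=(V_n,E_n)$ be the complete graph on $n$ vertices, let $(\omega_e)_{e\in E_n}$ be i.i.d. uniform on $[0,1]$ with law $\mathbb{P}$, let $\beta=\beta(n)\ge0$, and let $\mathcal{T}$ be the RSTRE on $K_n$ with length $L(\mathcal{T})=\sum_{e\in\mathcal{T}}\omega_e$. If $0<\beta=\beta(n)\ll n/\log n$, then with high $\mathbb{P}$-probability (and also in $\mathbb{P}$-expectation) $$\mathbf{E}^\omega_{n,\beta}\big[L(\mathcal{T})\big]=(1+o(1))\,\frac{n}{\beta}\cdot\frac{1-\beta e^{-\beta}-e^{-\beta}}{1-e^{-\beta}}.$$ If on the other hand $\beta\gg n(\log n)^5$, then with high $\mathbb{P}$-probability (and also in $\mathbb{P}$-expectation) $$\mathbf{E}^\omega_{n,\beta}\big[L(\mathcal{T})\big]=(1+o(1))\,\zeta(3),\qquad \zeta(3)=\sum_{k=1}^\infty k^{-3}.$$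
   Context: Given $\omega$ and $\beta$, the random spanning tree in random environment (RSTRE) is the random spanning tree $\mathcal{T}$ of $K_n$ with law $\mathbf{P}^\omega_{n,\beta}(\mathcal{T}=T)\propto\prod_{e\in T}e^{-\beta\omega_e}$ over all spanning trees $T$ of $K_n$; $\mathbf{E}^\omega_{n,\beta}$ is the corresponding expectation, so $\mathbf{E}^\omega_{n,\beta}[L(\mathcal{T})]$ is a function of the random environment $\omega$. $f\ll g$ (equivalently $g\gg f$) means $f(n)/g(n)\to0$ as $n\to\infty$. "With high probability" means with probability tending to $1$ as $n\to\infty$; "$X_n=(1+o(1))a_n$ with high probability" means that for some deterministic $\delta_n\to0$, $|X_n/a_n-1|\le\delta_n$ with probability tending to 1, and "in $\mathbb{P}$-expectation" means $\mathbb{E}[X_n]=(1+o(1))a_n$. *)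

theory Defs
  imports "HOL-Probability.Probability" "HOL-Library.Landau_Symbols"
begin

text \<open>
  Undirected graphs are given by a vertex set and a set of two-element edges; a spanning tree is
  identified with its edge set.
\<close>

definition edges_connect :: "'v set \<Rightarrow> 'v set set \<Rightarrow> bool" where
  "edges_connect V T \<longleftrightarrow> (\<forall>u\<in>V. \<forall>v\<in>V. (u, v) \<in> {(a, b). {a, b} \<in> T}\<^sup>*)"

definition is_cycle :: "'v set set \<Rightarrow> 'v list \<Rightarrow> bool" where
  "is_cycle T p \<longleftrightarrow> 3 \<le> length p \<and> distinct p \<and>
     (\<forall>i<length p. {p ! i, p ! (Suc i mod length p)} \<in> T)"

definition spanning_trees :: "'v set \<Rightarrow> 'v set set \<Rightarrow> 'v set set set" where
  "spanning_trees V E = {T. T \<subseteq> E \<and> edges_connect V T \<and> (\<nexists>p. is_cycle T p)}"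

definition complete_verts :: "nat \<Rightarrow> nat set" where
  "complete_verts n = {..<n}"

definition complete_edges :: "nat \<Rightarrow> nat set set" where
  "complete_edges n = {e. e \<subseteq> complete_verts n \<and> card e = 2}"

abbreviation complete_spanning_trees :: "nat \<Rightarrow> nat set set set" where
  "complete_spanning_trees n \<equiv> spanning_trees (complete_verts n) (complete_edges n)"

type_synonym environment = "nat set \<Rightarrow> real"

definition env_measure :: "nat \<Rightarrow> environment measure" where
  "env_measure n = (\<Pi>\<^sub>M e\<in>complete_edges n. uniform_measure lborel {0..1})"

definition tree_weight :: "real \<Rightarrow> environment \<Rightarrow> nat set set \<Rightarrow> real" where
  "tree_weight b \<omega> T = (\<Prod>e\<in>T. exp (- b * \<omega> e))"

definition tree_length :: "environment \<Rightarrow> nat set set \<Rightarrow> real" where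
  "tree_length \<omega> T = (\<Sum>e\<in>T. \<omega> e)"

text \<open>
  The constant \<open>embed_pmf\<close> is meaningful only for nonnegative functions of total mass 1;
  \<open>pmf_rstre\<close> below shows that this is the case here.
\<close>

definition rstre :: "nat \<Rightarrow> real \<Rightarrow> environment \<Rightarrow> nat set set pmf" where
  "rstre n b \<omega> = embed_pmf (\<lambda>T. if T \<in> complete_spanning_trees n
     then tree_weight b \<omega> T / (\<Sum>T'\<in>complete_spanning_trees n. tree_weight b \<omega> T') else 0)"

definition rstre_mean_length :: "nat \<Rightarrow> real \<Rightarrow> environment \<Rightarrow> real" where
  "rstre_mean_length n b \<omega> = measure_pmf.expectation (rstre n b \<omega>) (tree_length \<omega>)"

definition whp_asymp_equiv ::
  "(nat \<Rightarrow> 'a measure) \<Rightarrow> (nat \<Rightarrow> 'a \<Rightarrow> real) \<Rightarrow> (nat \<Rightarrow> real) \<Rightarrow> bool" where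
  "whp_asymp_equiv M X a \<longleftrightarrow> (\<exists>\<delta> :: nat \<Rightarrow> real. \<delta> \<longlonglongrightarrow> 0 \<and>
     (\<lambda>n. measure (M n) {x \<in> space (M n). \<bar>X n x / a n - 1\<bar> \<le> \<delta> n}) \<longlonglongrightarrow> 1)"

lemma finite_complete_edges: "finite (complete_edges n)"
  by (rule finite_subset[of _ "Pow {..<n}"]) (auto simp: complete_edges_def complete_verts_def)

lemma finite_complete_spanning_trees: "finite (complete_spanning_trees n)"
  by (rule finite_subset[of _ "Pow (complete_edges n)"])
    (auto simp: spanning_trees_def finite_complete_edges)

lemma complete_spanning_trees_nonempty: "complete_spanning_trees n \<noteq> {}"
proof -
  define T where "T = {{0, v} | v. 0 < v \<and> v < n}"
  have "T \<subseteq> complete_edges n"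
    by (auto simp: T_def complete_edges_def complete_verts_def card_insert_if)
  moreover have "edges_connect (complete_verts n) T"
    unfolding edges_connect_def
  proof (intro ballI)
    fix u v assume uv: "u \<in> complete_verts n" "v \<in> complete_verts n"
    let ?R = "{(a, b). {a, b} \<in> T}"
    have *: "(w, 0) \<in> ?R\<^sup>* \<and> (0, w) \<in> ?R\<^sup>*" if "w \<in> complete_verts n" for w
    proof (cases "w = 0")
      case False
      then have "{0, w} \<in> T" "{w, 0} \<in> T"
        using that by (auto simp: T_def complete_verts_def insert_commute)
      then show ?thesis by auto
    qed auto
    from *[OF uv(1)] *[OF uv(2)] show "(u, v) \<in> ?R\<^sup>*"
      by (meson rtrancl_trans)
  qed
  moreover have "\<not> is_cycle T p" for p
  proof
    assume p: "is_cycle T p"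
    then have len: "3 \<le> length p" and dist: "distinct p"
      and step: "\<And>i. i < length p \<Longrightarrow> {p ! i, p ! (Suc i mod length p)} \<in> T"
      by (auto simp: is_cycle_def)
    have zero: "p ! i = 0 \<or> p ! (Suc i mod length p) = 0" if "i < length p" for i
      using step[OF that] by (auto simp: T_def doubleton_eq_iff)
    have uniq: "i = j" if "i < length p" "j < length p" "p ! i = 0" "p ! j = 0" for i j
      using dist that by (simp add: nth_eq_iff_index_eq[symmetric])
    have "p ! 1 = 0"
      using zero[of 0] zero[of 1] uniq[of 0 2] len
      by (cases "p = []") (auto simp: numeral_2_eq_2)
    moreover have "3 mod length p < length p" "3 mod length p \<noteq> 1"
      using len by (auto simp: mod_if)
    moreover have "p ! 2 = 0 \<or> p ! (3 mod length p) = 0"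
      using zero[of 2] len by (simp add: numeral_3_eq_3)
    ultimately show False
      using uniq[of 1 2] uniq[of 1 "3 mod length p"] len by auto
  qed
  ultimately have "T \<in> complete_spanning_trees n"
    by (auto simp: spanning_trees_def)
  then show ?thesis by auto
qed

lemma tree_weight_pos: "0 < tree_weight b \<omega> T"
  by (auto simp: tree_weight_def intro!: prod_pos)

lemma sum_tree_weight_pos: "0 < (\<Sum>T\<in>complete_spanning_trees n. tree_weight b \<omega> T)"
  by (intro sum_pos finite_complete_spanning_trees complete_spanning_trees_nonempty tree_weight_pos)

lemma pmf_rstre:
  "pmf (rstre n b \<omega>) T = (if T \<in> complete_spanning_trees n
     then tree_weight b \<omega> T / (\<Sum>T'\<in>complete_spanning_trees n. tree_weight b \<omega> T') else 0)"
proof -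
  let ?S = "complete_spanning_trees n"
  let ?Z = "\<Sum>T'\<in>?S. tree_weight b \<omega> T'"
  let ?f = "\<lambda>T. if T \<in> ?S then tree_weight b \<omega> T / ?Z else 0"
  have nn: "0 \<le> ?f T" for T
    using tree_weight_pos[of b \<omega> T] sum_tree_weight_pos[where n=n and b=b and \<omega>=\<omega>] by simp
  have "(\<integral>\<^sup>+T. ennreal (?f T) \<partial>count_space UNIV) = (\<Sum>T\<in>?S. ennreal (?f T))"
    by (subst nn_integral_count_space'[of ?S])
      (auto simp: finite_complete_spanning_trees)
  also have "\<dots> = ennreal (\<Sum>T\<in>?S. ?f T)"
    by (intro sum_ennreal nn)
  also have "(\<Sum>T\<in>?S. ?f T) = 1"
    using sum_tree_weight_pos[where n=n and b=b and \<omega>=\<omega>]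
    by (simp add: sum_divide_distrib[symmetric])
  finally have "(\<integral>\<^sup>+T. ennreal (?f T) \<partial>count_space UNIV) = 1" by simp
  then show ?thesis
    unfolding rstre_def by (subst pmf_embed_pmf) (use nn in auto)
qed

lemma rstre_mean_length_eq:
  "rstre_mean_length n b \<omega> =
     (\<Sum>T\<in>complete_spanning_trees n. tree_length \<omega> T * tree_weight b \<omega> T) /
     (\<Sum>T\<in>complete_spanning_trees n. tree_weight b \<omega> T)"
proof -
  have "rstre_mean_length n b \<omega> =
      (\<Sum>T\<in>complete_spanning_trees n. pmf (rstre n b \<omega>) T *\<^sub>R tree_length \<omega> T)"
    unfolding rstre_mean_length_def
    by (rule integral_measure_pmf[OF finite_complete_spanning_trees])
      (auto simp: set_pmf_eq pmf_rstre split: if_splits)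
  also have "\<dots> = (\<Sum>T\<in>complete_spanning_trees n. tree_length \<omega> T * tree_weight b \<omega> T /
      (\<Sum>T\<in>complete_spanning_trees n. tree_weight b \<omega> T))"
    by (intro sum.cong) (auto simp: pmf_rstre)
  finally show ?thesis by (simp add: sum_divide_distrib)
qed

lemma prob_space_env_measure: "prob_space (env_measure n)"
  unfolding env_measure_def
  by (intro prob_space_PiM prob_space_uniform_measure) auto

lemma borel_measurable_rstre_mean_length [measurable]:
  "rstre_mean_length n b \<in> borel_measurable (env_measure n)"
proof -
  have [measurable]: "(\<lambda>\<omega>. \<omega> e) \<in> borel_measurable (env_measure n)"
    if "T \<in> complete_spanning_trees n" "e \<in> T" for e T
  proof -
    have "e \<in> complete_edges n" using that by (auto simp: spanning_trees_def)
    then have "(\<lambda>\<omega>. \<omega> e) \<in> env_measure n \<rightarrow>\<^sub>M uniform_measure lborel {0..1}"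
      unfolding env_measure_def by (rule measurable_component_singleton)
    then show ?thesis by (simp cong: measurable_cong_sets)
  qed
  show ?thesis
    unfolding rstre_mean_length_eq[abs_def] tree_length_def tree_weight_def
    by (intro borel_measurable_divide borel_measurable_sum borel_measurable_times
        borel_measurable_prod borel_measurable_exp measurable_compose[OF _ borel_measurable_exp]) auto
qed

end

(*
  Both regimes are read off the partition function Z(b), the sum of exp(-b L(T)) over all spanning
  trees T: by Jensen's inequality ln Z lies above its tangents, whose slope is minus the mean
  length, so difference quotients of ln Z bound the mean length.

  For b << n / ln n, ln Z(b) is compared with (n - 1) ln (n m), where m is the mean of
  exp(-b w) over the environment. Trees rooted at 0 are acyclic maps, and
  the weight F(S) of the forests with root set S satisfies F(S) = d_v P(escape from v to S) F(S + v),
  which follows from the harmonicity of the weight of the forests in which a vertex is attached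
  to a prescribed root. This gives Z <= product of the weighted degrees, and a matching lower bound
  as soon as S has n / sqrt(n m) elements. Second moments of the degrees suffice; bounded and
  vanishing b are reconciled by the monotonicity of the mean length.

  For b >> n (ln n)^5 the entropy of the uniform spanning tree is at most n ln n, so
  the mean length is within n ln n / b of the minimal length. The latter is the integral over t of
  (number of components of the graph of edges below t) - 1. Components that are trees of size k
  contribute k^(-3) by Cayley's formula and a Beta integral, and they concentrate by a
  second moment computation; all other contributions are negligible.
*)
theory Submission
  imports Defs "HOL-Real_Asymp.Real_Asymp"
begin


section \<open>Weighted rooted forests\<close>

inductive ends :: "('v \<Rightarrow> 'v) \<Rightarrow> 'v set \<Rightarrow> 'v set \<Rightarrow> 'v \<Rightarrow> bool" for f R B where
  stop: "u \<in> R \<Longrightarrow> u \<in> B \<Longrightarrow> ends f R B u"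
| step: "u \<notin> R \<Longrightarrow> ends f R B (f u) \<Longrightarrow> ends f R B u"

lemma ends_root [simp]: "u \<in> R \<Longrightarrow> ends f R B u \<longleftrightarrow> u \<in> B"
  by (auto intro: ends.intros elim: ends.cases)

lemma ends_unfold: "u \<notin> R \<Longrightarrow> ends f R B u \<longleftrightarrow> ends f R B (f u)"
  by (auto intro: ends.intros elim: ends.cases)

lemma ends_mono: "ends f R B u \<Longrightarrow> B \<inter> R \<subseteq> C \<Longrightarrow> ends f R C u"
  by (induction rule: ends.induct) (auto intro: ends.intros)

lemma ends_Int: "ends f R B u \<Longrightarrow> ends f R C u \<Longrightarrow> ends f R (B \<inter> C) u"
  by (induction rule: ends.induct) (auto simp: ends_unfold)

lemma ends_empty: "\<not> ends f R {} u"
proof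
  show "ends f R {} u \<Longrightarrow> False" by (induction rule: ends.induct) auto
qed

lemma ends_disjoint: "ends f R B u \<Longrightarrow> ends f R C u \<Longrightarrow> B \<inter> C = {} \<Longrightarrow> False"
  using ends_Int[of f R B u C] ends_empty[of f R u] by auto

lemma ends_Un: "ends f R (B \<union> C) u \<longleftrightarrow> ends f R B u \<or> ends f R C u"
proof
  show "ends f R (B \<union> C) u \<Longrightarrow> ends f R B u \<or> ends f R C u"
    by (induction rule: ends.induct) (auto simp: ends_unfold)
qed (auto elim: ends_mono)

lemma ends_upd_root: "u \<in> R \<Longrightarrow> ends (f(u := y)) R B z \<longleftrightarrow> ends f R B z"
proof
  assume u: "u \<in> R"
  show "ends (f(u := y)) R B z \<Longrightarrow> ends f R B z"
    by (induction rule: ends.induct) (use u in \<open>auto simp: ends_unfold split: if_splits\<close>)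
  show "ends f R B z \<Longrightarrow> ends (f(u := y)) R B z"
  proof (induction rule: ends.induct)
    case (step x)
    then show ?case using u by (metis ends.step fun_upd_other)
  qed auto
qed

text \<open>Making \<open>u\<close> a root cuts the walks that pass through \<open>u\<close>. A walk
  caught by the new root continues, once \<open>u\<close> is an inner vertex again, exactly like the
  walk from \<open>u\<close>.\<close>

lemma ends_insert_via:
  assumes "ends f (insert u R) {u} z" "u \<notin> R"
  shows "ends f R B z \<longleftrightarrow> ends f R B u"
  using assms(1)
proof (induction rule: ends.induct)
  case (step x)
  then show ?case by (auto simp: ends_unfold)
qed auto

text \<open>A walk that stops in \<open>R\<close> although \<open>u\<close> is a root as well never
  meets \<open>u\<close>, so it does not notice whether \<open>u\<close> is a root.\<close>

lemma ends_insert_avoid: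
  assumes "ends f (insert u R) R z" "u \<notin> R"
  shows "ends f R B z \<longleftrightarrow> ends f (insert u R) B z"
  using assms(1)
proof (induction rule: ends.induct)
  case (stop x)
  then show ?case by auto
next
  case (step x)
  then show ?case by (auto simp: ends_unfold)
qed

lemma ends_insertI: "ends f R B z \<Longrightarrow> ends f (insert u R) (insert u R) z"
proof (induction rule: ends.induct)
  case (step x)
  then show ?case by (cases "x = u") (auto simp: ends_unfold)
qed auto

text \<open>A walk that came back to \<open>u\<close> would be periodic and never absorbed. The
  induction follows the terminating walk; whenever it stands at \<open>u\<close>, the supposed
  return starts afresh from \<open>f u\<close>.\<close>

lemma ends_no_return:
  assumes "ends f R B u" "u \<notin> R" "ends f (insert u R) {u} (f u)"
  shows False
proof -
  have "ends f R B x \<Longrightarrow> ends f (insert u R) {u} x \<Longrightarrow> False" for x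
  proof (induction rule: ends.induct)
    case (step x)
    then show ?case using assms by (cases "x = u") (auto simp: ends_unfold)
  qed (use assms in auto)
  from this[of u] show False using assms by simp
qed

lemma ends_cases_via:
  assumes "ends f (insert u R) (insert u R) z"
  shows "ends f (insert u R) R z \<or> ends f (insert u R) {u} z"
  using assms ends_Un[of f "insert u R" R "{u}" z] by simp

text \<open>A rooted forest is encoded by its parent map, taken extensional so that equal forests
  are equal functions. As \<open>ends\<close> is inductive, demanding that every vertex ends in
  \<open>R\<close> excludes all cycles, loops included.\<close>

definition forests :: "'v set \<Rightarrow> 'v set \<Rightarrow> ('v \<Rightarrow> 'v) set" where
  "forests V R = {f \<in> (V - R) \<rightarrow>\<^sub>E V. \<forall>u\<in>V. ends f R R u}"

definition forest_weight :: "('v \<Rightarrow> 'v \<Rightarrow> real) \<Rightarrow> 'v set \<Rightarrow> 'v set \<Rightarrow> ('v \<Rightarrow> 'v) \<Rightarrow> real" where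
  "forest_weight w V R f = (\<Prod>x\<in>V - R. w x (f x))"

definition forest_sum :: "('v \<Rightarrow> 'v \<Rightarrow> real) \<Rightarrow> 'v set \<Rightarrow> 'v set \<Rightarrow> real" where
  "forest_sum w V R = (\<Sum>f\<in>forests V R. forest_weight w V R f)"

text \<open>As a function of \<open>z\<close> this plays the role of the probability that the walk
  with steps proportional to \<open>w\<close>, stopped in \<open>R\<close>, stops inside
  \<open>B\<close>, scaled by \<open>forest_sum\<close>.\<close>

definition forest_sum_to :: "('v \<Rightarrow> 'v \<Rightarrow> real) \<Rightarrow> 'v set \<Rightarrow> 'v set \<Rightarrow> 'v set \<Rightarrow> 'v \<Rightarrow> real" where
  "forest_sum_to w V R B z = (\<Sum>f\<in>forests V R. of_bool (ends f R B z) * forest_weight w V R f)"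

lemma finite_forests: "finite V \<Longrightarrow> finite (forests V R)"
  by (rule finite_subset[of _ "(V - R) \<rightarrow>\<^sub>E V"]) (auto simp: forests_def intro!: finite_PiE)

text \<open>Deleting the edge out of \<open>u\<close> makes \<open>u\<close> a further root.
  Conversely an edge from \<open>u\<close> to \<open>y\<close> may be put back exactly when the tree
  of \<open>y\<close> is not the one rooted at \<open>u\<close>, since otherwise it would close a
  cycle.\<close>

lemma forests_insert_bij:
  assumes "u \<in> V" "u \<notin> R"
  shows "bij_betw (\<lambda>(g, y). g(u := y))
    (SIGMA g:forests V (insert u R). {y\<in>V. ends g (insert u R) R y}) (forests V R)"
proof (rule bij_betw_byWitness[where f' = "\<lambda>f. (f(u := undefined), f u)"])
  let ?R = "insert u R"
  show "\<forall>a\<in>SIGMA g:forests V ?R. {y\<in>V. ends g ?R R y}.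
      (\<lambda>f. (f(u := undefined), f u)) ((\<lambda>(g, y). g(u := y)) a) = a"
    by (auto simp: forests_def fun_eq_iff PiE_def extensional_def)
  show "\<forall>f\<in>forests V R. (\<lambda>(g, y). g(u := y)) (f(u := undefined), f u) = f"
    by auto
  show "(\<lambda>(g, y). g(u := y)) ` (SIGMA g:forests V ?R. {y\<in>V. ends g ?R R y}) \<subseteq> forests V R"
  proof safe
    fix g y assume g: "g \<in> forests V ?R" and y: "y \<in> V" "ends g ?R R y"
    have y': "ends (g(u := y)) ?R R y" using y by (simp add: ends_upd_root)
    then have "ends (g(u := y)) R R y" using assms y'  ends_insert_avoid[OF y'] by auto
    then have uu: "ends (g(u := y)) R R u" using assms by (subst ends_unfold) auto
    have "ends (g(u := y)) R R x" if x: "x \<in> V" for x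
    proof -
      have "ends (g(u := y)) ?R ?R x" using g x by (simp add: ends_upd_root forests_def)
      then consider "ends (g(u := y)) ?R R x" | "ends (g(u := y)) ?R {u} x"
        using ends_cases_via by metis
      then show ?thesis
        by cases (use assms uu ends_insert_avoid ends_insert_via in \<open>metis\<close>)+
    qed
    moreover have "g(u := y) \<in> (V - R) \<rightarrow>\<^sub>E V"
      using g y assms by (auto simp: forests_def PiE_def extensional_def Pi_def)
    ultimately show "g(u := y) \<in> forests V R" by (auto simp: forests_def)
  qed
  show "(\<lambda>f. (f(u := undefined), f u)) ` forests V R \<subseteq>
      (SIGMA g:forests V ?R. {y\<in>V. ends g ?R R y})"
  proof safe
    fix f assume f: "f \<in> forests V R"
    then show "f u \<in> V" using assms by (auto simp: forests_def)
    have "f(u := undefined) \<in> (V - ?R) \<rightarrow>\<^sub>E V"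
      using f by (auto simp: forests_def PiE_def extensional_def Pi_def)
    moreover have "ends (f(u := undefined)) ?R ?R x" if "x \<in> V" for x
      using f that by (auto simp: forests_def ends_upd_root intro: ends_insertI)
    ultimately show "f(u := undefined) \<in> forests V ?R" by (auto simp: forests_def)
    have u: "ends f R R u" using f assms by (auto simp: forests_def)
    then have "ends f ?R ?R (f u)" using assms by (auto simp: ends_unfold intro: ends_insertI)
    then have "ends f ?R R (f u)"
      using ends_cases_via ends_no_return[OF u] assms by metis
    then show "ends (f(u := undefined)) ?R R (f u)" by (simp add: ends_upd_root)
  qed
qed

text \<open>The bijection in weighted form. The test function \<open>\<phi>\<close> lets it apply to
  \<open>forest_sum\<close> and \<open>forest_sum_to\<close> alike.\<close>

lemma forest_sum_decompose:
  assumes "finite V" "u \<in> V" "u \<notin> R"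
  shows "(\<Sum>f\<in>forests V R. \<phi> f * forest_weight w V R f) =
    (\<Sum>g\<in>forests V (insert u R). \<Sum>y\<in>V. of_bool (ends g (insert u R) R y) * \<phi> (g(u := y)) *
      w u y * forest_weight w V (insert u R) g)"
proof -
  let ?R = "insert u R"
  have *: "forest_weight w V R (g(u := y)) = w u y * forest_weight w V ?R g" for g y
  proof -
    have "forest_weight w V R (g(u := y)) = (\<Prod>x\<in>insert u (V - ?R). w x ((g(u := y)) x))"
      unfolding forest_weight_def by (rule prod.cong) (use assms in auto)
    also have "\<dots> = w u y * (\<Prod>x\<in>V - ?R. w x ((g(u := y)) x))"
      by (subst prod.insert) (use assms(1) in auto)
    also have "(\<Prod>x\<in>V - ?R. w x ((g(u := y)) x)) = forest_weight w V ?R g"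
      unfolding forest_weight_def by (rule prod.cong) auto
    finally show ?thesis .
  qed
  have "(\<Sum>f\<in>forests V R. \<phi> f * forest_weight w V R f) =
    (\<Sum>(g, y)\<in>(SIGMA g:forests V ?R. {y\<in>V. ends g ?R R y}). \<phi> (g(u := y)) * forest_weight w V R (g(u := y)))"
    by (subst sum.reindex_bij_betw[OF forests_insert_bij[OF assms(2,3)], symmetric])
      (simp add: case_prod_unfold)
  also have "\<dots> = (\<Sum>g\<in>forests V ?R. \<Sum>y\<in>{y\<in>V. ends g ?R R y}. \<phi> (g(u := y)) * forest_weight w V R (g(u := y)))"
    using assms(1) by (subst sum.Sigma) (auto simp: finite_forests)
  also have "\<dots> = (\<Sum>g\<in>forests V ?R. \<Sum>y\<in>V. of_bool (ends g ?R R y) * \<phi> (g(u := y)) * w u y * forest_weight w V ?R g)"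
    using assms(1) unfolding *
    by (intro sum.cong[OF refl] sum.mono_neutral_cong_left) auto
  finally show ?thesis .
qed

text \<open>This is F(S) = d_v P(escape) F(S + v): the edge out of \<open>v\<close> is the first
  step of a walk, and the factor at \<open>z\<close> is the weight of being absorbed by
  \<open>S\<close> rather than by \<open>v\<close>.\<close>

lemma forest_sum_insert:
  assumes "finite V" "v \<in> V" "v \<notin> S"
  shows "forest_sum w V S = (\<Sum>z\<in>V. w v z * forest_sum_to w V (insert v S) S z)"
proof -
  have "forest_sum w V S = (\<Sum>g\<in>forests V (insert v S). \<Sum>y\<in>V.
      of_bool (ends g (insert v S) S y) * w v y * forest_weight w V (insert v S) g)"
    using forest_sum_decompose[OF assms, where \<phi> = "\<lambda>_. 1" and w = w] by (simp add: forest_sum_def)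
  also have "\<dots> = (\<Sum>y\<in>V. \<Sum>g\<in>forests V (insert v S).
      of_bool (ends g (insert v S) S y) * w v y * forest_weight w V (insert v S) g)"
    by (rule sum.swap)
  finally show ?thesis
    by (simp add: forest_sum_to_def sum_distrib_left ac_simps)
qed

text \<open>Splitting off the edge at u writes both sides as sums over forests g with u as an
  additional root; for fixed g the two expressions agree.\<close>

lemma forest_sum_to_harmonic:
  assumes "finite V" "u \<in> V" "u \<notin> R" "B \<subseteq> R"
  shows "(\<Sum>z\<in>V. w u z) * forest_sum_to w V R B u = (\<Sum>z\<in>V. w u z * forest_sum_to w V R B z)"
proof -
  let ?R = "insert u R"
  let ?F = "forests V ?R"
  \<comment> \<open>For a fixed forest \<open>g\<close> these are the weights from \<open>u\<close>
    into the trees rooted in \<open>B\<close>, in \<open>R\<close> and at \<open>u\<close> itself;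
    the last two exhaust the degree \<open>d\<close>.\<close>
  define a where "a g = (\<Sum>y\<in>V. w u y * of_bool (ends g ?R B y))" for g
  define b where "b g = (\<Sum>y\<in>V. w u y * of_bool (ends g ?R R y))" for g
  define c where "c g = (\<Sum>y\<in>V. w u y * of_bool (ends g ?R {u} y))" for g
  define d where "d = (\<Sum>z\<in>V. w u z)"
  have bc: "b g + c g = d" if g: "g \<in> ?F" for g
    unfolding b_def c_def d_def sum.distrib[symmetric]
  proof (intro sum.cong refl)
    fix y assume "y \<in> V"
    then have "ends g ?R ?R y" using g by (auto simp: forests_def)
    then have "ends g ?R R y \<or> ends g ?R {u} y" by (rule ends_cases_via)
    moreover have "\<not> (ends g ?R R y \<and> ends g ?R {u} y)"
      using ends_disjoint[of g ?R R y "{u}"] assms by auto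
    ultimately show "w u y * of_bool (ends g ?R R y) + w u y * of_bool (ends g ?R {u} y) = w u y"
      by auto
  qed
  \<comment> \<open>After the edge from \<open>u\<close> to \<open>y\<close> is added,
    \<open>z\<close> ends in \<open>B\<close> either because it already did, or because it hung
    below \<open>u\<close> and \<open>y\<close> ends in \<open>B\<close>.\<close>
  have E: "of_bool (ends g ?R R y) * of_bool (ends (g(u := y)) R B z) =
      (of_bool (ends g ?R R y) * of_bool (ends g ?R B z) +
       of_bool (ends g ?R B y) * of_bool (ends g ?R {u} z) :: real)"
    if g: "g \<in> ?F" and z: "z \<in> V" for g y z
  proof (cases "ends g ?R R y")
    case False
    then have "\<not> ends g ?R B y" using assms(4) ends_mono[of g ?R B y R] by auto
    with False show ?thesis by simp
  next
    case True
    let ?f = "g(u := y)"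
    have y: "ends ?f ?R R y" using True by (simp add: ends_upd_root)
    have "ends ?f R B u \<longleftrightarrow> ends ?f R B y" using assms by (simp add: ends_unfold)
    also have "\<dots> \<longleftrightarrow> ends g ?R B y"
      using ends_insert_avoid[OF y assms(3)] by (simp add: ends_upd_root)
    finally have u: "ends ?f R B u \<longleftrightarrow> ends g ?R B y" .
    have "ends g ?R ?R z" using g z by (auto simp: forests_def)
    then consider "ends g ?R R z" | "ends g ?R {u} z" using ends_cases_via by metis
    then show ?thesis
    proof cases
      case 1
      then have z: "ends ?f ?R R z" by (simp add: ends_upd_root)
      have "\<not> ends g ?R {u} z" using ends_disjoint[OF 1] assms by auto
      then show ?thesis
        using True ends_insert_avoid[OF z assms(3)] by (simp add: ends_upd_root)
    next
      case 2
      then have z: "ends ?f ?R {u} z" by (simp add: ends_upd_root)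
      have "\<not> ends g ?R B z" using ends_disjoint[OF 2, of B] assms by auto
      then show ?thesis
        using True 2 u ends_insert_via[OF z assms(3)] by simp
    qed
  qed
  have Eu: "of_bool (ends g ?R R y) * of_bool (ends (g(u := y)) R B u) =
      (of_bool (ends g ?R B y) :: real)" if g: "g \<in> ?F" for g y
    using E[OF g assms(2), of y] assms by auto
  have H: "forest_sum_to w V R B u = (\<Sum>g\<in>?F. forest_weight w V ?R g * a g)"
    unfolding forest_sum_to_def forest_sum_decompose[OF assms(1-3)] a_def sum_distrib_left
  proof (intro sum.cong refl)
    fix g y assume "g \<in> ?F"
    from Eu[OF this, of y]
    show "of_bool (ends g ?R R y) * of_bool (ends (g(u := y)) R B u) * w u y * forest_weight w V ?R g =
        forest_weight w V ?R g * (w u y * of_bool (ends g ?R B y))"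
      by (simp only: ac_simps)
  qed
  have Hz: "forest_sum_to w V R B z = (\<Sum>g\<in>?F. \<Sum>y\<in>V.
      (of_bool (ends g ?R R y) * of_bool (ends g ?R B z) +
       of_bool (ends g ?R B y) * of_bool (ends g ?R {u} z)) * w u y * forest_weight w V ?R g)"
    if "z \<in> V" for z
    unfolding forest_sum_to_def forest_sum_decompose[OF assms(1-3)]
    by (intro sum.cong refl) (simp only: E that)
  have "(\<Sum>z\<in>V. w u z * forest_sum_to w V R B z) =
      (\<Sum>z\<in>V. w u z * (\<Sum>g\<in>?F. \<Sum>y\<in>V. (of_bool (ends g ?R R y) * of_bool (ends g ?R B z) +
       of_bool (ends g ?R B y) * of_bool (ends g ?R {u} z)) * w u y * forest_weight w V ?R g))"
    by (intro sum.cong refl) (simp only: Hz)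
  also have "\<dots> = (\<Sum>g\<in>?F. \<Sum>z\<in>V. \<Sum>y\<in>V. w u z * ((of_bool (ends g ?R R y) * of_bool (ends g ?R B z) +
       of_bool (ends g ?R B y) * of_bool (ends g ?R {u} z)) * w u y * forest_weight w V ?R g))"
    by (simp only: sum_distrib_left, subst sum.swap) (rule refl)
  \<comment> \<open>The double sums factorise for each \<open>g\<close>, and a b + a c = a d is what
    the left-hand side gives.\<close>
  also have "\<dots> = (\<Sum>g\<in>?F. forest_weight w V ?R g * (b g * a g + a g * c g))"
  proof (intro sum.cong refl)
    fix g
    have "(\<Sum>z\<in>V. \<Sum>y\<in>V. w u z * ((of_bool (ends g ?R R y) * of_bool (ends g ?R B z) +
       of_bool (ends g ?R B y) * of_bool (ends g ?R {u} z)) * w u y * forest_weight w V ?R g)) =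
       forest_weight w V ?R g * ((\<Sum>z\<in>V. \<Sum>y\<in>V. (w u z * of_bool (ends g ?R B z)) * (w u y * of_bool (ends g ?R R y)))
        + (\<Sum>z\<in>V. \<Sum>y\<in>V. (w u z * of_bool (ends g ?R {u} z)) * (w u y * of_bool (ends g ?R B y))))"
      by (simp only: sum.distrib[symmetric] sum_distrib_left)
        (intro sum.cong refl, simp only: distrib_left distrib_right ac_simps)
    also have "\<dots> = forest_weight w V ?R g * (a g * b g + c g * a g)"
      by (simp only: sum_product a_def b_def c_def)
    finally show "(\<Sum>z\<in>V. \<Sum>y\<in>V. w u z * ((of_bool (ends g ?R R y) * of_bool (ends g ?R B z) +
       of_bool (ends g ?R B y) * of_bool (ends g ?R {u} z)) * w u y * forest_weight w V ?R g)) =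
       forest_weight w V ?R g * (b g * a g + a g * c g)" by (simp add: algebra_simps)
  qed
  also have "\<dots> = (\<Sum>g\<in>?F. forest_weight w V ?R g * (d * a g))"
    using bc by (intro sum.cong refl) (metis distrib_left mult.commute)
  also have "\<dots> = d * forest_sum_to w V R B u"
    unfolding H sum_distrib_left by (simp only: ac_simps)
  finally show ?thesis by (simp only: d_def)
qed


section \<open>Bounds on forest sums and the number of forests\<close>

lemma forest_weight_nonneg: "(\<And>u v. 0 \<le> w u v) \<Longrightarrow> 0 \<le> forest_weight w V R f"
  by (auto simp: forest_weight_def intro: prod_nonneg)

lemma forest_sum_to_nonneg: "(\<And>u v. 0 \<le> w u v) \<Longrightarrow> 0 \<le> forest_sum_to w V R B z"
  by (auto simp: forest_sum_to_def forest_weight_nonneg intro!: sum_nonneg)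

lemma forest_sum_nonneg: "(\<And>u v. 0 \<le> w u v) \<Longrightarrow> 0 \<le> forest_sum w V R"
  by (auto simp: forest_sum_def forest_weight_nonneg intro!: sum_nonneg)

lemma forest_sum_to_le: "(\<And>u v. 0 \<le> w u v) \<Longrightarrow> forest_sum_to w V R B z \<le> forest_sum w V R"
  by (auto simp: forest_sum_to_def forest_sum_def forest_weight_nonneg intro!: sum_mono)

lemma forest_sum_to_root: "z \<in> R \<Longrightarrow> forest_sum_to w V R B z = of_bool (z \<in> B) * forest_sum w V R"
  by (simp add: forest_sum_to_def forest_sum_def)

lemma forest_sum_to_compl:
  assumes "v \<notin> S" "z \<in> V"
  shows "forest_sum_to w V (insert v S) S z = forest_sum w V (insert v S) - forest_sum_to w V (insert v S) {v} z"
proof -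
  have "of_bool (ends f (insert v S) S z) * x = x - of_bool (ends f (insert v S) {v} z) * x"
    if "f \<in> forests V (insert v S)" for f and x :: real
  proof -
    have "ends f (insert v S) (insert v S) z" using that assms by (auto simp: forests_def)
    then have "ends f (insert v S) S z \<or> ends f (insert v S) {v} z" by (rule ends_cases_via)
    moreover have "\<not> (ends f (insert v S) S z \<and> ends f (insert v S) {v} z)"
      using ends_disjoint[of f "insert v S" S z "{v}"] assms by auto
    ultimately show ?thesis by auto
  qed
  then show ?thesis unfolding forest_sum_to_def forest_sum_def sum_subtractf[symmetric]
    by (intro sum.cong) auto
qed

lemma forest_sum_all: "forest_sum w V V = 1"
proof -
  have "forests V V = {\<lambda>_. undefined}" by (auto simp: forests_def)
  then show ?thesis by (simp add: forest_sum_def forest_weight_def)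
qed

text \<open>The escape probability is bounded by 1.\<close>

lemma forest_sum_insert_upper:
  assumes "finite V" "v \<in> V" "v \<notin> S" "\<And>u v. 0 \<le> w u v"
  shows "forest_sum w V S \<le> (\<Sum>z\<in>V. w v z) * forest_sum w V (insert v S)"
  unfolding forest_sum_insert[OF assms(1-3)] sum_distrib_right
  by (intro sum_mono mult_left_mono forest_sum_to_le assms)

text \<open>Keeps only the first steps from \<open>v\<close> that land in \<open>S'\<close>, where
  absorption is immediate.\<close>

lemma forest_sum_insert_lower:
  assumes "finite V" "v \<in> V" "v \<notin> S" "S' \<subseteq> S" "S \<subseteq> V" "\<And>u v. 0 \<le> w u v"
  shows "forest_sum w V S \<ge> (\<Sum>z\<in>S'. w v z) * forest_sum w V (insert v S)"
proof -
  have "(\<Sum>z\<in>S'. w v z) * forest_sum w V (insert v S) = (\<Sum>z\<in>S'. w v z * forest_sum_to w V (insert v S) S z)"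
    unfolding sum_distrib_right using assms by (intro sum.cong refl) (auto simp: forest_sum_to_root)
  also have "\<dots> \<le> forest_sum w V S"
    unfolding forest_sum_insert[OF assms(1-3)]
    by (intro sum_mono2) (use assms in \<open>auto intro!: mult_nonneg_nonneg forest_sum_to_nonneg\<close>)
  finally show ?thesis .
qed

text \<open>A maximum principle. Let \<open>G u\<close> be the weight of attaching \<open>u\<close>
  to \<open>v\<close>. At a vertex where \<open>G\<close> is largest outside the roots, harmonicity
  loses the part of the degree that leads into \<open>S\<close>, a fraction of at least
  \<open>\<epsilon>\<close>, and gains only the edge to \<open>v\<close>, at most
  \<open>\<eta> * \<epsilon>\<close> of the degree. Hence \<open>G\<close> is at most
  \<open>\<eta> * F\<close> off the roots, and the walk from \<open>v\<close> escapes with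
  probability at least \<open>1 - \<eta>\<close>.\<close>

lemma forest_sum_insert_lower_escape:
  assumes fin: "finite V" and v: "v \<in> V" "v \<notin> S" "S \<subseteq> V" and nn: "\<And>u v. 0 \<le> w u v"
    and vv: "w v v = 0"
    and esc: "\<And>u. u \<in> V - S \<Longrightarrow> \<epsilon> * (\<Sum>z\<in>V. w u z) \<le> (\<Sum>z\<in>S. w u z)"
    and pos: "\<And>u. u \<in> V - S \<Longrightarrow> 0 < \<epsilon> * (\<Sum>z\<in>V. w u z)"
    and small: "\<And>u z. u \<in> V - S \<Longrightarrow> z \<in> V \<Longrightarrow> w u z \<le> \<eta> * (\<epsilon> * (\<Sum>z\<in>V. w u z))"
  shows "forest_sum w V S \<ge> (\<Sum>z\<in>V. w v z) * (1 - \<eta>) * forest_sum w V (insert v S)"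
proof -
  let ?R = "insert v S"
  define F where "F = forest_sum w V ?R"
  define G where "G = forest_sum_to w V ?R {v}"
  have F0: "0 \<le> F" unfolding F_def by (rule forest_sum_nonneg) (rule nn)
  have finS: "finite S" using fin v finite_subset by auto
  have \<eta>: "0 \<le> \<eta>"
    using small[of v v] pos[of v] v vv by (simp add: zero_le_mult_iff)
  have bound: "G u \<le> \<eta> * F" if u: "u \<in> V - ?R" for u
  proof -
    define x where "x = Max (G ` (V - ?R))"
    have "x \<in> G ` (V - ?R)" unfolding x_def by (rule Max_in) (use fin u in auto)
    then obtain y where y: "y \<in> V - ?R" "x = G y" by auto
    have le: "G z \<le> x" if "z \<in> V - ?R" for z
      unfolding x_def by (rule Max_ge) (use fin that in auto)
    have x0: "0 \<le> x" unfolding y(2) G_def by (rule forest_sum_to_nonneg) (rule nn)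
    have "(\<Sum>z\<in>V. w y z) * x = (\<Sum>z\<in>V. w y z * G z)"
      unfolding y(2) G_def by (rule forest_sum_to_harmonic) (use fin y in auto)
    \<comment> \<open>Outside the roots \<open>G\<close> is at most \<open>x\<close>; it vanishes on
      \<open>S\<close> and equals \<open>F\<close> at \<open>v\<close>.\<close>
    also have "\<dots> \<le> (\<Sum>z\<in>V. w y z * x - of_bool (z \<in> S) * (w y z * x) + of_bool (z = v) * (w y z * F))"
    proof (rule sum_mono)
      fix z assume z: "z \<in> V"
      consider "z = v" | "z \<in> S" | "z \<in> V - ?R" using z by auto
      then show "w y z * G z \<le> w y z * x - of_bool (z \<in> S) * (w y z * x) + of_bool (z = v) * (w y z * F)"
      proof cases
        case 1
        then show ?thesis using v x0 nn by (simp add: G_def F_def forest_sum_to_root)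
      next
        case 2
        then have "z \<noteq> v" using v by auto
        then show ?thesis using 2 by (simp add: G_def forest_sum_to_root)
      next
        case 3
        then show ?thesis using le[OF 3] nn by (auto intro: mult_left_mono)
      qed
    qed
    also have "\<dots> = (\<Sum>z\<in>V. w y z) * x - (\<Sum>z\<in>S. w y z) * x + w y v * F"
    proof -
      have 1: "(\<Sum>z\<in>V. of_bool (z \<in> S) * (w y z * x)) = (\<Sum>z\<in>S. w y z) * x"
        unfolding sum_distrib_right using fin v
        by (intro sum.mono_neutral_cong_right) auto
      have 2: "(\<Sum>z\<in>V. of_bool (z = v) * (w y z * F)) = w y v * F"
        using fin v by simp
      show ?thesis unfolding sum.distrib sum_subtractf 1 2 by (simp add: sum_distrib_right)
    qed
    finally have "(\<Sum>z\<in>S. w y z) * x \<le> w y v * F" by simp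
    moreover have "(\<epsilon> * (\<Sum>z\<in>V. w y z)) * x \<le> (\<Sum>z\<in>S. w y z) * x"
      using esc y x0 by (intro mult_right_mono) auto
    moreover have "w y v * F \<le> \<eta> * (\<epsilon> * (\<Sum>z\<in>V. w y z)) * F"
      using small y v F0 by (intro mult_right_mono) auto
    ultimately have "(\<epsilon> * (\<Sum>z\<in>V. w y z)) * x \<le> (\<epsilon> * (\<Sum>z\<in>V. w y z)) * (\<eta> * F)"
      by (simp add: ac_simps)
    then have "x \<le> \<eta> * F" using pos[of y] y(1) by (simp del: mult.assoc add: mult_le_cancel_left_pos)
    then show ?thesis using le[OF u] by simp
  qed
  have "(\<Sum>z\<in>V. w v z * (F - \<eta> * F)) = (\<Sum>z\<in>V. w v z) * (F - \<eta> * F)"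
    by (simp only: sum_distrib_right)
  moreover have "F - \<eta> * F = (1 - \<eta>) * F" by (simp add: algebra_simps)
  ultimately have "(\<Sum>z\<in>V. w v z) * (1 - \<eta>) * F = (\<Sum>z\<in>V. w v z * (F - \<eta> * F))"
    by (simp only: mult.assoc)
  also have "\<dots> \<le> (\<Sum>z\<in>V. w v z * forest_sum_to w V ?R S z)"
  proof (rule sum_mono)
    fix z assume z: "z \<in> V"
    show "w v z * (F - \<eta> * F) \<le> w v z * forest_sum_to w V ?R S z"
    \<comment> \<open>From \<open>z = v\<close> nothing escapes, but this first step has weight
      0.\<close>
    proof (cases "z = v")
      case True
      then show ?thesis using vv by simp
    next
      case False
      have "G z \<le> \<eta> * F"
        using bound[of z] z False \<eta> F0 v by (cases "z \<in> S") (auto simp: G_def forest_sum_to_root)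
      then show ?thesis
        using forest_sum_to_compl[OF v(2) z, of w] nn by (intro mult_left_mono) (auto simp: F_def G_def)
    qed
  qed
  also have "\<dots> = forest_sum w V S" using forest_sum_insert[OF fin v(1,2)] by simp
  finally show ?thesis by (simp add: F_def)
qed

text \<open>Telescopes over the vertices of \<open>B - R\<close> in an arbitrary order, which is why
  the step is assumed for every root set that contains \<open>R\<close>.\<close>

lemma forest_sum_chain:
  assumes fin: "finite V" and "R \<subseteq> B" "B \<subseteq> V" and nn: "\<And>u v. 0 \<le> w u v" "\<And>v. v \<in> B - R \<Longrightarrow> 0 \<le> c v"
    and step: "\<And>v S. v \<in> B - R \<Longrightarrow> v \<notin> S \<Longrightarrow> R \<subseteq> S \<Longrightarrow> S \<subseteq> V \<Longrightarrow>
      c v * forest_sum w V (insert v S) \<le> forest_sum w V S"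
  shows "(\<Prod>v\<in>B - R. c v) * forest_sum w V B \<le> forest_sum w V R"
proof -
  have "D \<subseteq> B - R \<Longrightarrow> (\<Prod>v\<in>D. c v) * forest_sum w V (R \<union> D) \<le> forest_sum w V R" if "finite D" for D
    using that
  proof (induction D rule: finite_induct)
    case (insert v D)
    have "(\<Prod>v\<in>insert v D. c v) * forest_sum w V (R \<union> insert v D) =
        (\<Prod>v\<in>D. c v) * (c v * forest_sum w V (insert v (R \<union> D)))"
      using insert by simp
    also have "\<dots> \<le> (\<Prod>v\<in>D. c v) * forest_sum w V (R \<union> D)"
      using insert.prems insert.hyps assms(2,3) nn(2)
      by (intro mult_left_mono step prod_nonneg) auto
    also have "\<dots> \<le> forest_sum w V R" using insert by auto
    finally show ?case .
  qed simp
  from this[of "B - R"] show ?thesis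
    using assms(2,3) fin finite_subset[of B V] by (simp add: Un_absorb1)
qed

lemma forest_sum_upper:
  assumes fin: "finite V" "R \<subseteq> V" and nn: "\<And>u v. 0 \<le> w u v"
  shows "forest_sum w V R \<le> (\<Prod>v\<in>V - R. \<Sum>z\<in>V. w v z)"
proof -
  have "D \<subseteq> V - R \<Longrightarrow> forest_sum w V R \<le> (\<Prod>v\<in>D. \<Sum>z\<in>V. w v z) * forest_sum w V (R \<union> D)" if "finite D" for D
    using that
  proof (induction D rule: finite_induct)
    case (insert v D)
    have "forest_sum w V R \<le> (\<Prod>v\<in>D. \<Sum>z\<in>V. w v z) * forest_sum w V (R \<union> D)" using insert by auto
    also have "\<dots> \<le> (\<Prod>v\<in>D. \<Sum>z\<in>V. w v z) * ((\<Sum>z\<in>V. w v z) * forest_sum w V (insert v (R \<union> D)))"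
      using insert.prems insert.hyps assms
      by (intro mult_left_mono prod_nonneg forest_sum_insert_upper) (auto intro!: sum_nonneg)
    also have "\<dots> = (\<Prod>v\<in>insert v D. \<Sum>z\<in>V. w v z) * forest_sum w V (R \<union> insert v D)"
      using insert by simp
    finally show ?case .
  qed simp
  from this[of "V - R"] show ?thesis
    using fin by (simp add: Un_absorb1 forest_sum_all)
qed

text \<open>The number of forests with s given roots is s n^(n-s-1); multiplying by n keeps the
  exponent a natural number when every vertex is a root. For constant weights harmonicity makes
  \<open>H\<close> equal to T / n at all vertices outside the roots, so T = s F + (n - s - 1) T / n,
  which expresses T through the count F for one more root.\<close>

lemma forest_sum_one:
  assumes fin: "finite V" and S: "S \<subseteq> V" "S \<noteq> {}"
  shows "card V * forest_sum (\<lambda>_ _. 1) V S = card S * real (card V) ^ (card V - card S)"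
  using S
proof (induction "card V - card S" arbitrary: S)
  case 0
  then have "S = V" using fin card_subset_eq card_mono by (metis diff_is_0_eq le_antisym)
  then show ?case by (simp add: forest_sum_all)
next
  case (Suc m)
  let ?w = "\<lambda>_ _. 1 :: real"
  have "S \<noteq> V" using Suc by auto
  then obtain v where v: "v \<in> V" "v \<notin> S" using Suc by auto
  let ?R = "insert v S"
  have finS: "finite S" using fin Suc finite_subset by auto
  have cR: "card ?R = Suc (card S)" using v finS by simp
  have le: "card ?R \<le> card V" using fin v Suc by (intro card_mono) auto
  define F where "F = forest_sum ?w V ?R"
  define H where "H = forest_sum_to ?w V ?R S"
  define n where "n = real (card V)"
  define s where "s = real (card S)"
  have n0: "0 < n" using fin v by (auto simp: n_def card_gt_0_iff)
  have s0: "0 < s" using finS Suc by (auto simp: s_def card_gt_0_iff)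
  have IH: "n * F = (s + 1) * n ^ m"
  proof -
    have m: "m = card V - card ?R" using Suc(2) cR by simp
    show ?thesis using Suc(1)[OF m] Suc(3) v cR unfolding m[symmetric] by (simp add: F_def n_def s_def add.commute)
  qed
  define T where "T = forest_sum ?w V S"
  have T: "T = (\<Sum>z\<in>V. H z)"
    unfolding T_def H_def using forest_sum_insert[OF fin v, of ?w] by simp
  have out: "H u = T / n" if "u \<in> V - ?R" for u
  proof -
    have "n * H u = T"
      using forest_sum_to_harmonic[of V u ?R S ?w] fin that subset_insertI[of S v]
      by (simp add: T H_def n_def)
    then show ?thesis using n0 by (simp add: eq_divide_eq mult.commute)
  qed
  have "T = (\<Sum>z\<in>S. H z) + H v + (\<Sum>z\<in>V - ?R. H z)"
  proof -
    have "V = ?R \<union> (V - ?R)" using Suc v by auto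
    then have "sum H V = sum H ?R + sum H (V - ?R)"
      using fin Suc v by (subst sum.subset_diff[of ?R V]) auto
    then show ?thesis using finS v by (simp add: T)
  qed
  also have "(\<Sum>z\<in>S. H z) = s * F" by (simp add: H_def forest_sum_to_root F_def s_def)
  also have "H v = 0" using v by (simp add: H_def forest_sum_to_root)
  also have "(\<Sum>z\<in>V - ?R. H z) = (n - (s + 1)) * (T / n)"
  proof -
    have "card (V - ?R) = card V - card ?R" using fin Suc v by (intro card_Diff_subset) (auto intro: finite_subset)
    then show ?thesis using out le cR by (simp add: n_def s_def of_nat_diff)
  qed
  finally have "T * (s + 1) = n * s * F" using n0 by (simp add: field_simps)
  also have "n * s * F = s * (n * F)" by (simp only: ac_simps)
  finally have "T * (s + 1) = s * n ^ m * (s + 1)" unfolding IH by (simp only: ac_simps)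
  then have "T = s * n ^ m" using s0 by simp
  then show ?case using Suc(2) n0 by (simp add: T_def n_def s_def flip: Suc(2))
qed

lemma card_forests:
  assumes "finite V" "r \<in> V"
  shows "card V * card (forests V {r}) = card V ^ (card V - 1)"
proof -
  have "forest_sum (\<lambda>_ _. 1) V {r} = card (forests V {r})" by (simp add: forest_sum_def forest_weight_def)
  then have "real (card V * card (forests V {r})) = real (card V ^ (card V - 1))"
    using forest_sum_one[of V "{r}"] assms by simp
  then show ?thesis by (simp only: of_nat_eq_iff)
qed


section \<open>Spanning trees\<close>

definition conn :: "'v set set \<Rightarrow> ('v \<times> 'v) set" where
  "conn H = {(a, b). {a, b} \<in> H}\<^sup>*"

lemma edges_connect_conn: "edges_connect V T \<longleftrightarrow> (\<forall>u\<in>V. \<forall>v\<in>V. (u, v) \<in> conn T)"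
  by (simp add: edges_connect_def conn_def)

lemma conn_refl [simp]: "(u, u) \<in> conn H"
  by (simp add: conn_def)

lemma conn_sym: "(u, v) \<in> conn H \<Longrightarrow> (v, u) \<in> conn H"
proof -
  have "sym (conn H)" unfolding conn_def
    by (rule sym_rtrancl) (auto simp: sym_def insert_commute)
  then show "(u, v) \<in> conn H \<Longrightarrow> (v, u) \<in> conn H" by (auto dest: symD)
qed

lemma conn_trans: "(u, v) \<in> conn H \<Longrightarrow> (v, w) \<in> conn H \<Longrightarrow> (u, w) \<in> conn H"
  unfolding conn_def by (rule rtrancl_trans)

lemma conn_edge: "{u, v} \<in> H \<Longrightarrow> (u, v) \<in> conn H"
  unfolding conn_def by auto

lemma conn_mono: "H \<subseteq> H' \<Longrightarrow> conn H \<subseteq> conn H'"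
  unfolding conn_def by (rule rtrancl_mono) auto

lemma conn_insert_edge:
  assumes "(u, v) \<in> conn (insert {a, b} H)"
  shows "(u, v) \<in> conn H \<or> (u, a) \<in> conn H \<and> (b, v) \<in> conn H \<or> (u, b) \<in> conn H \<and> (a, v) \<in> conn H"
  using assms unfolding conn_def[of "insert _ _"]
proof (induction rule: rtrancl_induct)
  case (step y z)
  from step(2) consider "y = a" "z = b" | "y = b" "z = a" | "(y, z) \<in> conn H"
    by (auto simp: doubleton_eq_iff intro: conn_edge)
  then show ?case
  proof cases
    case 1
    then show ?thesis using step(3) by (meson conn_refl conn_sym conn_trans)
  next
    case 2
    then show ?thesis using step(3) by (meson conn_refl conn_sym conn_trans)
  next
    case 3
    then show ?thesis using step(3) by (meson conn_trans)
  qed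
qed simp

text \<open>Loop erasure: when the next vertex already lies on the path, the path is cut back to
  it.\<close>

lemma conn_simple_path:
  assumes "(a, b) \<in> conn H"
  shows "\<exists>p. p \<noteq> [] \<and> distinct p \<and> hd p = a \<and> last p = b \<and>
    (\<forall>i. Suc i < length p \<longrightarrow> {p ! i, p ! Suc i} \<in> H)"
  using assms unfolding conn_def
proof (induction rule: rtrancl_induct)
  case base
  show ?case by (rule exI[of _ "[a]"]) auto
next
  case (step b c)
  then obtain p where p: "p \<noteq> []" "distinct p" "hd p = a" "last p = b"
    "\<And>i. Suc i < length p \<Longrightarrow> {p ! i, p ! Suc i} \<in> H" by auto
  show ?case
  proof (cases "c \<in> set p")
    case False
    have "{(p @ [c]) ! i, (p @ [c]) ! Suc i} \<in> H" if i: "Suc i < length (p @ [c])" for i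
    proof (cases "Suc i < length p")
      case True
      then show ?thesis using p(5)[of i] by (simp add: nth_append)
    next
      case F: False
      then have l: "length p = Suc i" using i by auto
      then have "p ! i = b" using p(1,4) by (simp add: last_conv_nth)
      then show ?thesis using l step(2) by (simp add: nth_append)
    qed
    then show ?thesis using False p by (intro exI[of _ "p @ [c]"]) auto
  next
    case True
    then obtain k where k: "k < length p" "p ! k = c" by (auto simp: in_set_conv_nth)
    let ?q = "take (Suc k) p"
    have q: "?q \<noteq> []" "length ?q = Suc k" using p(1) k by auto
    have "last ?q = c" unfolding last_conv_nth[OF q(1)] q(2) using k by simp
    moreover have "hd ?q = a" using p by (cases p) auto
    ultimately show ?thesis using p k by (intro exI[of _ ?q]) auto
  qed
qed

text \<open>The cycle must use the new edge, and going round it the other way joins the ends of that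
  edge inside \<open>T\<close>.\<close>

lemma is_cycle_insertD:
  assumes cyc: "is_cycle (insert {a, b} T) p" and "\<not> is_cycle T p"
  shows "(a, b) \<in> conn T"
proof -
  let ?L = "length p"
  have L: "3 \<le> ?L" and d: "distinct p"
    and e: "\<And>i. i < ?L \<Longrightarrow> {p ! i, p ! (Suc i mod ?L)} \<in> insert {a, b} T"
    using cyc by (auto simp: is_cycle_def)
  obtain i where i: "i < ?L" "{p ! i, p ! (Suc i mod ?L)} = {a, b}"
  proof -
    have "\<exists>i<?L. {p ! i, p ! (Suc i mod ?L)} = {a, b}"
    proof (rule ccontr)
      assume "\<not> ?thesis"
      then have "\<And>i. i < ?L \<Longrightarrow> {p ! i, p ! (Suc i mod ?L)} \<in> T" using e by blast
      then show False using assms(2) L d by (simp add: is_cycle_def)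
    qed
    then show ?thesis using that by blast
  qed
  have "(p ! ((i + 1) mod ?L), p ! ((i + 1 + j) mod ?L)) \<in> conn T" if "j < ?L" for j
    using that
  proof (induction j)
    case (Suc j)
    define x where "x = (i + 1 + j) mod ?L"
    have x: "x < ?L" unfolding x_def using L by (intro mod_less_divisor) linarith
    have sx: "Suc x mod ?L = (i + 1 + Suc j) mod ?L" by (simp add: x_def mod_Suc_eq)
    have x_if: "x = (if i + 1 + j < ?L then i + 1 + j else i + 1 + j - ?L)"
    proof (cases "i + 1 + j < ?L")
      case False
      then have "x = (i + 1 + j - ?L) mod ?L" unfolding x_def by (intro le_mod_geq) simp
      then show ?thesis using False i(1) Suc.prems by simp
    qed (simp add: x_def)
    have xi: "x \<noteq> i" using Suc.prems unfolding x_if by auto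
    have sx_if: "Suc x mod ?L = (if Suc x = ?L then 0 else Suc x)" using x by (cases "Suc x = ?L") auto
    have si_if: "Suc i mod ?L = (if Suc i = ?L then 0 else Suc i)" using i(1) by (cases "Suc i = ?L") auto
    \<comment> \<open>Different positions carry different edges: a coincidence would force the cycle
      to have length 2.\<close>
    have "{p ! x, p ! (Suc x mod ?L)} \<noteq> {p ! i, p ! (Suc i mod ?L)}"
    proof
      assume eq: "{p ! x, p ! (Suc x mod ?L)} = {p ! i, p ! (Suc i mod ?L)}"
      have lt: "Suc x mod ?L < ?L" "Suc i mod ?L < ?L"
        using L by (intro mod_less_divisor; linarith)+
      have "p ! x \<noteq> p ! i" using xi x i d by (simp add: nth_eq_iff_index_eq)
      then have "p ! x = p ! (Suc i mod ?L)" "p ! (Suc x mod ?L) = p ! i"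
        using eq by (auto simp: doubleton_eq_iff)
      then have "x = Suc i mod ?L" "Suc x mod ?L = i"
        using x i lt d by (auto simp: nth_eq_iff_index_eq)
      then have "x = (if Suc i = ?L then 0 else Suc i)" "(if Suc x = ?L then 0 else Suc x) = i"
        using sx_if si_if by simp_all
      then show False using L i(1) by (auto split: if_splits)
    qed
    then have "{p ! x, p ! (Suc x mod ?L)} \<in> T" using e[OF x] i(2) by auto
    then have "(p ! x, p ! ((i + 1 + Suc j) mod ?L)) \<in> conn T" unfolding sx by (rule conn_edge)
    then show ?case using Suc by (auto simp: x_def intro: conn_trans)
  qed simp
  from this[of "?L - 1"] have "(p ! (Suc i mod ?L), p ! ((i + 1 + (?L - 1)) mod ?L)) \<in> conn T"
    using L by simp
  moreover have "(i + 1 + (?L - 1)) mod ?L = (i + ?L) mod ?L" using L by (intro arg_cong[of _ _ "\<lambda>x. x mod ?L"]) simp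
  ultimately have "(p ! (Suc i mod ?L), p ! i) \<in> conn T" using i(1) by simp
  with i(2) show ?thesis by (auto simp: doubleton_eq_iff intro: conn_sym)
qed

text \<open>Kruskal's construction, one edge at a time in the order of increasing weight.\<close>

lemma ex_minimal_spanning_forest:
  fixes \<omega> :: "'v set \<Rightarrow> real"
  assumes "finite E" "\<And>e. e \<in> E \<Longrightarrow> card e = 2"
  shows "\<exists>T\<subseteq>E. (\<nexists>p. is_cycle T p) \<and> (\<forall>t. conn {e\<in>T. \<omega> e \<le> t} = conn {e\<in>E. \<omega> e \<le> t})"
  using assms
proof (induction E rule: finite_ranking_induct[where f = \<omega>])
  case empty
  show ?case by (auto simp: is_cycle_def intro!: exI[of _ 0]) 
next
  case (insert e E)
  then obtain T where T: "T \<subseteq> E" "\<nexists>p. is_cycle T p"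
    "\<And>t. conn {e\<in>T. \<omega> e \<le> t} = conn {e\<in>E. \<omega> e \<le> t}" by auto
  obtain a b where e: "e = {a, b}" using insert.prems[of e] by (auto simp: card_2_iff)
  \<comment> \<open>The induction inserts edges by increasing weight, so at level
    \<open>\<omega> e\<close> all of \<open>T\<close> and all of \<open>E\<close> are
    present.\<close>
  have TE: "conn T = conn E"
  proof -
    have "{x\<in>T. \<omega> x \<le> \<omega> e} = T" "{x\<in>E. \<omega> x \<le> \<omega> e} = E" using insert.hyps T(1) by auto
    then show ?thesis using T(3)[of "\<omega> e"] by simp
  qed
  show ?case
  proof (cases "(a, b) \<in> conn E")
    case True
    have "conn {x\<in>T. \<omega> x \<le> t} = conn {x\<in>insert e E. \<omega> x \<le> t}" for t
    proof (cases "\<omega> e \<le> t")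
      case t: True
      then have "{x\<in>T. \<omega> x \<le> t} = T" "{x\<in>insert e E. \<omega> x \<le> t} = insert e E"
        using insert.hyps T(1) by force+
      moreover have "conn (insert e E) = conn E"
      proof
        show "conn (insert e E) \<subseteq> conn E"
          using True unfolding e by (auto dest!: conn_insert_edge) (meson conn_sym conn_trans)+
      qed (auto intro: conn_mono[THEN subsetD])
      ultimately show ?thesis using TE by simp
    next
      case False
      then have "{x\<in>insert e E. \<omega> x \<le> t} = {x\<in>E. \<omega> x \<le> t}" by auto
      then show ?thesis using T(3) by simp
    qed
    then show ?thesis using T by blast
  next
    case False
    have "conn {x\<in>insert e T. \<omega> x \<le> t} = conn {x\<in>insert e E. \<omega> x \<le> t}" for t
    proof (cases "\<omega> e \<le> t")
      case t: True
      then have "{x\<in>insert e T. \<omega> x \<le> t} = insert e T" "{x\<in>insert e E. \<omega> x \<le> t} = insert e E"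
        using insert.hyps T(1) by force+
      moreover have "conn (insert e E) \<subseteq> conn (insert e T)"
      proof
        fix z assume z: "z \<in> conn (insert e E)"
        obtain x y where xy: "z = (x, y)" by (cases z)
        have sub: "conn T \<subseteq> conn (insert e T)" by (intro conn_mono) auto
        have ab: "(a, b) \<in> conn (insert e T)" by (rule conn_edge) (simp add: e)
        have "(x, y) \<in> conn T \<or> (x, a) \<in> conn T \<and> (b, y) \<in> conn T \<or> (x, b) \<in> conn T \<and> (a, y) \<in> conn T"
          using conn_insert_edge[of x y a b E] z unfolding xy e TE by auto
        then show "z \<in> conn (insert e T)"
          unfolding xy using sub ab by (meson subsetD conn_sym conn_trans)
      qed
      moreover have "conn (insert e T) \<subseteq> conn (insert e E)" using T by (intro conn_mono) auto
      ultimately show ?thesis by auto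
    next
      case False
      then have "{x\<in>insert e E. \<omega> x \<le> t} = {x\<in>E. \<omega> x \<le> t}"
         "{x\<in>insert e T. \<omega> x \<le> t} = {x\<in>T. \<omega> x \<le> t}" by auto
      then show ?thesis using T(3) by simp
    qed
    moreover have "\<nexists>p. is_cycle (insert e T) p"
      using T(2) is_cycle_insertD[of a b T] False unfolding e TE by metis
    ultimately show ?thesis using T(1) by (intro exI[of _ "insert e T"]) auto
  qed
qed

section \<open>Spanning trees as parent maps towards a root\<close>

definition tree_of :: "'v set \<Rightarrow> 'v \<Rightarrow> ('v \<Rightarrow> 'v) \<Rightarrow> 'v set set" where
  "tree_of V r f = (\<lambda>v. {v, f v}) ` (V - {r})"

definition all_edges :: "'v set \<Rightarrow> 'v set set" where
  "all_edges V = {e. e \<subseteq> V \<and> card e = 2}"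

lemma complete_edges_all_edges: "complete_edges n = all_edges {..<n}"
  by (simp add: complete_edges_def all_edges_def complete_verts_def)

lemma finite_all_edges: "finite V \<Longrightarrow> finite (all_edges V)"
  by (rule finite_subset[of _ "Pow V"]) (auto simp: all_edges_def)

text \<open>The number of steps to the root. A height that drops by 1 along \<open>f\<close>
  excludes cycles and fixes the direction of each edge in the arguments below.\<close>

lemma forest_depth:
  assumes "f \<in> forests V {r}"
  shows "\<exists>d :: 'v \<Rightarrow> nat. \<forall>v\<in>V - {r}. d v = Suc (d (f v))"
proof -
  have ex: "ends f {r} {r} v \<Longrightarrow> \<exists>k. (f ^^ k) v = r" for v
  proof (induction rule: ends.induct)
    case (stop u)
    then show ?case by (intro exI[of _ 0]) auto
  next
    case (step u)
    then obtain k where "(f ^^ k) (f u) = r" by auto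
    then show ?case by (intro exI[of _ "Suc k"]) (simp add: funpow_swap1)
  qed
  have "(LEAST k. (f ^^ k) v = r) = Suc (LEAST k. (f ^^ k) (f v) = r)" if v: "v \<in> V - {r}" for v
  proof -
    obtain k where "(f ^^ k) v = r" using ex[of v] assms v by (auto simp: forests_def)
    then show ?thesis
      using v by (subst Least_Suc[of _ k]) (auto simp: funpow_swap1)
  qed
  then show ?thesis by (intro exI[of _ "\<lambda>v. LEAST k. (f ^^ k) v = r"]) auto
qed

lemma tree_of_edge: "{x, y} \<in> tree_of V r f \<longleftrightarrow> x \<in> V - {r} \<and> y = f x \<or> y \<in> V - {r} \<and> x = f y"
  by (auto simp: tree_of_def doubleton_eq_iff)

lemma forest_range: "f \<in> forests V R \<Longrightarrow> v \<in> V - R \<Longrightarrow> f v \<in> V"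
  by (auto simp: forests_def)

lemma tree_of_connect:
  assumes f: "f \<in> forests V {r}"
  shows "edges_connect V (tree_of V r f)"
proof -
  have "ends f {r} {r} v \<Longrightarrow> v \<in> V \<longrightarrow> (v, r) \<in> conn (tree_of V r f)" for v
  proof (induction rule: ends.induct)
    case (step u)
    show ?case
    proof
      assume u: "u \<in> V"
      then have "{u, f u} \<in> tree_of V r f" using step by (auto simp: tree_of_edge)
      then have "(u, f u) \<in> conn (tree_of V r f)" by (rule conn_edge)
      then show "(u, r) \<in> conn (tree_of V r f)"
        using step forest_range[OF f, of u] u by (auto intro: conn_trans)
    qed
  qed auto
  then have "(v, r) \<in> conn (tree_of V r f)" if "v \<in> V" for v
    using f that by (auto simp: forests_def)
  then show ?thesis unfolding edges_connect_conn by (meson conn_trans conn_sym)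
qed

text \<open>At a deepest vertex of a cycle neither cycle neighbour is deeper, so both are its
  parent, although they are distinct.\<close>

lemma tree_of_acyclic:
  assumes f: "f \<in> forests V {r}"
  shows "\<not> is_cycle (tree_of V r f) p"
proof
  assume "is_cycle (tree_of V r f) p"
  then have L: "3 \<le> length p" and dist: "distinct p"
    and e: "\<And>i. i < length p \<Longrightarrow> {p ! i, p ! (Suc i mod length p)} \<in> tree_of V r f"
    by (auto simp: is_cycle_def)
  obtain d :: "'a \<Rightarrow> nat" where d: "\<And>v. v \<in> V - {r} \<Longrightarrow> d v = Suc (d (f v))"
    using forest_depth[OF f] by auto
  let ?M = "Max ((\<lambda>i. d (p ! i)) ` {..<length p})"
  have "?M \<in> (\<lambda>i. d (p ! i)) ` {..<length p}" using L by (intro Max_in) (auto simp: lessThan_empty_iff)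
  then obtain i where i: "i < length p" "d (p ! i) = ?M" by auto
  have mx: "d (p ! j) \<le> d (p ! i)" if "j < length p" for j
    unfolding i(2) using that by (intro Max_ge) auto
  define j where "j = (if Suc i = length p then 0 else Suc i)"
  define k where "k = (if i = 0 then length p - 1 else i - 1)"
  have jk: "j < length p" "k < length p" "Suc i mod length p = j" "Suc k mod length p = i" "j \<noteq> k"
    using i(1) L by (auto simp: j_def k_def)
  have ej: "{p ! i, p ! j} \<in> tree_of V r f" using e[OF i(1)] jk by simp
  have ek: "{p ! i, p ! k} \<in> tree_of V r f" using e[OF jk(2)] jk by (simp add: insert_commute)
  have "p ! j = f (p ! i)"
    using ej mx[OF jk(1)] d[of "p ! j"] by (auto simp: tree_of_edge)
  moreover have "p ! k = f (p ! i)"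
    using ek mx[OF jk(2)] d[of "p ! k"] by (auto simp: tree_of_edge)
  ultimately show False using jk dist by (metis nth_eq_iff_index_eq)
qed

lemma inj_on_tree_of_edges:
  assumes f: "f \<in> forests V {r}"
  shows "inj_on (\<lambda>v. {v, f v}) (V - {r})"
proof (rule inj_onI)
  obtain d :: "'a \<Rightarrow> nat" where d: "\<And>v. v \<in> V - {r} \<Longrightarrow> d v = Suc (d (f v))"
    using forest_depth[OF f] by auto
  fix u v assume u: "u \<in> V - {r}" and v: "v \<in> V - {r}" and eq: "{u, f u} = {v, f v}"
  show "u = v"
  proof (rule ccontr)
    assume "u \<noteq> v"
    then have "f u = v" "f v = u" using eq by (auto simp: doubleton_eq_iff)
    then show False using d[OF u] d[OF v] by simp
  qed
qed

text \<open>Induction on the depth in \<open>f\<close>. If the edge between \<open>v\<close> and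
  \<open>f v\<close> were directed the other way in \<open>g\<close>, then
  \<open>g (f v) = v\<close>; as \<open>f v\<close> is less deep, also \<open>f (f v) = v\<close>,
  against the depth.\<close>

lemma inj_on_tree_of: "inj_on (tree_of V r) (forests V {r})"
proof (rule inj_onI)
  fix f g assume f: "f \<in> forests V {r}" and g: "g \<in> forests V {r}" and eq: "tree_of V r f = tree_of V r g"
  obtain d :: "'a \<Rightarrow> nat" where d: "\<And>v. v \<in> V - {r} \<Longrightarrow> d v = Suc (d (f v))"
    using forest_depth[OF f] by auto
  have "v \<in> V - {r} \<Longrightarrow> f v = g v" for v
  proof (induction "d v" arbitrary: v rule: less_induct)
    case less
    have "{v, f v} \<in> tree_of V r g" using less.prems unfolding eq[symmetric] by (auto simp: tree_of_edge)
    then consider "f v = g v" | "f v \<in> V - {r}" "g (f v) = v" by (auto simp: tree_of_edge)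
    then show ?case
    proof cases
      case 2
      have "f (f v) = g (f v)" using less.hyps[OF _ 2(1)] d[OF less.prems] by simp
      then show ?thesis using 2 d[OF less.prems] d[OF 2(1)] by simp
    qed
  qed
  then show "f = g" using f g by (intro PiE_ext[of f "V - {r}" "\<lambda>_. V" g]) (auto simp: forests_def)
qed

text \<open>Every vertex points to a neighbour that is nearer to \<open>r\<close> in
  \<open>T\<close>. An edge of \<open>T\<close> missed by this parent map would close a cycle with
  the simple path between its ends.\<close>

lemma tree_of_surj:
  assumes T: "T \<in> spanning_trees V (all_edges V)" and r: "r \<in> V"
  shows "\<exists>f\<in>forests V {r}. tree_of V r f = T"
proof -
  let ?R = "{(a, b). {a, b} \<in> T}"
  have con: "edges_connect V T" and acyc: "\<nexists>p. is_cycle T p" and TE: "T \<subseteq> all_edges V"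
    using T by (auto simp: spanning_trees_def)
  \<comment> \<open>The graph distance to \<open>r\<close> in \<open>T\<close>; the first step of a
    shortest path lowers it by 1.\<close>
  define N where "N v = (LEAST k. (v, r) \<in> ?R ^^ k)" for v
  have "\<exists>u. {v, u} \<in> T \<and> N v = Suc (N u)" if v: "v \<in> V - {r}" for v
  proof -
    have "(v, r) \<in> ?R\<^sup>*" using con v r by (auto simp: edges_connect_def)
    then obtain k where "(v, r) \<in> ?R ^^ k" by (auto simp: rtrancl_is_UN_relpow)
    then have 1: "(v, r) \<in> ?R ^^ (N v)" unfolding N_def by (rule LeastI)
    moreover have "N v \<noteq> 0" using 1 v by (auto intro!: gr0I)
    ultimately obtain m where m: "N v = Suc m" "(v, r) \<in> ?R ^^ Suc m" by (cases "N v") auto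
    then obtain u where u: "(v, u) \<in> ?R" "(u, r) \<in> ?R ^^ m" by (meson relpow_Suc_D2)
    have "N u \<le> m" unfolding N_def using u(2) by (rule Least_le)
    moreover have "(u, r) \<in> ?R ^^ (N u)" unfolding N_def using u(2) by (rule LeastI)
    then have "(v, r) \<in> ?R ^^ Suc (N u)" using u(1) by (rule relpow_Suc_I2[rotated])
    then have "N v \<le> Suc (N u)" unfolding N_def[of v] by (rule Least_le)
    ultimately show ?thesis using u m by auto
  qed
  then obtain h where h: "\<And>v. v \<in> V - {r} \<Longrightarrow> {v, h v} \<in> T \<and> N v = Suc (N (h v))" by metis
  define f where "f = restrict h (V - {r})"
  have fT: "{v, f v} \<in> T" and fN: "N v = Suc (N (f v))" if "v \<in> V - {r}" for v
    using h[OF that] that by (auto simp: f_def)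
  have fV: "f v \<in> V" if "v \<in> V - {r}" for v
    using fT[OF that] TE by (auto simp: all_edges_def)
  have "v \<in> V \<Longrightarrow> ends f {r} {r} v" for v
  proof (induction "N v" arbitrary: v rule: less_induct)
    case less
    show ?case
    proof (cases "v = r")
      case False
      then have v: "v \<in> V - {r}" using less.prems by auto
      have "ends f {r} {r} (f v)" by (rule less.hyps) (use fN[OF v] fV[OF v] in linarith, rule fV[OF v])
      then show ?thesis using v by (auto intro: ends.step)
    qed auto
  qed
  then have f: "f \<in> forests V {r}" using fV by (auto simp: forests_def f_def)
  have sub: "tree_of V r f \<subseteq> T" using fT by (auto simp: tree_of_def)
  have "T \<subseteq> tree_of V r f"
  proof (rule subsetI, rule ccontr)
    fix e assume e: "e \<in> T" "e \<notin> tree_of V r f"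
    obtain a b where ab: "e = {a, b}" "a \<noteq> b" "a \<in> V" "b \<in> V"
      using e TE by (auto simp: all_edges_def card_2_iff)
    have "(a, b) \<in> conn (tree_of V r f)"
      using tree_of_connect[OF f] ab by (auto simp: edges_connect_conn)
    then obtain p where p: "p \<noteq> []" "distinct p" "hd p = a" "last p = b"
        "\<And>i. Suc i < length p \<Longrightarrow> {p ! i, p ! Suc i} \<in> tree_of V r f"
      using conn_simple_path by metis
    have p0: "p ! 0 = a" "p ! (length p - 1) = b" using p by (auto simp: hd_conv_nth last_conv_nth)
    \<comment> \<open>A path with one vertex would give \<open>a = b\<close>, and one with two
      vertices would be \<open>e\<close> itself.\<close>
    have "length p \<noteq> 1" using p0 ab by auto
    moreover have "length p \<noteq> 2" using p0 p(5)[of 0] e ab by auto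
    moreover have "length p \<noteq> 0" using p(1) by simp
    ultimately have L: "3 \<le> length p" by linarith
    have "{p ! i, p ! (Suc i mod length p)} \<in> T" if i: "i < length p" for i
    proof (cases "Suc i < length p")
      case True
      then show ?thesis using p(5)[OF True] sub by auto
    next
      case False
      then have "Suc i = length p" using i by simp
      then have "i = length p - 1" "Suc i mod length p = 0" by auto
      then show ?thesis using p0 e ab by (auto simp: insert_commute)
    qed
    then have "is_cycle T p" using L p by (auto simp: is_cycle_def)
    then show False using acyc by auto
  qed
  with sub f show ?thesis by blast
qed

lemma tree_of_bij:
  assumes "r \<in> V"
  shows "bij_betw (tree_of V r) (forests V {r}) (spanning_trees V (all_edges V))"
  unfolding bij_betw_def
proof (intro conjI inj_on_tree_of set_eqI iffI)
  fix T assume "T \<in> tree_of V r ` forests V {r}"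
  then obtain f where f: "f \<in> forests V {r}" "T = tree_of V r f" by auto
  obtain d :: "'a \<Rightarrow> nat" where d: "\<And>v. v \<in> V - {r} \<Longrightarrow> d v = Suc (d (f v))"
    using forest_depth[OF f(1)] by auto
  have "v \<noteq> f v" if "v \<in> V - {r}" for v using d[OF that] by auto
  then have "T \<subseteq> all_edges V" using forest_range[OF f(1)] by (auto simp: f(2) tree_of_def all_edges_def)
  then show "T \<in> spanning_trees V (all_edges V)"
    using tree_of_connect[OF f(1)] tree_of_acyclic[OF f(1)] by (auto simp: spanning_trees_def f(2))
next
  fix T assume "T \<in> spanning_trees V (all_edges V)"
  then show "T \<in> tree_of V r ` forests V {r}" using tree_of_surj[OF _ assms] by blast
qed

lemma card_spanning_tree:
  assumes "finite V" "V \<noteq> {}" "T \<in> spanning_trees V (all_edges V)"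
  shows "Suc (card T) = card V"
proof -
  obtain r where r: "r \<in> V" using assms by auto
  then obtain f where f: "f \<in> forests V {r}" "tree_of V r f = T" using tree_of_surj assms by metis
  then have "card T = card (V - {r})"
    using card_image[OF inj_on_tree_of_edges[OF f(1)]] by (simp add: tree_of_def)
  then show ?thesis using r assms by (simp add: card_gt_0_iff Suc_diff_1)
qed

text \<open>Multiplied out like the count of forests, so that a single vertex is covered without an
  exponent n - 2.\<close>

lemma cayley:
  assumes "finite V" "V \<noteq> {}"
  shows "card V * card (spanning_trees V (all_edges V)) = card V ^ (card V - 1)"
proof -
  obtain r where r: "r \<in> V" using assms by auto
  show ?thesis using card_forests[OF assms(1) r] bij_betw_same_card[OF tree_of_bij[OF r]] by simp
qed

text \<open>Parent maps have no fixed points, so the weight can be cleared on the diagonal; the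
  associated walk then makes no idle steps, as the escape estimate demands.\<close>

lemma sum_spanning_trees:
  assumes r: "r \<in> V" and "finite V"
  shows "(\<Sum>T\<in>spanning_trees V (all_edges V). \<Prod>e\<in>T. w e) =
    forest_sum (\<lambda>u v. if u = v then 0 else w {u, v}) V {r}"
proof -
  have "(\<Prod>e\<in>tree_of V r f. w e) = forest_weight (\<lambda>u v. if u = v then 0 else w {u, v}) V {r} f"
    if f: "f \<in> forests V {r}" for f
  proof -
    obtain d :: "'a \<Rightarrow> nat" where d: "\<And>v. v \<in> V - {r} \<Longrightarrow> d v = Suc (d (f v))"
      using forest_depth[OF f] by auto
    have ne: "v \<noteq> f v" if "v \<in> V - {r}" for v using d[OF that] by auto
    show ?thesis
      unfolding tree_of_def forest_weight_def prod.reindex[OF inj_on_tree_of_edges[OF f]]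
      using ne by (intro prod.cong) auto
  qed
  then show ?thesis
    unfolding forest_sum_def by (subst sum.reindex_bij_betw[OF tree_of_bij[OF r], symmetric]) auto
qed

section \<open>Counting components\<close>

definition component :: "'v set \<Rightarrow> 'v set set \<Rightarrow> 'v \<Rightarrow> 'v set" where
  "component V H u = {v\<in>V. (u, v) \<in> conn H}"

definition components :: "'v set \<Rightarrow> 'v set set \<Rightarrow> 'v set set" where
  "components V H = component V H ` V"

lemma component_eq_iff: "u \<in> V \<Longrightarrow> component V H u = component V H v \<longleftrightarrow> (v, u) \<in> conn H"
  unfolding component_def set_eq_iff by (metis (mono_tags, lifting) conn_refl conn_sym conn_trans mem_Collect_eq)

lemma finite_components: "finite V \<Longrightarrow> finite (components V H)"
  by (simp add: components_def)

lemma comps_empty: "card (components V {}) = card V"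
proof -
  have "components V {} = (\<lambda>u. {u}) ` V" unfolding components_def
    by (intro image_cong) (auto simp: component_def conn_def)
  then show ?thesis by (simp add: card_image)
qed

lemma comps_connected:
  assumes "V \<noteq> {}" "edges_connect V H"
  shows "card (components V H) = 1"
proof -
  have "component V H u = V" if "u \<in> V" for u using assms that by (auto simp: component_def edges_connect_conn)
  then have "components V H = {V}" using assms(1) by (auto simp: components_def)
  then show ?thesis by simp
qed

text \<open>A component is sent to the component, in the enlarged graph, of a chosen representative.
  Only the classes of \<open>a\<close> and \<open>b\<close> can merge, so leaving out the class of
  \<open>a\<close> makes this map injective.\<close>

lemma card_components_insert:
  assumes "finite V"
  shows "card (components V H) \<le> card (components V (insert {a, b} H)) + 1"
proof -
  let ?C = "component V H" and ?C' = "component V (insert {a, b} H)"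
  define s where "s X = (SOME u. u \<in> V \<and> ?C u = X)" for X
  have s: "s X \<in> V \<and> ?C (s X) = X" if "X \<in> components V H" for X
    unfolding s_def by (rule someI_ex) (use that in \<open>auto simp: components_def\<close>)
  have "inj_on (\<lambda>X. ?C' (s X)) (components V H - {?C a})"
  proof (rule inj_onI)
    fix X Y assume X: "X \<in> components V H - {?C a}" and Y: "Y \<in> components V H - {?C a}"
      and eq: "?C' (s X) = ?C' (s Y)"
    have sX: "s X \<in> V" "?C (s X) = X" and sY: "s Y \<in> V" "?C (s Y) = Y" using s X Y by auto
    have nX: "(a, s X) \<notin> conn H" using sX X component_eq_iff by (metis DiffD2 insertI1)
    have nY: "(a, s Y) \<notin> conn H" using sY Y component_eq_iff by (metis DiffD2 insertI1)
    have "(s Y, s X) \<in> conn (insert {a, b} H)" using eq sX(1) component_eq_iff by metis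
    then have "(s Y, s X) \<in> conn H" using nX nY conn_insert_edge conn_sym by metis
    then show "X = Y" using component_eq_iff sX sY by metis
  qed
  moreover have "(\<lambda>X. ?C' (s X)) ` (components V H - {?C a}) \<subseteq> components V (insert {a, b} H)"
    using s by (auto simp: components_def[of V "insert _ _"])
  ultimately have "card (components V H - {?C a}) \<le> card (components V (insert {a, b} H))"
    using assms by (intro card_inj_on_le) (auto simp: finite_components)
  moreover have "card (components V H) \<le> card (components V H - {?C a}) + 1"
    using diff_card_le_card_Diff[of "{?C a}" "components V H"] by simp
  ultimately show ?thesis by simp
qed

text \<open>Turns component counts into edge counts in two ways: it bounds from below the edges of
  any spanning tree above a level, and those of the minimal tree up to that level.\<close>

lemma card_components_Un:
  assumes "finite V" "finite F" "\<And>e. e \<in> F \<Longrightarrow> card e = 2"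
  shows "card (components V H) \<le> card (components V (H \<union> F)) + card F"
  using assms(2,3)
proof (induction F rule: finite_induct)
  case (insert e F)
  obtain a b where e: "e = {a, b}" using insert.prems[of e] by (auto simp: card_2_iff)
  have "card (components V H) \<le> card (components V (H \<union> F)) + card F" using insert by auto
  also have "card (components V (H \<union> F)) \<le> card (components V (H \<union> insert e F)) + 1"
    using card_components_insert[OF assms(1), of "H \<union> F" a b] by (simp add: e)
  finally show ?case using insert by simp
qed simp


section \<open>The random environment\<close>

abbreviation unif :: "real measure" where
  "unif \<equiv> uniform_measure lborel {0..1}"

lemma prob_space_unif: "prob_space unif"
  by (rule prob_space_uniform_measure) auto

lemma integral_unif:
  fixes f :: "real \<Rightarrow> real"
  assumes "f \<in> borel_measurable borel"
  shows "(\<integral>x. f x \<partial>unif) = (\<integral>x. f x * indicator {0..1} x \<partial>lborel)"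
proof -
  have "unif = density lborel (\<lambda>x. ennreal (indicator {0..1} x))"
    unfolding uniform_measure_def
    by (intro density_cong) (auto simp: divide_ennreal_def split: split_indicator)
  then show ?thesis using assms by (simp add: integral_density mult.commute)
qed

lemma integral_unif_FTC:
  fixes f F :: "real \<Rightarrow> real"
  assumes "\<And>x. 0 \<le> x \<Longrightarrow> x \<le> 1 \<Longrightarrow> (F has_real_derivative f x) (at x)" "continuous_on UNIV f"
  shows "(\<integral>x. f x \<partial>unif) = F 1 - F 0"
proof -
  have "(\<integral>x. f x \<partial>unif) = (\<integral>x. f x * indicator {0..1} x \<partial>lborel)"
    using assms(2) by (intro integral_unif borel_measurable_continuous_onI) auto
  also have "\<dots> = F 1 - F 0"
    using assms by (intro integral_FTC_Icc_real) (auto simp: continuous_on_eq_continuous_at)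
  finally show ?thesis .
qed

lemma AE_unif: "AE x in unif. 0 \<le> x \<and> x \<le> 1"
  by (rule AE_uniform_measureI) auto

lemma integrable_unif:
  fixes f :: "real \<Rightarrow> real"
  assumes "f \<in> borel_measurable borel" "\<And>x. 0 \<le> x \<Longrightarrow> x \<le> 1 \<Longrightarrow> \<bar>f x\<bar> \<le> B"
  shows "integrable unif f"
proof -
  interpret prob_space unif by (rule prob_space_unif)
  show ?thesis
    by (rule integrable_const_bound[of _ B])
      (use AE_unif in eventually_elim, use assms in auto)
qed

lemma integrable_unif_continuous:
  fixes f :: "real \<Rightarrow> real"
  assumes "continuous_on UNIV f"
  shows "integrable unif f"
proof -
  have "compact (f ` {0..1})" using assms by (intro compact_continuous_image) (auto intro: continuous_on_subset)
  then obtain B where "\<And>x. x \<in> {0..1} \<Longrightarrow> \<bar>f x\<bar> \<le> B"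
    using compact_imp_bounded bounded_iff by (metis image_eqI real_norm_def)
  then show ?thesis using assms by (intro integrable_unif borel_measurable_continuous_onI) auto
qed

lemma measure_unif_less:
  assumes "0 \<le> m" "m \<le> 1"
  shows "measure unif {..<m} = m" "measure unif {m<..} = 1 - m" "measure unif {..m} = m"
proof -
  have *: "measure unif A = measure lborel ({0..1} \<inter> A)" if "A \<in> sets borel" for A
    using that by (subst measure_uniform_measure) auto
  have 1: "{0..1} \<inter> {..<m} = {0..<m}" and 2: "{0..1} \<inter> {m<..} = {m<..1}" and 3: "{0..1} \<inter> {..m} = {0..m}"
    using assms by auto
  show "measure unif {..<m} = m" by (subst *; (subst 1)?) (use assms in auto)
  show "measure unif {m<..} = 1 - m" by (subst *; (subst 2)?) (use assms in auto)
  show "measure unif {..m} = m" by (subst *; (subst 3)?) (use assms in auto)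
qed

lemma integral_unif_of_bool:
  assumes "0 \<le> m" "m \<le> 1"
  shows "(\<integral>t. of_bool (t < m) \<partial>unif) = m" "(\<integral>t. of_bool (m < t) \<partial>unif) = 1 - m" "(\<integral>t. of_bool (t \<le> m) \<partial>unif) = m"
proof -
  interpret prob_space unif by (rule prob_space_unif)
  have "(\<lambda>t. of_bool (t < m)) = (indicator {..<m} :: real \<Rightarrow> real)"
    "(\<lambda>t. of_bool (m < t)) = (indicator {m<..} :: real \<Rightarrow> real)"
    "(\<lambda>t. of_bool (t \<le> m)) = (indicator {..m} :: real \<Rightarrow> real)"
    by (auto split: split_indicator)
  then show "(\<integral>t. of_bool (t < m) \<partial>unif) = m" "(\<integral>t. of_bool (m < t) \<partial>unif) = 1 - m" "(\<integral>t. of_bool (t \<le> m) \<partial>unif) = m"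
    using measure_unif_less[OF assms] by simp_all
qed

text \<open>The Beta function at integers, by parts: the derivative of t^(a+1) (1 - t)^(b+1)
  integrates to 0, which trades a power of t for a power of 1 - t.\<close>

lemma integral_unif_beta:
  "(\<integral>t. t ^ a * (1 - t) ^ b \<partial>unif) = fact a * fact b / fact (a + b + 1)"
proof (induction a arbitrary: b)
  case 0
  have "(\<integral>t. (1 - t) ^ b \<partial>unif) = - ((1 - 1) ^ Suc b / Suc b) - (- ((1 - 0) ^ Suc b / Suc b))"
    by (rule integral_unif_FTC[where F = "\<lambda>t. - ((1 - t) ^ Suc b / Suc b)"])
      (auto intro!: derivative_eq_intros continuous_intros simp del: power_Suc)
  then show ?case by (simp add: divide_simps)
next
  case (Suc a)
  let ?I = "\<lambda>a b. \<integral>t. t ^ a * (1 - t) ^ b \<partial>unif"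
  have "(\<integral>t. Suc a * (t ^ a * (1 - t) ^ Suc b) - Suc b * (t ^ Suc a * (1 - t) ^ b) \<partial>unif) =
      1 ^ Suc a * (1 - 1) ^ Suc b - 0 ^ Suc a * (1 - 0) ^ Suc b"
    by (rule integral_unif_FTC[where F = "\<lambda>t. t ^ Suc a * (1 - t) ^ Suc b"])
      (auto intro!: derivative_eq_intros continuous_intros simp: algebra_simps simp del: power_Suc of_nat_Suc)
  moreover have i: "integrable unif (\<lambda>t. t ^ a * (1 - t) ^ b)" for a b
    by (intro integrable_unif_continuous continuous_intros)
  moreover have "(\<integral>t. Suc a * (t ^ a * (1 - t) ^ Suc b) - Suc b * (t ^ Suc a * (1 - t) ^ b) \<partial>unif) =
      Suc a * ?I a (Suc b) - Suc b * ?I (Suc a) b"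
    by (simp only: Bochner_Integration.integral_diff[OF integrable_mult_right[OF i] integrable_mult_right[OF i]]
        integral_mult_right_zero)
  ultimately have "Suc b * ?I (Suc a) b = Suc a * ?I a (Suc b)" by simp
  then have "?I (Suc a) b = Suc a * ?I a (Suc b) / Suc b" by (simp add: field_simps del: power_Suc)
  also have "\<dots> = fact (Suc a) * fact b / fact (Suc a + b + 1)"
  proof -
    have "fact (Suc b) = Suc b * (fact b :: real)" "fact (Suc a) = Suc a * (fact a :: real)"
      "a + Suc b + 1 = Suc a + b + 1" by simp_all
    then show ?thesis unfolding Suc by (simp del: of_nat_Suc fact_Suc)
  qed
  finally show ?case .
qed

section \<open>Independent edges: products, second moments and minima\<close>

lemma env_component_measurable:
  "e \<in> complete_edges n \<Longrightarrow> (\<lambda>\<omega>. \<omega> e) \<in> borel_measurable (env_measure n)"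
proof -
  assume "e \<in> complete_edges n"
  then have "(\<lambda>\<omega>. \<omega> e) \<in> env_measure n \<rightarrow>\<^sub>M unif"
    unfolding env_measure_def by (rule measurable_component_singleton)
  then show ?thesis by (simp cong: measurable_cong_sets)
qed

lemma AE_env: "AE \<omega> in env_measure n. \<forall>e\<in>complete_edges n. 0 \<le> \<omega> e \<and> \<omega> e \<le> 1"
proof (rule AE_finite_allI)
  show "finite (complete_edges n)" by (rule finite_complete_edges)
  fix e assume "e \<in> complete_edges n"
  then show "AE \<omega> in env_measure n. 0 \<le> \<omega> e \<and> \<omega> e \<le> 1"
    unfolding env_measure_def using AE_unif
    by (intro AE_PiM_component[where P = "\<lambda>x. 0 \<le> x \<and> x \<le> 1"] prob_space_unif) auto
qed

text \<open>Measurability is joint in level and environment, as the exchange of the two integrals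
  requires; the component events below all have this form.\<close>

lemma env_threshold_measurable:
  assumes "F \<subseteq> complete_edges n" "F' \<subseteq> complete_edges n"
  shows "(\<lambda>x. of_bool ((\<forall>e\<in>F. snd x e \<le> fst x) \<and> (\<forall>e\<in>F'. fst x < snd x e)) :: real)
    \<in> borel_measurable (unif \<Otimes>\<^sub>M env_measure n)"
proof -
  have edge: "(\<lambda>x. snd x e) \<in> borel_measurable (unif \<Otimes>\<^sub>M env_measure n)" if "e \<in> complete_edges n" for e
    using that by (intro measurable_compose[OF measurable_snd env_component_measurable])
  have fin: "finite F" "finite F'" using assms finite_complete_edges finite_subset by blast+
  have [measurable]: "Measurable.pred (unif \<Otimes>\<^sub>M env_measure n) (\<lambda>x. \<forall>e\<in>F. snd x e \<le> fst x)"
  proof (rule pred_intros_finite(3)[OF fin(1)])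
    fix e assume "e \<in> F"
    then have [measurable]: "(\<lambda>x. snd x e) \<in> borel_measurable (unif \<Otimes>\<^sub>M env_measure n)"
      using assms by (intro edge) auto
    show "Measurable.pred (unif \<Otimes>\<^sub>M env_measure n) (\<lambda>x. snd x e \<le> fst x)" by measurable
  qed
  have [measurable]: "Measurable.pred (unif \<Otimes>\<^sub>M env_measure n) (\<lambda>x. \<forall>e\<in>F'. fst x < snd x e)"
  proof (rule pred_intros_finite(3)[OF fin(2)])
    fix e assume "e \<in> F'"
    then have [measurable]: "(\<lambda>x. snd x e) \<in> borel_measurable (unif \<Otimes>\<^sub>M env_measure n)"
      using assms by (intro edge) auto
    show "Measurable.pred (unif \<Otimes>\<^sub>M env_measure n) (\<lambda>x. fst x < snd x e)" by measurable
  qed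
  show ?thesis by measurable
qed

lemma env_prod:
  fixes f :: "nat set \<Rightarrow> real \<Rightarrow> real"
  assumes "J \<subseteq> complete_edges n" "\<And>e. e \<in> J \<Longrightarrow> integrable unif (f e)"
  shows "integrable (env_measure n) (\<lambda>\<omega>. \<Prod>e\<in>J. f e (\<omega> e))"
    and "(\<integral>\<omega>. (\<Prod>e\<in>J. f e (\<omega> e)) \<partial>env_measure n) = (\<Prod>e\<in>J. \<integral>x. f e x \<partial>unif)"
proof -
  interpret U: prob_space unif by (rule prob_space_unif)
  interpret product_prob_space "\<lambda>_ :: nat set. unif" "complete_edges n" by unfold_locales
  \<comment> \<open>Padding by the constant 1 outside \<open>J\<close> brings in the product formula
    for the whole measure.\<close>
  define g where "g e = (if e \<in> J then f e else (\<lambda>_. 1))" for e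
  have g: "integrable unif (g e)" for e using assms by (auto simp: g_def)
  have eq: "(\<Prod>e\<in>J. f e (\<omega> e)) = (\<Prod>e\<in>complete_edges n. g e (\<omega> e))" for \<omega>
    using assms by (intro prod.mono_neutral_cong_left finite_complete_edges) (auto simp: g_def)
  show "integrable (env_measure n) (\<lambda>\<omega>. \<Prod>e\<in>J. f e (\<omega> e))"
    unfolding eq env_measure_def by (intro product_integrable_prod finite_complete_edges g)
  have "(\<integral>\<omega>. (\<Prod>e\<in>J. f e (\<omega> e)) \<partial>env_measure n) = (\<Prod>e\<in>complete_edges n. \<integral>x. g e x \<partial>unif)"
    unfolding eq env_measure_def by (intro product_integral_prod finite_complete_edges g)
  also have "\<dots> = (\<Prod>e\<in>J. \<integral>x. f e x \<partial>unif)"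
    using assms by (intro prod.mono_neutral_cong_right finite_complete_edges) (auto simp: g_def U.prob_space)
  finally show "(\<integral>\<omega>. (\<Prod>e\<in>J. f e (\<omega> e)) \<partial>env_measure n) = (\<Prod>e\<in>J. \<integral>x. f e x \<partial>unif)" .
qed

lemma env_single:
  fixes f :: "real \<Rightarrow> real"
  assumes "e \<in> complete_edges n" "integrable unif f"
  shows "integrable (env_measure n) (\<lambda>\<omega>. f (\<omega> e))"
    and "(\<integral>\<omega>. f (\<omega> e) \<partial>env_measure n) = (\<integral>x. f x \<partial>unif)"
  using env_prod[of "{e}" n "\<lambda>_. f"] assms by simp_all

lemma env_pair:
  fixes f g :: "real \<Rightarrow> real"
  assumes "e \<in> complete_edges n" "e' \<in> complete_edges n" "e \<noteq> e'" "integrable unif f" "integrable unif g"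
  shows "integrable (env_measure n) (\<lambda>\<omega>. f (\<omega> e) * g (\<omega> e'))"
    and "(\<integral>\<omega>. f (\<omega> e) * g (\<omega> e') \<partial>env_measure n) = (\<integral>x. f x \<partial>unif) * (\<integral>x. g x \<partial>unif)"
  using env_prod[of "{e, e'}" n "\<lambda>i. if i = e then f else g"] assms by auto

lemma env_pattern:
  assumes "F \<subseteq> complete_edges n" "F' \<subseteq> complete_edges n" "F \<inter> F' = {}" "0 \<le> t" "t \<le> 1"
  shows "(\<integral>\<omega>. of_bool ((\<forall>e\<in>F. \<omega> e \<le> t) \<and> (\<forall>e\<in>F'. t < \<omega> e)) \<partial>env_measure n) =
    t ^ card F * (1 - t) ^ card F'"
proof -
  let ?f = "\<lambda>e x. if e \<in> F then of_bool (x \<le> t) else (of_bool (t < x) :: real)"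
  have fin: "finite F" "finite F'" using assms finite_complete_edges finite_subset by blast+
  have eq: "of_bool ((\<forall>e\<in>F. \<omega> e \<le> t) \<and> (\<forall>e\<in>F'. t < \<omega> e)) = (\<Prod>e\<in>F \<union> F'. ?f e (\<omega> e))" for \<omega>
  proof -
    have "(\<Prod>e\<in>F \<union> F'. ?f e (\<omega> e)) = (\<Prod>e\<in>F. of_bool (\<omega> e \<le> t)) * (\<Prod>e\<in>F'. of_bool (t < \<omega> e))"
      using fin assms(3) by (subst prod.union_disjoint) (auto intro!: arg_cong2[of _ _ _ _ "(*)"] prod.cong)
    also have "(\<Prod>e\<in>F. of_bool (\<omega> e \<le> t)) = (of_bool (\<forall>e\<in>F. \<omega> e \<le> t) :: real)"
      using fin(1) by (induction F rule: finite_induct) auto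
    also have "(\<Prod>e\<in>F'. of_bool (t < \<omega> e)) = (of_bool (\<forall>e\<in>F'. t < \<omega> e) :: real)"
      using fin(2) by (induction F' rule: finite_induct) auto
    finally show ?thesis by simp
  qed
  have "(\<integral>\<omega>. of_bool ((\<forall>e\<in>F. \<omega> e \<le> t) \<and> (\<forall>e\<in>F'. t < \<omega> e)) \<partial>env_measure n) =
      (\<Prod>e\<in>F \<union> F'. \<integral>x. ?f e x \<partial>unif)"
    unfolding eq by (rule env_prod) (use assms in \<open>auto intro!: integrable_unif[of _ 1]\<close>)
  also have "\<dots> = (\<Prod>e\<in>F. \<integral>x. ?f e x \<partial>unif) * (\<Prod>e\<in>F'. \<integral>x. ?f e x \<partial>unif)"
    using fin assms(3) by (intro prod.union_disjoint)
  also have "(\<Prod>e\<in>F. \<integral>x. ?f e x \<partial>unif) = t ^ card F"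
    using integral_unif_of_bool[OF assms(4,5)] by simp
  also have "(\<Prod>e\<in>F'. \<integral>x. ?f e x \<partial>unif) = (\<Prod>e\<in>F'. 1 - t)"
  proof (rule prod.cong[OF refl])
    fix e assume "e \<in> F'"
    then have "e \<notin> F" using assms(3) by auto
    then show "(\<integral>x. ?f e x \<partial>unif) = 1 - t" using integral_unif_of_bool[OF assms(4,5)] by simp
  qed
  finally show ?thesis by simp
qed

text \<open>Independence leaves only the diagonal terms, and a variable with values in [0, 1] has
  variance at most its mean because f^2 <= f.\<close>

lemma env_sum_deviation:
  fixes f :: "real \<Rightarrow> real" and \<mu> :: real
  assumes D: "D \<subseteq> complete_edges n" and f: "f \<in> borel_measurable borel" "\<And>x. 0 \<le> x \<Longrightarrow> x \<le> 1 \<Longrightarrow> 0 \<le> f x \<and> f x \<le> 1"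
  defines "\<mu> \<equiv> \<integral>x. f x \<partial>unif"
  shows "integrable (env_measure n) (\<lambda>\<omega>. ((\<Sum>e\<in>D. f (\<omega> e)) - card D * \<mu>)\<^sup>2)"
    and "(\<integral>\<omega>. ((\<Sum>e\<in>D. f (\<omega> e)) - card D * \<mu>)\<^sup>2 \<partial>env_measure n) \<le> card D * \<mu>"
proof -
  interpret U: prob_space unif by (rule prob_space_unif)
  have fin: "finite D" using D finite_complete_edges finite_subset by blast
  define g where "g x = f x - \<mu>" for x
  have intf: "integrable unif f" by (rule integrable_unif[of _ 1]) (use f in \<open>auto simp: abs_le_iff intro: order_trans\<close>)
  then have intg: "integrable unif g" unfolding g_def by auto
  have int2: "integrable unif (\<lambda>x. f x * f x)"
  proof (rule integrable_unif[of _ 1])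
    fix x :: real assume "0 \<le> x" "x \<le> 1"
    then have "0 \<le> f x" "f x \<le> 1" using f by auto
    then have "f x * f x \<le> 1 * 1" by (intro mult_mono) auto
    then show "\<bar>f x * f x\<bar> \<le> 1" by simp
  qed (use f in measurable)
  have gg: "(\<lambda>x. g x * g x) = (\<lambda>x. f x * f x - 2 * \<mu> * f x + \<mu> * \<mu>)"
    by (auto simp: g_def algebra_simps)
  have intgg: "integrable unif (\<lambda>x. g x * g x)" unfolding gg using intf int2 by auto
  have Eg: "(\<integral>x. g x \<partial>unif) = 0" unfolding g_def using intf by (simp add: \<mu>_def U.prob_space)
  have "(\<integral>x. f x * f x \<partial>unif) \<le> (\<integral>x. f x \<partial>unif)"
  proof (rule integral_mono_AE[OF int2 intf])
    show "AE x in unif. f x * f x \<le> f x"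
      using AE_unif by eventually_elim (use f(2) in \<open>auto simp: mult_left_le\<close>)
  qed
  moreover have "(\<integral>x. g x * g x \<partial>unif) = (\<integral>x. f x * f x \<partial>unif) - \<mu> * \<mu>"
    unfolding gg using intf int2 by (simp add: \<mu>_def U.prob_space)
  ultimately have Egg: "(\<integral>x. g x * g x \<partial>unif) \<le> \<mu>" unfolding \<mu>_def by (smt (verit) zero_le_square)
  have eq: "((\<Sum>e\<in>D. f (\<omega> e)) - card D * \<mu>)\<^sup>2 = (\<Sum>e\<in>D. \<Sum>e'\<in>D. g (\<omega> e) * g (\<omega> e'))" for \<omega> :: environment
    by (simp add: g_def power2_eq_square sum_product[symmetric] sum_subtractf)
  have int: "integrable (env_measure n) (\<lambda>\<omega>. g (\<omega> e) * g (\<omega> e'))" if "e \<in> D" "e' \<in> D" for e e'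
    using env_pair(1)[of e n e' g g] env_single(1)[of e n "\<lambda>x. g x * g x"] intg intgg that D
    by (cases "e = e'") auto
  show "integrable (env_measure n) (\<lambda>\<omega>. ((\<Sum>e\<in>D. f (\<omega> e)) - card D * \<mu>)\<^sup>2)"
    unfolding eq using int by auto
  have "(\<integral>\<omega>. ((\<Sum>e\<in>D. f (\<omega> e)) - card D * \<mu>)\<^sup>2 \<partial>env_measure n) =
      (\<Sum>e\<in>D. \<Sum>e'\<in>D. \<integral>\<omega>. g (\<omega> e) * g (\<omega> e') \<partial>env_measure n)"
    unfolding eq using int by (simp add: Bochner_Integration.integral_sum)
  also have "\<dots> = (\<Sum>e\<in>D. \<Sum>e'\<in>D. if e' = e then \<integral>x. g x * g x \<partial>unif else 0)"
  proof (intro sum.cong refl)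
    fix e e' assume "e \<in> D" "e' \<in> D"
    then show "(\<integral>\<omega>. g (\<omega> e) * g (\<omega> e') \<partial>env_measure n) = (if e' = e then \<integral>x. g x * g x \<partial>unif else 0)"
      using env_pair(2)[of e n e' g g] env_single(2)[of e n "\<lambda>x. g x * g x"] intg intgg D Eg by auto
  qed
  also have "\<dots> = card D * (\<integral>x. g x * g x \<partial>unif)" using fin by simp
  also have "\<dots> \<le> card D * \<mu>" using Egg by (intro mult_left_mono) auto
  finally show "(\<integral>\<omega>. ((\<Sum>e\<in>D. f (\<omega> e)) - card D * \<mu>)\<^sup>2 \<partial>env_measure n) \<le> card D * \<mu>" .
qed

lemma env_unif_Fubini:
  fixes g :: "real \<Rightarrow> environment \<Rightarrow> real"
  assumes meas: "(\<lambda>(t, \<omega>). g t \<omega>) \<in> borel_measurable (unif \<Otimes>\<^sub>M env_measure n)"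
    and bound: "\<And>t \<omega>. \<bar>g t \<omega>\<bar> \<le> B"
  shows "integrable (env_measure n) (\<lambda>\<omega>. \<integral>t. g t \<omega> \<partial>unif)"
    and "integrable unif (\<lambda>t. \<integral>\<omega>. g t \<omega> \<partial>env_measure n)"
    and "(\<integral>\<omega>. (\<integral>t. g t \<omega> \<partial>unif) \<partial>env_measure n) = (\<integral>t. (\<integral>\<omega>. g t \<omega> \<partial>env_measure n) \<partial>unif)"
proof -
  interpret U: prob_space unif by (rule prob_space_unif)
  interpret P: prob_space "env_measure n" by (rule prob_space_env_measure)
  interpret UP: pair_prob_space unif "env_measure n" ..
  have int: "integrable (unif \<Otimes>\<^sub>M env_measure n) (\<lambda>(t, \<omega>). g t \<omega>)"
    by (rule UP.P.integrable_const_bound[of _ B]) (use meas bound in auto)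
  show "integrable (env_measure n) (\<lambda>\<omega>. \<integral>t. g t \<omega> \<partial>unif)"
    using UP.integrable_snd[OF int] by simp
  show "integrable unif (\<lambda>t. \<integral>\<omega>. g t \<omega> \<partial>env_measure n)"
    using UP.integrable_fst[OF int] by simp
  show "(\<integral>\<omega>. (\<integral>t. g t \<omega> \<partial>unif) \<partial>env_measure n) = (\<integral>t. (\<integral>\<omega>. g t \<omega> \<partial>env_measure n) \<partial>unif)"
    using UP.Fubini_integral[OF int] by simp
qed

text \<open>A minimum is the measure of the levels below it; after exchanging the integrals, (1 -
  t)^|D| is integrated over t. It prices the attachment of a vertex through its cheapest
  edge.\<close>

lemma env_min:
  assumes D: "D \<subseteq> complete_edges n" "D \<noteq> {}"
  shows "integrable (env_measure n) (\<lambda>\<omega>. Min (\<omega> ` D))"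
    and "(\<integral>\<omega>. Min (\<omega> ` D) \<partial>env_measure n) = 1 / (card D + 1)"
proof -
  interpret P: prob_space "env_measure n" by (rule prob_space_env_measure)
  have fin: "finite D" using D finite_complete_edges finite_subset by blast
  let ?g = "\<lambda>t \<omega>. of_bool (\<forall>e\<in>D. t < \<omega> e) :: real"
  have meas: "(\<lambda>(t, \<omega>). ?g t \<omega>) \<in> borel_measurable (unif \<Otimes>\<^sub>M env_measure n)"
    using env_threshold_measurable[OF empty_subsetI D(1)] by (simp add: case_prod_unfold)
  have AEmin: "AE \<omega> in env_measure n. (\<integral>t. ?g t \<omega> \<partial>unif) = Min (\<omega> ` D)"
    using AE_env
  proof eventually_elim
    case (elim \<omega>)
    have "Min (\<omega> ` D) \<in> \<omega> ` D" using D fin by (intro Min_in) auto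
    then have "0 \<le> Min (\<omega> ` D)" "Min (\<omega> ` D) \<le> 1" using elim D by auto
    moreover have "(\<forall>e\<in>D. t < \<omega> e) \<longleftrightarrow> t < Min (\<omega> ` D)" for t using D fin by (subst Min_gr_iff) auto
    ultimately show ?case using integral_unif_of_bool(1) by simp
  qed
  have mm: "(\<lambda>\<omega>. Min (\<omega> ` D)) \<in> borel_measurable (env_measure n)"
    using D fin by (intro borel_measurable_Min env_component_measurable) auto
  note F = env_unif_Fubini[OF meas, of 1]
  have 1: "integrable (env_measure n) (\<lambda>\<omega>. \<integral>t. ?g t \<omega> \<partial>unif)" by (rule F) auto
  show "integrable (env_measure n) (\<lambda>\<omega>. Min (\<omega> ` D))"
    by (rule Bochner_Integration.integrable_cong_AE_imp[OF 1 mm]) (use AEmin in auto)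
  have "(\<integral>\<omega>. Min (\<omega> ` D) \<partial>env_measure n) = (\<integral>\<omega>. (\<integral>t. ?g t \<omega> \<partial>unif) \<partial>env_measure n)"
    by (rule integral_cong_AE) (use AEmin mm 1 in \<open>auto simp: eq_commute\<close>)
  also have "\<dots> = (\<integral>t. (\<integral>\<omega>. ?g t \<omega> \<partial>env_measure n) \<partial>unif)"
    by (rule F) auto
  also have "\<dots> = (\<integral>t. (1 - t) ^ card D \<partial>unif)"
  proof (rule integral_cong_AE)
    show "(\<lambda>t. \<integral>\<omega>. ?g t \<omega> \<partial>env_measure n) \<in> borel_measurable unif"
      using F(2) by (simp add: borel_measurable_integrable)
    show "AE t in unif. (\<integral>\<omega>. ?g t \<omega> \<partial>env_measure n) = (1 - t) ^ card D"
      using AE_unif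
    proof eventually_elim
      case (elim t)
      then show ?case using env_pattern[of "{}" n D t] D by simp
    qed
  qed (simp add: borel_measurable_integrable[OF integrable_unif_continuous] continuous_intros)
  also have "\<dots> = 1 / (card D + 1)" using integral_unif_beta[of 0 "card D"] by simp
  finally show "(\<integral>\<omega>. Min (\<omega> ` D) \<partial>env_measure n) = 1 / (card D + 1)" .
qed

section \<open>Convergence in mean\<close>

text \<open>With \<open>\<delta>\<close> of the order sqrt E, Markov's inequality bounds the
  exceptional probability by \<open>\<delta>\<close> itself. The summand 1 / (n + 1) keeps
  \<open>\<delta>\<close> positive where the error \<open>E\<close> vanishes.\<close>

lemma mean_convergence_imp:
  fixes M :: "nat \<Rightarrow> 'a measure" and X :: "nat \<Rightarrow> 'a \<Rightarrow> real"
  assumes prob: "\<And>n. prob_space (M n)" and int: "\<And>n. integrable (M n) (X n)"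
    and lim: "(\<lambda>n. \<integral>x. \<bar>X n x / a n - 1\<bar> \<partial>M n) \<longlonglongrightarrow> 0"
    and nz: "eventually (\<lambda>n. a n \<noteq> 0) sequentially"
  shows "whp_asymp_equiv M X a" "(\<lambda>n. \<integral>x. X n x \<partial>M n) \<sim>[sequentially] a"
proof -
  define E where "E n = (\<integral>x. \<bar>X n x / a n - 1\<bar> \<partial>M n)" for n
  have intE: "integrable (M n) (\<lambda>x. \<bar>X n x / a n - 1\<bar>)" for n
  proof -
    interpret prob_space "M n" by (rule prob)
    show ?thesis using int[of n] by auto
  qed
  have E0: "0 \<le> E n" for n unfolding E_def by simp
  define \<delta> where "\<delta> n = sqrt (E n + 1 / real (Suc n))" for n
  have \<delta>0: "0 < \<delta> n" for n using E0[of n] by (auto simp: \<delta>_def intro!: add_nonneg_pos)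
  have "(\<lambda>n. E n + 1 / real (Suc n)) \<longlonglongrightarrow> 0 + 0"
    using lim unfolding E_def by (intro tendsto_add LIMSEQ_Suc[OF lim_1_over_n])
  then have \<delta>: "\<delta> \<longlonglongrightarrow> 0" unfolding \<delta>_def using tendsto_real_sqrt by fastforce
  have lower: "1 - \<delta> n \<le> measure (M n) {x\<in>space (M n). \<bar>X n x / a n - 1\<bar> \<le> \<delta> n}" for n
  proof -
    interpret prob_space "M n" by (rule prob)
    have [measurable]: "X n \<in> borel_measurable (M n)" using int[of n] by auto
    let ?A = "{x\<in>space (M n). \<bar>X n x / a n - 1\<bar> \<ge> \<delta> n}"
    have "measure (M n) ?A \<le> E n / \<delta> n"
      unfolding E_def by (rule integral_Markov_inequality_measure[where A = "space (M n)"]) (use intE \<delta>0 in auto)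
    also have "\<dots> \<le> (\<delta> n)\<^sup>2 / \<delta> n"
      using E0[of n] \<delta>0[of n] by (intro divide_right_mono) (auto simp: \<delta>_def)
    also have "\<dots> = \<delta> n" by (simp add: power2_eq_square)
    finally have "1 - \<delta> n \<le> 1 - measure (M n) ?A" by simp
    also have "\<dots> = measure (M n) (space (M n) - ?A)" by (subst prob_compl) auto
    also have "\<dots> \<le> measure (M n) {x\<in>space (M n). \<bar>X n x / a n - 1\<bar> \<le> \<delta> n}"
      by (intro finite_measure_mono) auto
    finally show ?thesis .
  qed
  have "(\<lambda>n. measure (M n) {x\<in>space (M n). \<bar>X n x / a n - 1\<bar> \<le> \<delta> n}) \<longlonglongrightarrow> 1"
  proof (rule tendsto_sandwich[of "\<lambda>n. 1 - \<delta> n" _ _ "\<lambda>_. 1"])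
    show "(\<lambda>n. 1 - \<delta> n) \<longlonglongrightarrow> 1" using tendsto_diff[OF tendsto_const[of 1] \<delta>] by simp
  qed (use lower prob in \<open>auto intro!: prob_space.prob_le_1 always_eventually\<close>)
  then show "whp_asymp_equiv M X a" unfolding whp_asymp_equiv_def using \<delta> by blast
  have le: "\<bar>(\<integral>x. X n x \<partial>M n) / a n - 1\<bar> \<le> E n" for n
  proof -
    interpret prob_space "M n" by (rule prob)
    have "(\<integral>x. X n x \<partial>M n) / a n - 1 = (\<integral>x. X n x / a n - 1 \<partial>M n)"
      using int[of n] by (simp add: prob_space)
    then show ?thesis unfolding E_def using integral_abs_bound by metis
  qed
  have "(\<lambda>n. (\<integral>x. X n x \<partial>M n) / a n - 1) \<longlonglongrightarrow> 0"
    by (rule Lim_null_comparison[OF _ lim[folded E_def]]) (use le in auto)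
  then have "(\<lambda>n. (\<integral>x. X n x \<partial>M n) / a n) \<longlonglongrightarrow> 1" by (simp add: LIM_zero_iff)
  then show "(\<lambda>n. \<integral>x. X n x \<partial>M n) \<sim>[sequentially] a" by (rule asymp_equivI')
qed


section \<open>The partition function\<close>

definition log_partition :: "nat \<Rightarrow> real \<Rightarrow> environment \<Rightarrow> real" where
  "log_partition n b \<omega> = ln (\<Sum>T\<in>complete_spanning_trees n. tree_weight b \<omega> T)"

definition edge_weight :: "real \<Rightarrow> environment \<Rightarrow> nat \<Rightarrow> nat \<Rightarrow> real" where
  "edge_weight b \<omega> u v = (if u = v then 0 else exp (- b * \<omega> {u, v}))"

text \<open>Removing \<open>v\<close> keeps the singleton \<open>{v}\<close> from counting as an
  edge.\<close>

definition star :: "nat \<Rightarrow> nat set \<Rightarrow> nat set set" where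
  "star v J = (\<lambda>z. {v, z}) ` (J - {v})"

lemma complete_spanning_trees_eq:
  "complete_spanning_trees n = spanning_trees {..<n} (all_edges {..<n})"
  by (simp add: complete_verts_def complete_edges_all_edges)

lemma tree_weight_exp:
  assumes "T \<in> complete_spanning_trees n"
  shows "tree_weight b \<omega> T = exp (- b * tree_length \<omega> T)"
proof -
  have "finite T" using assms finite_complete_edges finite_subset by (auto simp: spanning_trees_def)
  then show ?thesis unfolding tree_weight_def tree_length_def
    by (simp add: exp_sum sum_distrib_left)
qed

text \<open>Jensen's inequality for the tree law at \<open>b\<close>, in the form exp x >= 1 + x
  centred at the mean exponent \<open>c\<close>, so that the terms of first order cancel.\<close>

lemma log_partition_tangent:
  "log_partition n b' \<omega> \<ge> log_partition n b \<omega> - (b' - b) * rstre_mean_length n b \<omega>"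
proof -
  let ?S = "complete_spanning_trees n"
  define Z where "Z b = (\<Sum>T\<in>?S. tree_weight b \<omega> T)" for b
  define X where "X = rstre_mean_length n b \<omega>"
  define c where "c = - (b' - b) * X"
  have Z: "0 < Z b" for b unfolding Z_def by (rule sum_tree_weight_pos)
  have X: "X * Z b = (\<Sum>T\<in>?S. tree_length \<omega> T * tree_weight b \<omega> T)"
    unfolding X_def rstre_mean_length_eq using Z[of b] by (simp add: Z_def)
  have "Z b' = (\<Sum>T\<in>?S. tree_weight b \<omega> T * (exp c * exp (- (b' - b) * tree_length \<omega> T - c)))"
    unfolding Z_def by (intro sum.cong refl) (simp add: tree_weight_exp mult_exp_exp algebra_simps)
  also have "\<dots> \<ge> (\<Sum>T\<in>?S. tree_weight b \<omega> T * (exp c * (1 + (- (b' - b) * tree_length \<omega> T - c))))"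
    by (intro sum_mono mult_left_mono exp_ge_add_one_self less_imp_le[OF tree_weight_pos]) auto
  also have "(\<Sum>T\<in>?S. tree_weight b \<omega> T * (exp c * (1 + (- (b' - b) * tree_length \<omega> T - c)))) =
      exp c * ((1 - c) * Z b - (b' - b) * (X * Z b))"
    unfolding X unfolding Z_def sum_distrib_left sum_subtractf[symmetric]
    by (intro sum.cong refl) (simp add: algebra_simps)
  also have "\<dots> = exp c * Z b" by (simp add: c_def algebra_simps)
  finally have "ln (exp c * Z b) \<le> ln (Z b')" using Z by (subst ln_le_cancel_iff) auto
  then show ?thesis using Z[of b] by (simp add: ln_mult c_def log_partition_def Z_def X_def algebra_simps)
qed

text \<open>The tangent inequalities from \<open>b\<close> to \<open>b'\<close> and from
  \<open>b'\<close> to \<open>b\<close> are added; the log-partition functions cancel.\<close>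

lemma rstre_mean_length_antimono:
  assumes "b \<le> b'"
  shows "rstre_mean_length n b' \<omega> \<le> rstre_mean_length n b \<omega>"
proof (cases "b = b'")
  case False
  have "0 \<le> (b' - b) * (rstre_mean_length n b \<omega> - rstre_mean_length n b' \<omega>)"
    using log_partition_tangent[of n b \<omega> b'] log_partition_tangent[of n b' \<omega> b]
    by (simp add: algebra_simps)
  then show ?thesis using False assms by (simp add: zero_le_mult_iff)
qed simp

lemma partition_forest_sum:
  assumes "1 \<le> n"
  shows "(\<Sum>T\<in>complete_spanning_trees n. tree_weight b \<omega> T) = forest_sum (edge_weight b \<omega>) {..<n} {0}"
  unfolding complete_spanning_trees_eq tree_weight_def edge_weight_def[abs_def]
  using assms by (intro sum_spanning_trees) auto

lemma edge_weight_nonneg: "0 \<le> edge_weight b \<omega> u v"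
  by (simp add: edge_weight_def)

lemma star_subset: "v < n \<Longrightarrow> J \<subseteq> {..<n} \<Longrightarrow> star v J \<subseteq> complete_edges n"
  by (auto simp: star_def complete_edges_def complete_verts_def card_insert_if)

lemma inj_on_star: "inj_on (\<lambda>z. {v, z}) (J - {v})"
  by (auto simp: inj_on_def doubleton_eq_iff)

lemma card_star: "card (star v J) = card (J - {v})"
  unfolding star_def by (rule card_image) (rule inj_on_star)

lemma sum_edge_weight:
  assumes "finite J"
  shows "(\<Sum>z\<in>J. edge_weight b \<omega> v z) = (\<Sum>e\<in>star v J. exp (- b * \<omega> e))"
proof -
  have "(\<Sum>z\<in>J. edge_weight b \<omega> v z) = (\<Sum>z\<in>J - {v}. exp (- b * \<omega> {v, z}))"
    using assms by (intro sum.mono_neutral_cong_right) (auto simp: edge_weight_def)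
  also have "\<dots> = (\<Sum>e\<in>star v J. exp (- b * \<omega> e))"
    unfolding star_def by (subst sum.reindex[OF inj_on_star]) simp
  finally show ?thesis .
qed

lemma sum_edge_weight_ge_Min:
  assumes "finite J" "J - {v} \<noteq> {}"
  shows "exp (- b * Min (\<omega> ` star v J)) \<le> (\<Sum>z\<in>J. edge_weight b \<omega> v z)"
proof -
  have fin: "finite (star v J)" using assms by (simp add: star_def)
  have "Min (\<omega> ` star v J) \<in> \<omega> ` star v J"
    using assms by (intro Min_in) (auto simp: star_def)
  then obtain e where e: "e \<in> star v J" "Min (\<omega> ` star v J) = \<omega> e" by auto
  have "exp (- b * \<omega> e) \<le> (\<Sum>e\<in>star v J. exp (- b * \<omega> e))"
    using member_le_sum[OF e(1), of "\<lambda>e. exp (- b * \<omega> e)"] fin by simp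
  then show ?thesis using e(2) sum_edge_weight[OF assms(1)] by simp
qed

text \<open>The product of weighted degrees bounds Z, and the tangent of ln at \<open>y\<close>
  makes the bound linear in the degrees, so that only their deviations from \<open>y\<close> matter
  when means are taken.\<close>

lemma log_partition_upper:
  assumes "2 \<le> n" "0 < y"
  shows "log_partition n b \<omega> - real (n - 1) * ln y \<le> (\<Sum>v\<in>{1..<n}. (\<Sum>z<n. edge_weight b \<omega> v z) / y - 1)"
proof -
  let ?d = "\<lambda>v. \<Sum>z<n. edge_weight b \<omega> v z"
  have d: "0 < ?d v" if "v < n" for v
  proof -
    have "{..<n} - {v} \<noteq> {}"
    proof (cases "v = 0")
      case True then have "1 \<in> {..<n} - {v}" using assms by auto
      then show ?thesis by blast
    next
      case False then have "0 \<in> {..<n} - {v}" using assms by auto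
      then show ?thesis by blast
    qed
    from sum_edge_weight_ge_Min[OF _ this, of b \<omega>] show ?thesis
      using exp_gt_zero less_le_trans by (metis finite_lessThan)
  qed
  have "log_partition n b \<omega> \<le> ln (\<Prod>v\<in>{..<n} - {0}. ?d v)"
    unfolding log_partition_def
  proof (subst ln_le_cancel_iff)
    show "(\<Sum>T\<in>complete_spanning_trees n. tree_weight b \<omega> T) \<le> (\<Prod>v\<in>{..<n} - {0}. ?d v)"
      using assms by (subst partition_forest_sum) (auto intro!: forest_sum_upper edge_weight_nonneg)
  qed (use d in \<open>auto intro!: sum_tree_weight_pos prod_pos\<close>)
  also have "{..<n} - {0} = {1..<n}" by auto
  also have "ln (\<Prod>v\<in>{1..<n}. ?d v) = (\<Sum>v\<in>{1..<n}. ln (?d v))"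
  proof (rule ln_prod)
    fix v assume "v \<in> {1..<n}"
    then show "?d v \<noteq> 0" using d[of v] by auto
  qed simp
  also have "\<dots> \<le> (\<Sum>v\<in>{1..<n}. ln y + (?d v / y - 1))"
  proof (rule sum_mono)
    fix v assume v: "v \<in> {1..<n}"
    then have "ln (?d v / y) \<le> ?d v / y - 1" using d assms by (intro ln_le_minus_one) auto
    then show "ln (?d v) \<le> ln y + (?d v / y - 1)" using d[of v] v assms by (simp add: ln_div)
  qed
  finally show ?thesis by (simp add: sum.distrib)
qed

lemma neg_ln_one_minus_le:
  fixes x :: real
  assumes "0 \<le> x" "x \<le> 1 / 2"
  shows "- ln (1 - x) \<le> 2 * x"
proof -
  have "- ln (1 - x) = ln (1 / (1 - x))" using assms by (simp add: ln_div)
  also have "\<dots> \<le> 1 / (1 - x) - 1" using assms by (intro ln_le_minus_one) auto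
  also have "\<dots> = x / (1 - x)" using assms by (simp add: field_simps)
  also have "\<dots> \<le> x / (1 / 2)" using assms by (intro divide_left_mono) auto
  finally show ?thesis by simp
qed

text \<open>The vertices below m and the exceptional ones are attached greedily through their
  cheapest admissible edge. For every other vertex the walk reaches the first m vertices
  after about sqrt y steps while hitting a given vertex has probability of order 1 / y per step, so
  that it rarely returns and almost the whole weighted degree is gained.\<close>

lemma log_partition_lower:
  assumes m: "1 \<le> m" "m \<le> n" and b: "0 \<le> b" and \<omega>: "\<And>e. e \<in> complete_edges n \<Longrightarrow> 0 \<le> \<omega> e"
    and y: "256 \<le> y" and \<delta>: "0 \<le> \<delta>" "\<delta> \<le> 1 / 4" and Bad: "Bad \<subseteq> {m..<n}"
    and good: "\<And>v. v \<in> {m..<n} - Bad \<Longrightarrow> (1 - 2 * \<delta>) * y \<le> (\<Sum>z<n. edge_weight b \<omega> v z) \<and>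
      (\<Sum>z<n. edge_weight b \<omega> v z) \<le> 2 * y \<and> sqrt y / 2 \<le> (\<Sum>z<m. edge_weight b \<omega> v z)"
  shows "real (n - 1) * ln y - log_partition n b \<omega> \<le> (m + card Bad) * ln y +
    b * (\<Sum>v\<in>{1..<n}. Min (\<omega> ` star v {..<min v m})) + n * (4 * \<delta> + 16 / sqrt y)"
proof -
  let ?V = "{..<n}" and ?w = "edge_weight b \<omega>"
  let ?F = "forest_sum ?w ?V"
  let ?d = "\<lambda>v. \<Sum>z<n. edge_weight b \<omega> v z"
  define M where "M v = Min (\<omega> ` star v {..<min v m})" for v
  \<comment> \<open>Both constants fit the bounds on good vertices. At least sqrt y / 2 out of a
    degree of at most 2 y leads into the first \<open>m\<close> vertices, a fraction 1 / (4 sqrt y).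
    A single edge weighs at most 1 = \<open>\<eta> * \<epsilon> * (y / 2)\<close>, and y / 2 is a
    lower bound for the degree.\<close>
  define \<eta> where "\<eta> = 8 / sqrt y"
  define \<epsilon> where "\<epsilon> = 1 / (4 * sqrt y)"
  have sy: "16 \<le> sqrt y" using y real_le_rsqrt[of 16 y] by simp
  have sq: "sqrt y * sqrt y = y" using y by simp
  have \<eta>: "0 \<le> \<eta>" "\<eta> \<le> 1 / 2" using divide_left_mono[of 16 "sqrt y" 8] sy y by (auto simp: \<eta>_def)
  have M0: "0 \<le> M v" if v: "v \<in> {1..<n}" for v
  proof -
    have "{v, 0} \<in> star v {..<min v m}" unfolding star_def using v m by (intro imageI) auto
    then have "\<omega> ` star v {..<min v m} \<noteq> {}" by blast
    moreover have "finite (\<omega> ` star v {..<min v m})" by (simp add: star_def)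
    ultimately have "M v \<in> \<omega> ` star v {..<min v m}" unfolding M_def by (intro Min_in)
    moreover have "star v {..<min v m} \<subseteq> complete_edges n" using v by (intro star_subset) auto
    ultimately show ?thesis using \<omega> by auto
  qed
  have min_le: "exp (- b * M v) \<le> (\<Sum>z<min v m. ?w v z)" if "v \<in> {1..<n}" for v
  proof -
    have "0 \<in> {..<min v m} - {v}" using that m by auto
    then have "{..<min v m} - {v} \<noteq> {}" by blast
    then show ?thesis unfolding M_def by (intro sum_edge_weight_ge_Min) auto
  qed
  \<comment> \<open>The vertex \<open>k\<close> joins when exactly the smaller ones are roots. This
    explains \<open>min v m\<close>: before \<open>m\<close> only the vertices below
    \<open>v\<close> are available, from \<open>m\<close> on all of the first
    \<open>m\<close>.\<close>
  have stage1: "(\<Prod>v\<in>{1..<k}. exp (- b * M v)) * ?F {..<k} \<le> ?F {0}" if "1 \<le> k" "k \<le> m" for k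
    using that
  proof (induction k rule: nat_induct_at_least)
    case base
    then show ?case by (simp add: lessThan_Suc)
  next
    case (Suc k)
    have "exp (- b * M k) * ?F {..<Suc k} \<le> (\<Sum>z<k. ?w k z) * ?F {..<Suc k}"
      using min_le[of k] Suc m by (intro mult_right_mono forest_sum_nonneg edge_weight_nonneg) (auto simp: min_def)
    also have "\<dots> \<le> ?F {..<k}"
      using forest_sum_insert_lower[of ?V k "{..<k}" "{..<k}" ?w] Suc m
      by (auto simp: edge_weight_nonneg lessThan_Suc)
    finally have *: "exp (- b * M k) * ?F {..<Suc k} \<le> ?F {..<k}" .
    have "(\<Prod>v\<in>{1..<Suc k}. exp (- b * M v)) * ?F {..<Suc k} =
        (\<Prod>v\<in>{1..<k}. exp (- b * M v)) * (exp (- b * M k) * ?F {..<Suc k})"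
      using Suc by (simp add: atLeastLessThanSuc)
    also have "\<dots> \<le> (\<Prod>v\<in>{1..<k}. exp (- b * M v)) * ?F {..<k}"
      by (intro mult_left_mono * prod_nonneg) auto
    also have "\<dots> \<le> ?F {0}" using Suc by simp
    finally show ?case .
  qed
  let ?R = "{..<m} \<union> Bad"
  have Bad_diff: "?R - {..<m} = Bad" using Bad by auto
  have stage2: "(\<Prod>v\<in>?R - {..<m}. exp (- b * M v)) * ?F ?R \<le> ?F {..<m}"
  proof (rule forest_sum_chain)
    fix v S assume v: "v \<in> ?R - {..<m}" "v \<notin> S" "{..<m} \<subseteq> S" "S \<subseteq> ?V"
    have vm: "min v m = m" "v \<in> {1..<n}" using v(1) Bad m by auto
    have "exp (- b * M v) * ?F (insert v S) \<le> (\<Sum>z<m. ?w v z) * ?F (insert v S)"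
      using min_le[OF vm(2)] vm(1) by (intro mult_right_mono forest_sum_nonneg edge_weight_nonneg) auto
    also have "\<dots> \<le> ?F S"
      using v vm by (intro forest_sum_insert_lower) (auto simp: edge_weight_nonneg)
    finally show "exp (- b * M v) * ?F (insert v S) \<le> ?F S" .
  qed (use m Bad in \<open>auto simp: edge_weight_nonneg\<close>)
  have e1: "1 / (4 * s) * (2 * (s * s)) = s / 2" and e2: "8 / s * (1 / (4 * s) * (s * s / 2)) = 1"
    if "16 \<le> s" for s :: real using that by (simp_all add: field_simps)
  have good': "\<epsilon> * ?d u \<le> (\<Sum>z<m. ?w u z)" "0 < ?d u" "\<And>z. ?w u z \<le> \<eta> * (\<epsilon> * ?d u) \<or> z \<notin> ?V"
    if u: "u \<in> ?V - ?R" for u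
  proof -
    have u': "u \<in> {m..<n} - Bad" using u by auto
    have "\<epsilon> * ?d u \<le> \<epsilon> * (2 * y)" using good[OF u'] sy y by (intro mult_left_mono) (auto simp: \<epsilon>_def)
    also have "\<epsilon> * (2 * y) = sqrt y / 2" using e1[OF sy] unfolding sq \<epsilon>_def .
    finally show "\<epsilon> * ?d u \<le> (\<Sum>z<m. ?w u z)" using good[OF u'] by simp
    have "y / 2 = (1 - 2 * (1 / 4)) * y" by simp
    also have "\<dots> \<le> (1 - 2 * \<delta>) * y" using \<delta> y by (intro mult_right_mono) auto
    finally have d: "y / 2 \<le> ?d u" using good[OF u'] by simp
    then show "0 < ?d u" using y by linarith
    fix z
    have "\<eta> * (\<epsilon> * (y / 2)) = 1" using e2[OF sy] unfolding sq \<epsilon>_def \<eta>_def .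
    moreover have "\<eta> * (\<epsilon> * (y / 2)) \<le> \<eta> * (\<epsilon> * ?d u)"
      using d \<eta> sy y by (intro mult_left_mono) (auto simp: \<epsilon>_def)
    moreover have "?w u z \<le> 1" if "z < n"
    proof (cases "u = z")
      case False
      then have "{u, z} \<in> complete_edges n"
        using u that by (auto simp: complete_edges_def complete_verts_def card_insert_if)
      then show ?thesis using \<omega> b by (auto simp: edge_weight_def)
    qed (simp add: edge_weight_def)
    ultimately show "?w u z \<le> \<eta> * (\<epsilon> * ?d u) \<or> z \<notin> ?V" by fastforce
  qed
  have stage3: "(\<Prod>v\<in>?V - ?R. ?d v * (1 - \<eta>)) * ?F ?V \<le> ?F ?R"
  proof (rule forest_sum_chain)
    fix v S assume v: "v \<in> ?V - ?R" "v \<notin> S" "?R \<subseteq> S" "S \<subseteq> ?V"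
    show "?d v * (1 - \<eta>) * ?F (insert v S) \<le> ?F S"
    proof (rule forest_sum_insert_lower_escape[where \<epsilon> = \<epsilon>])
      fix u assume u: "u \<in> ?V - S"
      then have u': "u \<in> ?V - ?R" using v by auto
      have "(\<Sum>z<m. ?w u z) \<le> (\<Sum>z\<in>S. ?w u z)"
        using v by (intro sum_mono2) (auto simp: edge_weight_nonneg intro: finite_subset)
      then show "\<epsilon> * ?d u \<le> (\<Sum>z\<in>S. ?w u z)" using good'(1)[OF u'] by simp
      show "0 < \<epsilon> * ?d u" using good'(2)[OF u'] y by (simp add: \<epsilon>_def)
      fix z assume "z \<in> ?V"
      then show "?w u z \<le> \<eta> * (\<epsilon> * ?d u)" using good'(3)[OF u', of z] by simp
    qed (use v in \<open>auto simp: edge_weight_nonneg edge_weight_def\<close>)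
  qed (use m Bad \<eta> in \<open>auto simp: edge_weight_nonneg intro!: mult_nonneg_nonneg sum_nonneg\<close>)
  let ?G = "{m..<n} - Bad"
  have VR: "?V - ?R = ?G" by auto
  define a where "a = (1 - 2 * \<delta>) * y * (1 - \<eta>)"
  have a: "0 < a" using \<delta> y \<eta> by (auto simp: a_def)
  have "a ^ card ?G = (\<Prod>v\<in>?G. a)" by simp
  also have "\<dots> \<le> (\<Prod>v\<in>?G. ?d v * (1 - \<eta>))"
    unfolding a_def using good \<delta> y \<eta> by (intro prod_mono conjI mult_right_mono) auto
  also have "\<dots> \<le> ?F ?R" using stage3 unfolding VR by (simp add: forest_sum_all)
  finally have F: "a ^ card ?G \<le> ?F ?R" .
  have "(\<Prod>v\<in>{1..<m}. exp (- b * M v)) * ((\<Prod>v\<in>Bad. exp (- b * M v)) * a ^ card ?G) \<le>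
      (\<Prod>v\<in>{1..<m}. exp (- b * M v)) * ((\<Prod>v\<in>Bad. exp (- b * M v)) * ?F ?R)"
    by (intro mult_left_mono F prod_nonneg) auto
  also have "\<dots> \<le> (\<Prod>v\<in>{1..<m}. exp (- b * M v)) * ?F {..<m}"
    using stage2 unfolding Bad_diff by (intro mult_left_mono prod_nonneg) auto
  also have "\<dots> \<le> ?F {0}" using stage1[of m] m by simp
  finally have Z: "(\<Prod>v\<in>{1..<m}. exp (- b * M v)) * ((\<Prod>v\<in>Bad. exp (- b * M v)) * a ^ card ?G) \<le> ?F {0}" .
  have finB: "finite Bad" using Bad finite_subset by blast
  have prods: "(\<Prod>v\<in>A. exp (- b * M v)) = exp (- b * (\<Sum>v\<in>A. M v))" if "finite A" for A
    using that by (simp add: exp_sum sum_distrib_left)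
  have "- b * (\<Sum>v\<in>{1..<m}. M v) + (- b * (\<Sum>v\<in>Bad. M v) + card ?G * ln a) =
      ln (exp (- b * (\<Sum>v\<in>{1..<m}. M v)) * (exp (- b * (\<Sum>v\<in>Bad. M v)) * a ^ card ?G))"
    using a by (simp add: ln_mult ln_realpow)
  also have "\<dots> \<le> ln (?F {0})"
    using Z a unfolding prods[OF finB] prods[OF finite_atLeastLessThan]
    by (subst ln_le_cancel_iff) (auto intro: less_le_trans[rotated])
  also have "\<dots> = log_partition n b \<omega>"
    using m by (simp add: log_partition_def partition_forest_sum)
  finally have L: "- b * (\<Sum>v\<in>{1..<m}. M v) + (- b * (\<Sum>v\<in>Bad. M v) + card ?G * ln a) \<le> log_partition n b \<omega>" .
  have "(\<Sum>v\<in>{1..<m}. M v) + (\<Sum>v\<in>Bad. M v) = (\<Sum>v\<in>{1..<m} \<union> Bad. M v)"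
    using finB Bad by (intro sum.union_disjoint[symmetric]) auto
  also have "\<dots> \<le> (\<Sum>v\<in>{1..<n}. M v)" using M0 m Bad by (intro sum_mono2) auto
  finally have "b * ((\<Sum>v\<in>{1..<m}. M v) + (\<Sum>v\<in>Bad. M v)) \<le> b * (\<Sum>v\<in>{1..<n}. M v)"
    using b by (rule mult_left_mono)
  then have S: "b * (\<Sum>v\<in>{1..<m}. M v) + b * (\<Sum>v\<in>Bad. M v) \<le> b * (\<Sum>v\<in>{1..<n}. M v)"
    by (simp add: algebra_simps)
  \<comment> \<open>Each loss -ln (1 - x) is at most 2 x, here with x = 2 \<open>\<delta>\<close>
    and x = \<open>\<eta>\<close>.\<close>
  have lna: "ln y - ln a \<le> 4 * \<delta> + 16 / sqrt y"
  proof -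
    have "ln a = ln (1 - 2 * \<delta>) + ln y + ln (1 - \<eta>)"
      using \<delta> \<eta> y by (simp add: a_def ln_mult)
    then show ?thesis
      using neg_ln_one_minus_le[of "2 * \<delta>"] neg_ln_one_minus_le[of \<eta>] \<delta> \<eta> by (simp add: \<eta>_def)
  qed
  have cG: "card ?G = n - m - card Bad" "card Bad \<le> n - m"
    using Bad finB card_mono[of "{m..<n}" Bad] by (auto simp: card_Diff_subset)
  have lny: "0 \<le> ln y" using y by simp
  \<comment> \<open>Every vertex is among the first \<open>m\<close>, exceptional or good; giving up
    ln y at the first two kinds is the term with \<open>m + card Bad\<close>.\<close>
  have "real (n - 1) * ln y \<le> (m + card Bad + card ?G) * ln y"
    using cG m lny by (intro mult_right_mono) auto
  also have "\<dots> = (m + card Bad) * ln y + card ?G * ln a + card ?G * (ln y - ln a)"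
    by (simp add: algebra_simps)
  also have "card ?G * (ln y - ln a) \<le> card ?G * (4 * \<delta> + 16 / sqrt y)"
    using lna by (intro mult_left_mono) auto
  also have "\<dots> \<le> n * (4 * \<delta> + 16 / sqrt y)"
    using cG \<delta> y by (intro mult_right_mono) auto
  finally show ?thesis using L S unfolding M_def by linarith
qed

section \<open>Mean deviation of the log-partition function\<close>

lemma log_partition_measurable: "log_partition n b \<in> borel_measurable (env_measure n)"
proof -
  have [measurable]: "(\<lambda>\<omega>. \<omega> e) \<in> borel_measurable (env_measure n)"
    if "T \<in> complete_spanning_trees n" "e \<in> T" for e T
    using that by (intro env_component_measurable) (auto simp: spanning_trees_def)
  show ?thesis
    unfolding log_partition_def[abs_def] tree_weight_def
    by (intro borel_measurable_ln borel_measurable_sum borel_measurable_prod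
        measurable_compose[OF _ borel_measurable_exp] borel_measurable_times) auto
qed

text \<open>The Laplace transform of the uniform law, that is, the mean weight of one edge.\<close>

definition mean_weight :: "real \<Rightarrow> real" where
  "mean_weight b = (1 - exp (- b)) / b"

lemma integral_exp_unif: "0 < b \<Longrightarrow> (\<integral>x. exp (- b * x) \<partial>unif) = mean_weight b"
  by (subst integral_unif_FTC[where F = "\<lambda>x. - exp (- b * x) / b"])
    (auto intro!: derivative_eq_intros continuous_intros simp: mean_weight_def field_simps)

lemma mean_weight_bounds:
  assumes "0 < b"
  shows "0 < mean_weight b" "mean_weight b \<le> 1" "mean_weight b \<le> 1 / b"
proof -
  show "0 < mean_weight b" using assms by (simp add: mean_weight_def)
  have "1 - b \<le> exp (- b)" using exp_ge_add_one_self[of "- b"] by simp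
  then show "mean_weight b \<le> 1" using assms by (simp add: mean_weight_def)
  show "mean_weight b \<le> 1 / b" using assms by (simp add: mean_weight_def divide_right_mono)
qed


lemma mean_length_bounds:
  assumes \<omega>: "\<And>e. e \<in> complete_edges n \<Longrightarrow> 0 \<le> \<omega> e \<and> \<omega> e \<le> 1"
  shows "0 \<le> rstre_mean_length n b \<omega>" "rstre_mean_length n b \<omega> \<le> real n"
proof -
  let ?S = "complete_spanning_trees n"
  have Z: "0 < (\<Sum>T\<in>?S. tree_weight b \<omega> T)" by (rule sum_tree_weight_pos)
  have L: "0 \<le> tree_length \<omega> T \<and> tree_length \<omega> T \<le> real n" if T: "T \<in> ?S" for T
  proof -
    have sub: "T \<subseteq> complete_edges n" using T by (auto simp: spanning_trees_def)
    have "tree_length \<omega> T \<le> (\<Sum>e\<in>T. 1)" unfolding tree_length_def using sub \<omega> by (intro sum_mono) auto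
    also have "\<dots> = card T" by simp
    also have "card T \<le> n"
    proof (cases "n = 0")
      case True
      then have "complete_edges n = {}" by (auto simp: complete_edges_def complete_verts_def)
      then show ?thesis using sub by simp
    next
      case False
      then show ?thesis
        using card_spanning_tree[of "{..<n}" T] T by (auto simp: complete_spanning_trees_eq lessThan_empty_iff)
    qed
    finally show ?thesis using sub \<omega> by (auto simp: tree_length_def intro!: sum_nonneg)
  qed
  show "0 \<le> rstre_mean_length n b \<omega>" unfolding rstre_mean_length_eq using Z L
    by (auto intro!: divide_nonneg_pos sum_nonneg mult_nonneg_nonneg simp: less_imp_le[OF tree_weight_pos])
  have "(\<Sum>T\<in>?S. tree_length \<omega> T * tree_weight b \<omega> T) \<le> (\<Sum>T\<in>?S. real n * tree_weight b \<omega> T)"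
    using L by (intro sum_mono mult_right_mono less_imp_le[OF tree_weight_pos]) auto
  then show "rstre_mean_length n b \<omega> \<le> real n"
    unfolding rstre_mean_length_eq using Z by (simp add: divide_le_eq sum_distrib_left)
qed

lemma integrable_mean_length: "integrable (env_measure n) (rstre_mean_length n b)"
proof -
  interpret prob_space "env_measure n" by (rule prob_space_env_measure)
  show ?thesis
  proof (rule integrable_const_bound[of _ "real n"])
    show "AE \<omega> in env_measure n. norm (rstre_mean_length n b \<omega>) \<le> real n"
      using AE_env by eventually_elim (use mean_length_bounds in auto)
  qed (rule borel_measurable_rstre_mean_length)
qed

text \<open>At inverse temperature 0 the tree does not depend on the environment, and each of its n
  - 1 edges has mean length 1 / 2.\<close>

lemma expectation_mean_length_zero:
  "(\<integral>\<omega>. rstre_mean_length n 0 \<omega> \<partial>env_measure n) \<le> real n / 2"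
proof (cases "n = 0")
  case True
  then have "complete_edges n = {}" by (auto simp: complete_edges_def complete_verts_def)
  then have "rstre_mean_length n 0 \<omega> = 0" for \<omega>
    unfolding rstre_mean_length_eq tree_length_def by (auto simp: spanning_trees_def)
  then show ?thesis by simp
next
  case False
  let ?S = "complete_spanning_trees n"
  have N: "0 < card ?S" using complete_spanning_trees_nonempty finite_complete_spanning_trees
    by (simp add: card_gt_0_iff)
  have half: "(\<integral>x. x \<partial>unif) = 1 / 2"
    using integral_unif_beta[of 1 0] by (simp add: numeral_2_eq_2)
  have id: "integrable unif (\<lambda>x. x)" by (intro integrable_unif_continuous continuous_intros)
  have sub: "T \<subseteq> complete_edges n" if "T \<in> ?S" for T using that by (auto simp: spanning_trees_def)
  have int: "integrable (env_measure n) (\<lambda>\<omega>. \<omega> e)" "(\<integral>\<omega>. \<omega> e \<partial>env_measure n) = 1 / 2"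
    if "T \<in> ?S" "e \<in> T" for T e
    using env_single[of e n "\<lambda>x. x"] sub[OF that(1)] that(2) id half by auto
  have "(\<integral>\<omega>. rstre_mean_length n 0 \<omega> \<partial>env_measure n) =
      (\<integral>\<omega>. (\<Sum>T\<in>?S. \<Sum>e\<in>T. \<omega> e) / card ?S \<partial>env_measure n)"
    unfolding rstre_mean_length_eq tree_length_def tree_weight_def by simp
  also have "\<dots> = (\<Sum>T\<in>?S. \<Sum>e\<in>T. \<integral>\<omega>. \<omega> e \<partial>env_measure n) / card ?S"
    using int by (simp add: Bochner_Integration.integral_sum)
  also have "(\<Sum>T\<in>?S. \<Sum>e\<in>T. \<integral>\<omega>. \<omega> e \<partial>env_measure n) = (\<Sum>T\<in>?S. real (n - 1) / 2)"
  proof (intro sum.cong refl)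
    fix T assume T: "T \<in> ?S"
    have "card T = n - 1"
      using card_spanning_tree[of "{..<n}" T] T False by (auto simp: complete_spanning_trees_eq lessThan_empty_iff)
    moreover have "(\<Sum>e\<in>T. \<integral>\<omega>. \<omega> e \<partial>env_measure n) = (\<Sum>e\<in>T. 1 / 2)"
      using int(2)[OF T] by (intro sum.cong) auto
    ultimately show "(\<Sum>e\<in>T. \<integral>\<omega>. \<omega> e \<partial>env_measure n) = real (n - 1) / 2"
      by simp
  qed
  also have "\<dots> / card ?S = real (n - 1) / 2" using N by simp
  finally show ?thesis by simp
qed

lemma harmonic_le_ln: "1 \<le> n \<Longrightarrow> (\<Sum>v\<in>{1..<n}. 1 / (real v + 1)) \<le> ln (real n)"
proof (induction n rule: nat_induct_at_least)
  case (Suc n)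
  have "ln (real n / (real n + 1)) \<le> real n / (real n + 1) - 1"
    using Suc by (intro ln_le_minus_one) auto
  also have "\<dots> = - (1 / (real n + 1))" by (simp add: field_simps)
  finally have "1 / (real n + 1) \<le> ln (real n + 1) - ln (real n)" using Suc by (simp add: ln_div)
  then show ?case using Suc by (simp add: add.commute)
qed simp

text \<open>The two deterministic bounds are integrated. Degree deviations and the number of
  exceptional vertices are dominated pointwise by sums of squares whose means are variances, so no
  probability needs a separate estimate.\<close>

lemma log_partition_mean_deviation:
  fixes n :: nat and b :: real
  defines "y \<equiv> real n * mean_weight b"
  assumes n: "2 \<le> n" and b: "0 < b" and y: "256 \<le> y"
  shows "integrable (env_measure n) (log_partition n b)" (is ?I)
    and "(\<integral>\<omega>. \<bar>log_partition n b \<omega> - real (n - 1) * ln y\<bar> \<partial>env_measure n) \<le>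
      n * (6 * (ln y / sqrt y) + 17 / sqrt y + 4 / sqrt (sqrt y)) + ln y + b * (ln n + sqrt y)" (is ?E)
proof -
  interpret P: prob_space "env_measure n" by (rule prob_space_env_measure)
  define \<mu> where "\<mu> = mean_weight b"
  \<comment> \<open>With m about n / s the mean weight into the first \<open>m\<close> vertices is
    at least y / s = s. The tolerance \<open>\<delta>\<close> = y^(-1/4) is small, and so is the
    resulting Chebyshev ratio 1 / (\<open>\<delta>\<close>^2 y) = 1 / s.\<close>
  define s where "s = sqrt y"
  define \<delta> where "\<delta> = 1 / sqrt s"
  define m where "m = nat \<lceil>n / s\<rceil>"
  have \<mu>: "0 < \<mu>" "\<mu> \<le> 1" using mean_weight_bounds[OF b] by (auto simp: \<mu>_def)
  have s: "16 \<le> s" "s * s = y" using y real_le_rsqrt[of 16 y] by (auto simp: s_def)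
  have \<delta>: "0 < \<delta>" "\<delta> \<le> 1 / 4" "\<delta>\<^sup>2 = 1 / s"
  proof -
    have "4 \<le> sqrt s" using s by (intro real_le_rsqrt) auto
    then show "0 < \<delta>" "\<delta> \<le> 1 / 4" "\<delta>\<^sup>2 = 1 / s"
      using divide_left_mono[of 4 "sqrt s" 1] s by (auto simp: \<delta>_def power_divide)
  qed
  have yn: "y \<le> n" using \<mu> by (simp add: y_def \<mu>_def mult_left_le)
  have lny: "0 \<le> ln y" using y by simp
  have m: "n / s \<le> m" "m \<le> n / s + 1" "1 \<le> m" "m \<le> n"
  proof -
    have pos: "0 < n / s" using s n by simp
    have 1: "real m = of_int \<lceil>n / s\<rceil>" using pos by (simp add: m_def)
    then show "n / s \<le> m" "m \<le> n / s + 1" by linarith+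
    with pos show "1 \<le> m" by (cases m) auto
    have "n / s \<le> n" using mult_left_mono[of 1 s "real n"] s by (simp add: divide_le_eq)
    then have "\<lceil>n / s\<rceil> \<le> int n" by (simp add: ceiling_le_iff)
    then show "m \<le> n" by (simp only: m_def nat_le_iff)
  qed
  have m\<mu>: "s \<le> m * \<mu>"
  proof -
    have "s = y / s" using s by (subst nonzero_eq_divide_eq) auto
    also have "\<dots> = n / s * \<mu>" by (simp add: y_def \<mu>_def)
    also have "\<dots> \<le> m * \<mu>" using m \<mu> by (intro mult_right_mono) auto
    finally show ?thesis .
  qed
  let ?f = "\<lambda>x. exp (- b * x)"
  define Q where "Q v \<omega> = ((\<Sum>e\<in>star v {..<n}. ?f (\<omega> e)) - real (n - 1) * \<mu>)\<^sup>2" for v and \<omega> :: environment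
  define S where "S v \<omega> = ((\<Sum>e\<in>star v {..<m}. ?f (\<omega> e)) - m * \<mu>)\<^sup>2" for v and \<omega> :: environment
  define M where "M v \<omega> = Min (\<omega> ` star v {..<min v m})" for v and \<omega> :: environment
  have f: "?f \<in> borel_measurable borel" "\<And>x. 0 \<le> x \<Longrightarrow> x \<le> 1 \<Longrightarrow> 0 \<le> ?f x \<and> ?f x \<le> 1"
    using b by auto
  have Q: "integrable (env_measure n) (Q v)" "(\<integral>\<omega>. Q v \<omega> \<partial>env_measure n) \<le> y" if v: "v < n" for v
  proof -
    have c: "card (star v {..<n}) = n - 1" using v by (simp add: card_star)
    note * = env_sum_deviation[OF star_subset[OF v, of "{..<n}"] f, unfolded integral_exp_unif[OF b] c, folded \<mu>_def]
    show "integrable (env_measure n) (Q v)" using *(1) by (simp add: Q_def[abs_def])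
    have "(\<integral>\<omega>. Q v \<omega> \<partial>env_measure n) \<le> real (n - 1) * \<mu>" using *(2) by (simp add: Q_def)
    also have "\<dots> \<le> y" using \<mu> unfolding y_def \<mu>_def[symmetric] by (intro mult_right_mono) auto
    finally show "(\<integral>\<omega>. Q v \<omega> \<partial>env_measure n) \<le> y" .
  qed
  have S: "integrable (env_measure n) (S v)" "(\<integral>\<omega>. S v \<omega> \<partial>env_measure n) \<le> m * \<mu>" if v: "v \<in> {m..<n}" for v
  proof -
    have c: "card (star v {..<m}) = m" using v by (simp add: card_star)
    have sub: "star v {..<m} \<subseteq> complete_edges n" using v m by (intro star_subset) auto
    note * = env_sum_deviation[OF sub f, unfolded integral_exp_unif[OF b] c, folded \<mu>_def]
    show "integrable (env_measure n) (S v)" using *(1) by (simp add: S_def[abs_def])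
    show "(\<integral>\<omega>. S v \<omega> \<partial>env_measure n) \<le> m * \<mu>" using *(2) by (simp add: S_def)
  qed
  have M: "integrable (env_measure n) (M v)" "(\<integral>\<omega>. M v \<omega> \<partial>env_measure n) = 1 / (min v m + 1)"
    if v: "v \<in> {1..<n}" for v
  proof -
    have sub: "star v {..<min v m} \<subseteq> complete_edges n" using v by (intro star_subset) auto
    have "{v, 0} \<in> star v {..<min v m}" unfolding star_def using v m by (intro imageI) auto
    then have ne: "star v {..<min v m} \<noteq> {}" by blast
    have "card (star v {..<min v m}) = min v m" by (simp add: card_star)
    then show "integrable (env_measure n) (M v)" "(\<integral>\<omega>. M v \<omega> \<partial>env_measure n) = 1 / (min v m + 1)"
      using env_min[OF sub ne] unfolding M_def[abs_def] by simp_all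
  qed
  define low where "low \<omega> = m * ln y + (\<Sum>v\<in>{m..<n}. Q v \<omega> / (\<delta> * y)\<^sup>2 + 4 * S v \<omega> / (m * \<mu>)\<^sup>2) * ln y +
    b * (\<Sum>v\<in>{1..<n}. M v \<omega>) + n * (4 * \<delta> + 16 / s)" for \<omega>
  define up where "up \<omega> = (\<Sum>v\<in>{1..<n}. (Q v \<omega> / s + s) / 2 / y)" for \<omega>
  have Q0: "0 \<le> Q v \<omega>" and S0: "0 \<le> S v \<omega>" for v \<omega> by (auto simp: Q_def S_def)
  let ?A = "\<lambda>\<omega>. log_partition n b \<omega> - real (n - 1) * ln y"
  have up: "?A \<omega> \<le> up \<omega>" for \<omega>
  proof -
    have "?A \<omega> \<le> (\<Sum>v\<in>{1..<n}. (\<Sum>z<n. edge_weight b \<omega> v z) / y - 1)"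
      using n y by (intro log_partition_upper) auto
    also have "\<dots> \<le> up \<omega>" unfolding up_def
    proof (rule sum_mono)
      fix v assume "v \<in> {1..<n}"
      define x where "x = (\<Sum>z<n. edge_weight b \<omega> v z) - real (n - 1) * \<mu>"
      have Qx: "Q v \<omega> = x\<^sup>2" unfolding Q_def x_def by (simp add: sum_edge_weight)
      have "real (n - 1) * \<mu> \<le> y" using \<mu> unfolding y_def \<mu>_def[symmetric] by (intro mult_right_mono) auto
      then have "(\<Sum>z<n. edge_weight b \<omega> v z) \<le> x + y" by (simp add: x_def)
      then have "(\<Sum>z<n. edge_weight b \<omega> v z) / y - 1 \<le> (x + y) / y - 1"
        using y by (intro diff_right_mono divide_right_mono) auto
      also have "\<dots> = x / y" using y by (simp add: field_simps)
      \<comment> \<open>The inequality 2 x s <= x^2 + s^2, balanced at the scale s = sqrt y of the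
        standard deviation.\<close>
      also have "x \<le> (x\<^sup>2 / s + s) / 2"
      proof -
        have "2 * x * s \<le> x\<^sup>2 + s * s" using zero_le_power2[of "x - s"] by (simp add: power2_eq_square algebra_simps)
        then show ?thesis using s(1) by (simp add: field_simps power2_eq_square)
      qed
      finally show "(\<Sum>z<n. edge_weight b \<omega> v z) / y - 1 \<le> (Q v \<omega> / s + s) / 2 / y"
        unfolding Qx using y by (simp add: divide_right_mono)
    qed
    finally show ?thesis .
  qed
  have low: "- ?A \<omega> \<le> low \<omega> \<and> 0 \<le> low \<omega>" if \<omega>: "\<forall>e\<in>complete_edges n. 0 \<le> \<omega> e \<and> \<omega> e \<le> 1" for \<omega>
  proof
    have M0: "0 \<le> M v \<omega>" if v: "v \<in> {1..<n}" for v
    proof -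
      have sub: "star v {..<min v m} \<subseteq> complete_edges n" using v by (intro star_subset) auto
      have "{v, 0} \<in> star v {..<min v m}" unfolding star_def using v m by (intro imageI) auto
      then have "\<omega> ` star v {..<min v m} \<noteq> {}" by blast
      moreover have "finite (\<omega> ` star v {..<min v m})" by (simp add: star_def)
      ultimately have "M v \<omega> \<in> \<omega> ` star v {..<min v m}" unfolding M_def by (intro Min_in)
      then show ?thesis using \<omega> sub by auto
    qed
    show "0 \<le> low \<omega>" unfolding low_def
      using M0 b lny \<delta> s Q0 S0
      by (intro add_nonneg_nonneg mult_nonneg_nonneg sum_nonneg divide_nonneg_nonneg) auto
    define Bad where "Bad = {v\<in>{m..<n}. (\<delta> * y)\<^sup>2 < Q v \<omega> \<or> (m * \<mu> / 2)\<^sup>2 < S v \<omega>}"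
    have dy: "0 < \<delta> * y" using \<delta> y by simp
    have mm: "0 < m * \<mu>" using m\<mu> s by linarith
    \<comment> \<open>Chebyshev's inequality in pointwise form: at an exceptional vertex one of the
      two normalised squares is at least 1.\<close>
    have "real (card Bad) = (\<Sum>v\<in>{m..<n}. of_bool (v \<in> Bad))"
      by (subst sum_of_bool_eq) (auto simp: Bad_def intro!: arg_cong[of _ _ card])
    also have "\<dots> \<le> (\<Sum>v\<in>{m..<n}. Q v \<omega> / (\<delta> * y)\<^sup>2 + 4 * S v \<omega> / (m * \<mu>)\<^sup>2)"
    proof (rule sum_mono)
      fix v assume v: "v \<in> {m..<n}"
      have 1: "0 \<le> Q v \<omega> / (\<delta> * y)\<^sup>2" "0 \<le> 4 * S v \<omega> / (m * \<mu>)\<^sup>2" using Q0 S0 by auto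
      have 2: "1 \<le> Q v \<omega> / (\<delta> * y)\<^sup>2" if "(\<delta> * y)\<^sup>2 < Q v \<omega>"
        using that dy zero_less_power[OF dy, of 2] by (subst le_divide_eq) (simp only: mult_1 if_True less_imp_le)
      have 3: "1 \<le> 4 * S v \<omega> / (m * \<mu>)\<^sup>2" if "(m * \<mu> / 2)\<^sup>2 < S v \<omega>"
        using that zero_less_power[OF mm, of 2]
        by (subst le_divide_eq) (simp only: mult_1 if_True power_divide, simp)
      show "of_bool (v \<in> Bad) \<le> Q v \<omega> / (\<delta> * y)\<^sup>2 + 4 * S v \<omega> / (m * \<mu>)\<^sup>2"
        using 1 2 3 by (auto simp: Bad_def)
    qed
    finally have cB: "real (card Bad) \<le> (\<Sum>v\<in>{m..<n}. Q v \<omega> / (\<delta> * y)\<^sup>2 + 4 * S v \<omega> / (m * \<mu>)\<^sup>2)" .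
    have "real (n - 1) * ln y - log_partition n b \<omega> \<le> (m + card Bad) * ln y +
      b * (\<Sum>v\<in>{1..<n}. Min (\<omega> ` star v {..<min v m})) + n * (4 * \<delta> + 16 / sqrt y)"
    proof (rule log_partition_lower)
      fix v assume v: "v \<in> {m..<n} - Bad"
      have eq: "(1 - 2 * \<delta>) * y = y - 2 * (\<delta> * y)" by (simp add: algebra_simps)
      have "\<bar>(\<Sum>z<n. edge_weight b \<omega> v z) - real (n - 1) * \<mu>\<bar> \<le> \<delta> * y"
        by (rule power2_le_imp_le) (use v dy in \<open>auto simp: Bad_def Q_def sum_edge_weight not_less\<close>)
      moreover have "\<bar>(\<Sum>z<m. edge_weight b \<omega> v z) - m * \<mu>\<bar> \<le> m * \<mu> / 2"
        by (rule power2_le_imp_le) (use v mm in \<open>auto simp: Bad_def S_def sum_edge_weight not_less\<close>)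
      moreover have "y - \<delta> * y \<le> real (n - 1) * \<mu>"
      proof -
        \<comment> \<open>A vertex has only n - 1 edges, so its mean degree is y -
          \<open>\<mu>\<close>. The missing \<open>\<mu>\<close> <= 1 is absorbed by a second
          \<open>\<delta> * y\<close>, whence the factor 2 in the lower bound for good
          vertices.\<close>
        have "1 \<le> \<delta> * y"
        proof -
          have "1 / r * (r * r * x) = r * x" if "0 < r" for r x :: real using that by simp
          from this[of "sqrt s" s] have "\<delta> * (sqrt s * sqrt s * s) = sqrt s * s"
            using s by (simp only: \<delta>_def) simp
          moreover have "sqrt s * sqrt s * s = y" using s by simp
          ultimately have "\<delta> * y = sqrt s * s" by metis
          moreover have "1 * 1 \<le> sqrt s * s" using s(1) by (intro mult_mono) auto
          ultimately show ?thesis by linarith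
        qed
        moreover have "real (n - 1) * \<mu> = y - \<mu>" using n by (simp add: y_def \<mu>_def algebra_simps of_nat_diff)
        ultimately show ?thesis using \<mu> by linarith
      qed
      moreover have "real (n - 1) * \<mu> \<le> y" using \<mu> unfolding y_def \<mu>_def[symmetric] by (intro mult_right_mono) auto
      moreover have "\<delta> * y \<le> 1 / 4 * y" using \<delta> y by (intro mult_right_mono) auto
      ultimately show "(1 - 2 * \<delta>) * y \<le> (\<Sum>z<n. edge_weight b \<omega> v z) \<and>
          (\<Sum>z<n. edge_weight b \<omega> v z) \<le> 2 * y \<and> sqrt y / 2 \<le> (\<Sum>z<m. edge_weight b \<omega> v z)"
        using y m\<mu> eq unfolding s_def[symmetric] abs_le_iff by (intro conjI; linarith)
    qed (use m b \<omega> y \<delta> in \<open>auto simp: Bad_def\<close>)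
    also have "\<dots> \<le> low \<omega>"
      using cB lny unfolding low_def M_def s_def by (simp add: distrib_right mult_right_mono)
    finally show "- ?A \<omega> \<le> low \<omega>" by simp
  qed
  have up0: "0 \<le> up \<omega>" for \<omega> unfolding up_def
    using Q0 s y by (intro sum_nonneg divide_nonneg_nonneg add_nonneg_nonneg) auto
  have iQ: "integrable (env_measure n) (\<lambda>\<omega>. Q v \<omega> / c)" if "v < n" for v c
    using Q(1)[OF that] by simp
  have iS: "integrable (env_measure n) (\<lambda>\<omega>. 4 * S v \<omega> / c)" if "v \<in> {m..<n}" for v c
    using S(1)[OF that] by simp
  let ?B = "\<lambda>\<omega>. \<Sum>v\<in>{m..<n}. Q v \<omega> / (\<delta> * y)\<^sup>2 + 4 * S v \<omega> / (m * \<mu>)\<^sup>2"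
  let ?M = "\<lambda>\<omega>. \<Sum>v\<in>{1..<n}. M v \<omega>"
  have iB: "integrable (env_measure n) ?B"
    by (intro Bochner_Integration.integrable_sum Bochner_Integration.integrable_add iQ iS) auto
  have iM: "integrable (env_measure n) ?M"
    by (intro Bochner_Integration.integrable_sum M(1))
  have EB: "(\<integral>\<omega>. ?B \<omega> \<partial>env_measure n) = (\<Sum>v\<in>{m..<n}. (\<integral>\<omega>. Q v \<omega> \<partial>env_measure n) / (\<delta> * y)\<^sup>2 +
      4 * (\<integral>\<omega>. S v \<omega> \<partial>env_measure n) / (m * \<mu>)\<^sup>2)"
  proof (subst Bochner_Integration.integral_sum)
    fix v assume v: "v \<in> {m..<n}"
    show "integrable (env_measure n) (\<lambda>\<omega>. Q v \<omega> / (\<delta> * y)\<^sup>2 + 4 * S v \<omega> / (m * \<mu>)\<^sup>2)"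
      using v by (intro Bochner_Integration.integrable_add iQ iS) auto
  next
    have "(\<integral>\<omega>. Q v \<omega> / (\<delta> * y)\<^sup>2 + 4 * S v \<omega> / (m * \<mu>)\<^sup>2 \<partial>env_measure n) =
        (\<integral>\<omega>. Q v \<omega> \<partial>env_measure n) / (\<delta> * y)\<^sup>2 + 4 * (\<integral>\<omega>. S v \<omega> \<partial>env_measure n) / (m * \<mu>)\<^sup>2"
      if v: "v \<in> {m..<n}" for v
      using v by (subst Bochner_Integration.integral_add[OF iQ iS]) auto
    then show "(\<Sum>v\<in>{m..<n}. \<integral>\<omega>. Q v \<omega> / (\<delta> * y)\<^sup>2 + 4 * S v \<omega> / (m * \<mu>)\<^sup>2 \<partial>env_measure n) =
        (\<Sum>v\<in>{m..<n}. (\<integral>\<omega>. Q v \<omega> \<partial>env_measure n) / (\<delta> * y)\<^sup>2 + 4 * (\<integral>\<omega>. S v \<omega> \<partial>env_measure n) / (m * \<mu>)\<^sup>2)"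
      by (intro sum.cong) auto
  qed
  have EM: "(\<integral>\<omega>. ?M \<omega> \<partial>env_measure n) = (\<Sum>v\<in>{1..<n}. 1 / (real (min v m) + 1))"
    by (subst Bochner_Integration.integral_sum[OF M(1)], assumption, intro sum.cong refl)
      (simp only: M(2) of_nat_add of_nat_1)
  have int_low: "integrable (env_measure n) low"
    unfolding low_def[abs_def] using iB iM
    by (intro Bochner_Integration.integrable_add integrable_mult_left integrable_mult_right) auto
  have iU: "integrable (env_measure n) (\<lambda>\<omega>. (Q v \<omega> / s + s) / 2 / y)" if "v \<in> {1..<n}" for v
    using iQ[of v s] that by auto
  have int_up: "integrable (env_measure n) up"
    unfolding up_def[abs_def] by (intro Bochner_Integration.integrable_sum iU)
  have AEA: "AE \<omega> in env_measure n. \<bar>?A \<omega>\<bar> \<le> low \<omega> + up \<omega>"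
    using AE_env
  proof eventually_elim
    case (elim \<omega>)
    show ?case using low[OF elim] up[of \<omega>] up0[of \<omega>] by linarith
  qed
  have intA: "integrable (env_measure n) ?A"
    by (rule Bochner_Integration.integrable_bound[of _ "\<lambda>\<omega>. low \<omega> + up \<omega>"])
      (use int_low int_up AEA log_partition_measurable in auto)
  have "integrable (env_measure n) (\<lambda>\<omega>. ?A \<omega> + real (n - 1) * ln y)"
    using intA by (intro Bochner_Integration.integrable_add) auto
  then show ?I by simp
  have "(\<integral>\<omega>. \<bar>?A \<omega>\<bar> \<partial>env_measure n) \<le> (\<integral>\<omega>. low \<omega> + up \<omega> \<partial>env_measure n)"
    using intA int_low int_up AEA by (intro integral_mono_AE) auto
  also have "\<dots> = (\<integral>\<omega>. low \<omega> \<partial>env_measure n) + (\<integral>\<omega>. up \<omega> \<partial>env_measure n)"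
    using int_low int_up by simp
  also have "(\<integral>\<omega>. up \<omega> \<partial>env_measure n) \<le> n * (1 / s)"
  proof -
    have "(\<integral>\<omega>. up \<omega> \<partial>env_measure n) = (\<Sum>v\<in>{1..<n}. ((\<integral>\<omega>. Q v \<omega> \<partial>env_measure n) / s + s) / 2 / y)"
      unfolding up_def
    proof (subst Bochner_Integration.integral_sum[OF iU], assumption, intro sum.cong refl)
      fix v assume "v \<in> {1..<n}"
      then show "(\<integral>\<omega>. (Q v \<omega> / s + s) / 2 / y \<partial>env_measure n) = ((\<integral>\<omega>. Q v \<omega> \<partial>env_measure n) / s + s) / 2 / y"
        using iQ[of v s] by (simp add: P.prob_space)
    qed
    also have "\<dots> \<le> (\<Sum>v\<in>{1..<n}. (y / s + s) / 2 / y)"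
      using Q(2) s y by (intro sum_mono divide_right_mono add_right_mono) auto
    also have "(y / s + s) / 2 / y = 1 / s" using s(1) unfolding s(2)[symmetric] by (simp add: field_simps)
    also have "(\<Sum>v\<in>{1..<n}. 1 / s) \<le> n * (1 / s)" using s by (simp add: divide_right_mono)
    finally show ?thesis .
  qed
  also have "(\<integral>\<omega>. low \<omega> \<partial>env_measure n) = m * ln y + (\<Sum>v\<in>{m..<n}. (\<integral>\<omega>. Q v \<omega> \<partial>env_measure n) / (\<delta> * y)\<^sup>2 +
      4 * (\<integral>\<omega>. S v \<omega> \<partial>env_measure n) / (m * \<mu>)\<^sup>2) * ln y +
      b * (\<Sum>v\<in>{1..<n}. 1 / (real (min v m) + 1)) + n * (4 * \<delta> + 16 / s)"
    unfolding low_def EB[symmetric] EM[symmetric] using iB iM by (simp add: P.prob_space)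
  also have "m * ln y \<le> (n / s + 1) * ln y" using m lny by (intro mult_right_mono) auto
  \<comment> \<open>The ratios of variance to squared tolerance are 1 / s for the degrees and 4 / (m
    \<open>\<mu>\<close>) <= 4 / s for the weights into the first \<open>m\<close> vertices.\<close>
  also have "(\<Sum>v\<in>{m..<n}. (\<integral>\<omega>. Q v \<omega> \<partial>env_measure n) / (\<delta> * y)\<^sup>2 +
      4 * (\<integral>\<omega>. S v \<omega> \<partial>env_measure n) / (m * \<mu>)\<^sup>2) * ln y \<le> (n * (5 / s)) * ln y"
  proof (intro mult_right_mono lny)
    have "(\<Sum>v\<in>{m..<n}. (\<integral>\<omega>. Q v \<omega> \<partial>env_measure n) / (\<delta> * y)\<^sup>2 +
        4 * (\<integral>\<omega>. S v \<omega> \<partial>env_measure n) / (m * \<mu>)\<^sup>2) \<le> (\<Sum>v\<in>{m..<n}. y / (\<delta> * y)\<^sup>2 + 4 * (m * \<mu>) / (m * \<mu>)\<^sup>2)"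
      using Q(2) S(2) by (intro sum_mono add_mono divide_right_mono mult_left_mono) auto
    also have "\<dots> \<le> (\<Sum>v\<in>{m..<n}. 5 / s)"
    proof (rule sum_mono)
      have "y / (\<delta> * y)\<^sup>2 = 1 / s"
        using s(1) \<delta>(1) unfolding power_mult_distrib \<delta>(3) s(2)[symmetric] by (simp add: field_simps power2_eq_square)
      moreover have "4 * (m * \<mu>) / (m * \<mu>)\<^sup>2 = 4 / (m * \<mu>)" by (simp add: power2_eq_square)
      moreover have "4 / (m * \<mu>) \<le> 4 / s" using m\<mu> s by (intro divide_left_mono) auto
      ultimately show "y / (\<delta> * y)\<^sup>2 + 4 * (m * \<mu>) / (m * \<mu>)\<^sup>2 \<le> 5 / s" by (simp add: add_divide_distrib[symmetric])
    qed
    also have "\<dots> \<le> n * (5 / s)" using s by (simp add: divide_right_mono)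
    finally show "(\<Sum>v\<in>{m..<n}. (\<integral>\<omega>. Q v \<omega> \<partial>env_measure n) / (\<delta> * y)\<^sup>2 +
        4 * (\<integral>\<omega>. S v \<omega> \<partial>env_measure n) / (m * \<mu>)\<^sup>2) \<le> n * (5 / s)" .
  qed
  \<comment> \<open>A harmonic sum covers v <= m; the remaining vertices contribute at most 1 / m
    each, in total at most n / m <= s.\<close>
  also have "(\<Sum>v\<in>{1..<n}. 1 / (real (min v m) + 1)) \<le> ln n + s"
  proof -
    have "(\<Sum>v\<in>{1..<n}. 1 / (real (min v m) + 1)) \<le> (\<Sum>v\<in>{1..<n}. 1 / (real v + 1) + 1 / m)"
    proof (rule sum_mono)
      fix v
      have "1 / (real m + 1) \<le> 1 / m" using m by (intro divide_left_mono) auto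
      then show "1 / (real (min v m) + 1) \<le> 1 / (real v + 1) + 1 / m"
        by (cases "v \<le> m") (auto simp: min_def intro: order_trans)
    qed
    also have "\<dots> = (\<Sum>v\<in>{1..<n}. 1 / (real v + 1)) + real (n - 1) / m" by (simp add: sum.distrib)
    also have "real (n - 1) / m \<le> s"
    proof -
      have "real (n - 1) \<le> n / s * s" using s by simp
      also have "\<dots> \<le> m * s" using m s by (intro mult_right_mono) auto
      finally show ?thesis using m by (simp add: divide_le_eq mult.commute)
    qed
    finally show ?thesis using harmonic_le_ln[of n] n by simp
  qed
  finally have "(\<integral>\<omega>. \<bar>?A \<omega>\<bar> \<partial>env_measure n) \<le> (n / s + 1) * ln y + n * (5 / s) * ln y + b * (ln n + s) +
      n * (4 * \<delta> + 16 / s) + n * (1 / s)" using b by (simp add: mult_left_mono)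
  also have "\<dots> = n * (6 * (ln y / s) + 17 / s + 4 * \<delta>) + ln y + b * (ln n + s)"
    by (simp add: algebra_simps add_divide_distrib[symmetric])
  finally show ?E by (simp add: s_def \<delta>_def)
qed


section \<open>The regime of small inverse temperature\<close>

text \<open>The mean of the uniform law tilted by exp (- b x), equivalently minus the logarithmic
  derivative of \<open>mean_weight\<close>.\<close>

definition tilted_mean :: "real \<Rightarrow> real" where
  "tilted_mean b = 1 / b * ((1 - b * exp (- b) - exp (- b)) / (1 - exp (- b)))"

lemma times_tilted_mean:
  assumes "0 < b"
  shows "b * tilted_mean b = 1 - b / (exp b - 1)"
proof -
  have "1 < exp b" using assms by simp
  then show ?thesis using assms by (simp add: tilted_mean_def exp_minus field_simps)
qed

text \<open>b / (exp b - 1) decreases because exp is convex, so that its chord slopes from 0 grow.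
  The monotone product compares \<open>tilted_mean\<close> at two arguments up to their
  ratio.\<close>

lemma times_tilted_mean_mono:
  assumes "0 < b" "b \<le> c"
  shows "b * tilted_mean b \<le> c * tilted_mean c"
proof -
  define t where "t = b / c"
  have t: "0 \<le> t" "t \<le> 1" "b = (1 - t) * 0 + t * c" using assms by (auto simp: t_def)
  have "exp ((1 - t) *\<^sub>R 0 + t *\<^sub>R c) \<le> (1 - t) * exp 0 + t * exp c"
    by (rule convex_onD[OF exp_convex]) (use t in auto)
  then have "exp b - 1 \<le> t * (exp c - 1)" using t by (simp add: algebra_simps)
  then have "c * (exp b - 1) \<le> b * (exp c - 1)" using assms by (simp add: t_def field_simps)
  moreover have "1 < exp b" "1 < exp c" using assms by auto
  ultimately have "c / (exp c - 1) \<le> b / (exp b - 1)" by (simp add: field_simps)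
  then show ?thesis using assms by (simp add: times_tilted_mean)
qed

lemma tilted_mean_ge:
  assumes "0 < b"
  shows "1 / (2 + b) \<le> tilted_mean b"
proof -
  have "b + b\<^sup>2 / 2 \<le> exp b - 1" using exp_lower_Taylor_quadratic[of b] assms by simp
  then have "b / (exp b - 1) \<le> b / (b + b\<^sup>2 / 2)"
    using assms by (intro divide_left_mono mult_pos_pos) (auto intro: add_pos_pos)
  also have "b + b\<^sup>2 / 2 = b * ((2 + b) / 2)" by (simp add: field_simps power2_eq_square)
  also have "b / (b * ((2 + b) / 2)) = 2 / (2 + b)" using assms by simp
  finally have "1 - 2 / (2 + b) \<le> b * tilted_mean b" using assms by (simp add: times_tilted_mean)
  also have "1 - 2 / (2 + b) = b * (1 / (2 + b))" using assms by (simp add: field_simps)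
  finally show ?thesis using assms by (simp only: mult_le_cancel_left_pos)
qed

lemma tilted_mean_pos: "0 < b \<Longrightarrow> 0 < tilted_mean b"
  using tilted_mean_ge[of b] by (smt (verit) zero_less_divide_1_iff)

lemma tilted_mean_limit: "(tilted_mean \<longlongrightarrow> 1 / 2) (at_right 0)"
  unfolding tilted_mean_def[abs_def] by real_asymp

lemma has_derivative_ln_mean_weight:
  assumes "0 < b"
  shows "((\<lambda>b. ln (mean_weight b)) has_real_derivative - tilted_mean b) (at b)"
proof -
  have 1: "0 < 1 - exp (- b)" using assms by simp
  show ?thesis unfolding mean_weight_def
    by (rule derivative_eq_intros refl | use assms 1 in \<open>simp add: tilted_mean_def field_simps\<close>)+
qed

text \<open>The mean value theorem; monotonicity of b \<open>tilted_mean\<close> b then moves the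
  intermediate point to \<open>b\<close> at the price of a factor 1 / (1 -
  \<open>\<epsilon>\<close>) or 1 / (1 + \<open>\<epsilon>\<close>).\<close>

lemma ln_mean_weight_diff:
  assumes b: "0 < b" and \<epsilon>: "0 < \<epsilon>" "\<epsilon> < 1"
  shows "ln (mean_weight (b * (1 - \<epsilon>))) - ln (mean_weight b) \<le> \<epsilon> * b * (tilted_mean b / (1 - \<epsilon>))"
    and "\<epsilon> * b * (tilted_mean b / (1 + \<epsilon>)) \<le> ln (mean_weight b) - ln (mean_weight (b * (1 + \<epsilon>)))"
proof -
  have "b * (1 - \<epsilon>) < b" and p: "0 < b * (1 - \<epsilon>)" using b \<epsilon> by auto
  then obtain z where z: "b * (1 - \<epsilon>) < z" "z < b"
    "ln (mean_weight b) - ln (mean_weight (b * (1 - \<epsilon>))) = (b - b * (1 - \<epsilon>)) * (- tilted_mean z)"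
    using MVT2[of "b * (1 - \<epsilon>)" b "\<lambda>b. ln (mean_weight b)" "\<lambda>b. - tilted_mean b"]
      has_derivative_ln_mean_weight by (smt (verit))
  have z0: "0 < z" using z p by linarith
  have "tilted_mean z = z * tilted_mean z / z" using z0 by simp
  also have "\<dots> \<le> b * tilted_mean b / z"
    using times_tilted_mean_mono[of z b] z z0 by (intro divide_right_mono) auto
  also have "\<dots> \<le> b * tilted_mean b / (b * (1 - \<epsilon>))"
    using z p b tilted_mean_pos[OF b] by (intro divide_left_mono) auto
  also have "\<dots> = tilted_mean b / (1 - \<epsilon>)" using b by simp
  finally have "\<epsilon> * b * tilted_mean z \<le> \<epsilon> * b * (tilted_mean b / (1 - \<epsilon>))" using b \<epsilon> by (intro mult_left_mono) auto
  then show "ln (mean_weight (b * (1 - \<epsilon>))) - ln (mean_weight b) \<le> \<epsilon> * b * (tilted_mean b / (1 - \<epsilon>))"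
    using z(3) by (simp add: algebra_simps)
next
  have "b < b * (1 + \<epsilon>)" using b \<epsilon> by auto
  then obtain z where z: "b < z" "z < b * (1 + \<epsilon>)"
    "ln (mean_weight (b * (1 + \<epsilon>))) - ln (mean_weight b) = (b * (1 + \<epsilon>) - b) * (- tilted_mean z)"
    using MVT2[of b "b * (1 + \<epsilon>)" "\<lambda>b. ln (mean_weight b)" "\<lambda>b. - tilted_mean b"]
      has_derivative_ln_mean_weight b by (smt (verit))
  have z0: "0 < z" using z b by linarith
  have "tilted_mean b / (1 + \<epsilon>) = b * tilted_mean b / (b * (1 + \<epsilon>))" using b by simp
  also have "\<dots> \<le> b * tilted_mean b / z"
    using z z0 b tilted_mean_pos[OF b] \<epsilon> by (intro divide_left_mono) auto
  also have "\<dots> \<le> z * tilted_mean z / z"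
    using times_tilted_mean_mono[of b z] z z0 b by (intro divide_right_mono) auto
  also have "\<dots> = tilted_mean z" using z0 by simp
  finally have "\<epsilon> * b * (tilted_mean b / (1 + \<epsilon>)) \<le> \<epsilon> * b * tilted_mean z" using b \<epsilon> by (intro mult_left_mono) auto
  then show "\<epsilon> * b * (tilted_mean b / (1 + \<epsilon>)) \<le> ln (mean_weight b) - ln (mean_weight (b * (1 + \<epsilon>)))"
    using z(3) by (simp add: algebra_simps)
qed

section \<open>From deviations of ln Z to the mean length\<close>

definition log_dev :: "nat \<Rightarrow> real \<Rightarrow> environment \<Rightarrow> real" where
  "log_dev n b \<omega> = \<bar>log_partition n b \<omega> - real (n - 1) * ln (real n * mean_weight b)\<bar>"

lemma log_dev_nonneg: "0 \<le> log_dev n b \<omega>"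
  by (simp add: log_dev_def)

text \<open>The tangent at \<open>b\<close>, read off at b (1 - \<open>\<epsilon>\<close>) and b (1
  + \<open>\<epsilon>\<close>), traps the mean length between two difference quotients. A step
  proportional to \<open>b\<close> keeps their relative error of order \<open>\<epsilon>\<close>;
  deviations of ln Z are divided by the step, and the term 1 / n pays for replacing n - 1 by
  n.\<close>

lemma mean_length_deviation:
  assumes n: "1 \<le> n" and b: "0 < b" and \<epsilon>: "0 < \<epsilon>" "\<epsilon> \<le> 1 / 2"
  shows "\<bar>rstre_mean_length n b \<omega> - n * tilted_mean b\<bar> \<le> n * tilted_mean b * (2 * \<epsilon> + 1 / n) +
    (log_dev n (b * (1 - \<epsilon>)) \<omega> + log_dev n b \<omega> + log_dev n (b * (1 + \<epsilon>)) \<omega>) / (\<epsilon> * b)"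
proof -
  define m where "m = tilted_mean b"
  define X where "X = rstre_mean_length n b \<omega>"
  define D where "D = log_dev n (b * (1 - \<epsilon>)) \<omega> + log_dev n b \<omega> + log_dev n (b * (1 + \<epsilon>)) \<omega>"
  have m0: "0 < m" unfolding m_def by (rule tilted_mean_pos[OF b])
  have e0: "0 < \<epsilon> * b" using b \<epsilon> by simp
  have lnw: "ln (real n * mean_weight c) = ln n + ln (mean_weight c)" if "0 < c" for c
    using n mean_weight_bounds[OF that] by (simp add: ln_mult)
  have p: "0 < b * (1 - \<epsilon>)" "0 < b * (1 + \<epsilon>)" using b \<epsilon> by auto
  have *: "log_partition n c \<omega> \<le> real (n - 1) * ln n + real (n - 1) * ln (mean_weight c) + log_dev n c \<omega>"
    "real (n - 1) * ln n + real (n - 1) * ln (mean_weight c) - log_dev n c \<omega> \<le> log_partition n c \<omega>" if "0 < c" for c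
    using abs_ge_self[of "log_partition n c \<omega> - real (n - 1) * (ln n + ln (mean_weight c))"]
      abs_ge_minus_self[of "log_partition n c \<omega> - real (n - 1) * (ln n + ln (mean_weight c))"]
    unfolding log_dev_def lnw[OF that] distrib_left by linarith+
  note abs_bounds = *[OF b] *[OF p(1)] *[OF p(2)] log_dev_nonneg[of n b \<omega>]
    log_dev_nonneg[of n "b * (1 - \<epsilon>)" \<omega>] log_dev_nonneg[of n "b * (1 + \<epsilon>)" \<omega>]
  have "\<epsilon> * b * X \<le> log_partition n (b * (1 - \<epsilon>)) \<omega> - log_partition n b \<omega>"
    using log_partition_tangent[of n b \<omega> "b * (1 - \<epsilon>)"] by (simp add: X_def algebra_simps)
  also have "\<dots> \<le> real (n - 1) * (ln (mean_weight (b * (1 - \<epsilon>))) - ln (mean_weight b)) + D"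
    using abs_bounds unfolding D_def right_diff_distrib by linarith
  also have "real (n - 1) * (ln (mean_weight (b * (1 - \<epsilon>))) - ln (mean_weight b)) \<le>
      real (n - 1) * (\<epsilon> * b * (m / (1 - \<epsilon>)))"
    unfolding m_def using b \<epsilon> by (intro mult_left_mono ln_mean_weight_diff) auto
  also have "\<dots> \<le> n * (\<epsilon> * b * (m * (1 + 2 * \<epsilon>)))"
  proof (intro mult_mono mult_left_mono)
    have "1 \<le> (1 + 2 * \<epsilon>) * (1 - \<epsilon>)" using mult_left_mono[of \<epsilon> "1/2" \<epsilon>] \<epsilon> by (simp add: algebra_simps)
    then have "1 / (1 - \<epsilon>) \<le> 1 + 2 * \<epsilon>" using \<epsilon> by (simp add: divide_le_eq)
    then show "m / (1 - \<epsilon>) \<le> m * (1 + 2 * \<epsilon>)" using mult_left_mono[of "1 / (1 - \<epsilon>)" "1 + 2 * \<epsilon>" m] m0 by simp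
  qed (use e0 m0 \<epsilon> b in auto)
  also have "\<dots> = \<epsilon> * b * (n * m * (1 + 2 * \<epsilon>))" by (simp only: ac_simps)
  finally have "\<epsilon> * b * X \<le> \<epsilon> * b * (n * m * (1 + 2 * \<epsilon>) + D / (\<epsilon> * b))"
    using e0 by (simp add: distrib_left)
  then have 1: "X \<le> n * m * (1 + 2 * \<epsilon>) + D / (\<epsilon> * b)" using e0 by (simp only: mult_le_cancel_left_pos)
  have "\<epsilon> * b * (n * m * (1 - \<epsilon> - 1 / n)) = n * (1 - \<epsilon> - 1 / n) * (\<epsilon> * b * m)" by (simp only: ac_simps)
  also have "\<dots> \<le> real (n - 1) / (1 + \<epsilon>) * (\<epsilon> * b * m)"
  proof (intro mult_right_mono)
    have "n * (1 - \<epsilon> - 1 / n) = real (n - 1) - n * \<epsilon>" using n by (simp add: algebra_simps of_nat_diff)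
    also have "\<dots> \<le> real (n - 1) - real (n - 1) * \<epsilon>" using \<epsilon> by (simp add: mult_right_mono)
    also have "\<dots> \<le> real (n - 1) / (1 + \<epsilon>)"
    proof -
      have "(1 - \<epsilon>) * (1 + \<epsilon>) \<le> 1" by (simp add: algebra_simps)
      then have "1 - \<epsilon> \<le> 1 / (1 + \<epsilon>)" using \<epsilon> by (simp add: le_divide_eq)
      then show ?thesis using mult_left_mono[of "1 - \<epsilon>" "1 / (1 + \<epsilon>)" "real (n - 1)"] by (simp add: algebra_simps)
    qed
    finally show "n * (1 - \<epsilon> - 1 / n) \<le> real (n - 1) / (1 + \<epsilon>)" .
  qed (use e0 m0 in auto)
  also have "\<dots> = real (n - 1) * (\<epsilon> * b * (m / (1 + \<epsilon>)))" by simp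
  also have "\<dots> \<le> real (n - 1) * (ln (mean_weight b) - ln (mean_weight (b * (1 + \<epsilon>))))"
    unfolding m_def using b \<epsilon> by (intro mult_left_mono ln_mean_weight_diff) auto
  also have "\<dots> \<le> log_partition n b \<omega> - log_partition n (b * (1 + \<epsilon>)) \<omega> + D"
    using abs_bounds unfolding D_def right_diff_distrib by linarith
  also have "\<dots> \<le> \<epsilon> * b * X + D"
    using log_partition_tangent[of n b \<omega> "b * (1 + \<epsilon>)"] by (simp add: X_def algebra_simps)
  finally have "\<epsilon> * b * (n * m * (1 - \<epsilon> - 1 / n)) \<le> \<epsilon> * b * (X + D / (\<epsilon> * b))"
    using e0 by (simp add: distrib_left)
  then have 2: "n * m * (1 - \<epsilon> - 1 / n) \<le> X + D / (\<epsilon> * b)" using e0 by (simp only: mult_le_cancel_left_pos)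
  have nm: "0 \<le> n * m * \<epsilon>" using m0 \<epsilon> by simp
  have nm': "0 \<le> n * m * (1 / n)" using m0 by simp
  have "X - n * m \<le> n * m * (2 * \<epsilon> + 1 / n) + D / (\<epsilon> * b)"
    using 1 nm' by (simp only: distrib_left mult_1_right; linarith)
  moreover have "- (X - n * m) \<le> n * m * (2 * \<epsilon> + 1 / n) + D / (\<epsilon> * b)"
  proof -
    have "n * m * (1 - \<epsilon> - 1 / n) = n * m - n * m * \<epsilon> - n * m * (1 / n)"
      by (simp only: right_diff_distrib mult_1_right)
    moreover have "n * m * (2 * \<epsilon> + 1 / n) = 2 * (n * m * \<epsilon>) + n * m * (1 / n)"
      by (simp only: distrib_left mult.left_commute)
    ultimately show ?thesis using 2 nm by linarith
  qed
  ultimately show ?thesis unfolding X_def[symmetric] m_def[symmetric] D_def[symmetric] by linarith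
qed

text \<open>For b >= \<open>\<eta>\<close> the mean weight is at least a constant over b, and b =
  o(n) because ln n is eventually at least 1.\<close>

lemma expected_weighted_degree_tendsto:
  assumes \<eta>: "0 < \<eta>" "\<And>n. \<eta> \<le> b n" and lim: "(\<lambda>n. b n * ln (real n) / real n) \<longlonglongrightarrow> 0"
  shows "(\<lambda>n. b n / real n) \<longlonglongrightarrow> 0"
    and "filterlim (\<lambda>n. real n * mean_weight (b n)) at_top sequentially"
proof -
  have b0: "0 < b n" for n using \<eta>(1) \<eta>(2)[of n] by linarith
  show bn: "(\<lambda>n. b n / real n) \<longlonglongrightarrow> 0"
  proof (rule tendsto_sandwich[OF _ _ tendsto_const lim])
    have "eventually (\<lambda>n :: nat. 1 \<le> ln (real n)) sequentially" by real_asymp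
    then show "eventually (\<lambda>n. b n / real n \<le> b n * ln (real n) / real n) sequentially"
    proof eventually_elim
      case (elim n)
      have "b n * 1 \<le> b n * ln (real n)" using elim b0[of n] by (intro mult_left_mono) auto
      then show ?case by (simp add: divide_right_mono)
    qed
  qed (use b0 in \<open>auto simp: less_imp_le intro!: always_eventually\<close>)
  have "filterlim (\<lambda>n. b n / real n) (at_right 0) sequentially"
    unfolding filterlim_at
  proof (intro conjI bn)
    show "eventually (\<lambda>n. b n / real n \<in> {0<..} \<and> b n / real n \<noteq> 0) sequentially"
      using eventually_gt_at_top[of 0]
    proof eventually_elim
      case (elim n)
      then show ?case using b0[of n] by simp
    qed
  qed
  then have inv: "filterlim (\<lambda>n. inverse (b n / real n)) at_top sequentially"
    by (rule filterlim_compose[OF filterlim_inverse_at_top_right])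
  define c where "c = 1 - exp (- \<eta>)"
  have c: "0 < c" using \<eta> by (simp add: c_def)
  have "filterlim (\<lambda>n. c * inverse (b n / real n)) at_top sequentially"
    by (rule filterlim_tendsto_pos_mult_at_top[OF tendsto_const c inv])
  then show "filterlim (\<lambda>n. real n * mean_weight (b n)) at_top sequentially"
  proof (rule filterlim_at_top_mono, intro always_eventually allI)
    fix n
    have "exp (- b n) \<le> exp (- \<eta>)" using \<eta>(2)[of n] by simp
    then have "c / b n \<le> mean_weight (b n)" unfolding mean_weight_def c_def using b0[of n] by (intro divide_right_mono) auto
    then have "real n * (c / b n) \<le> real n * mean_weight (b n)" by (intro mult_left_mono) auto
    then show "c * inverse (b n / real n) \<le> real n * mean_weight (b n)" by (simp add: mult.commute)
  qed
qed

text \<open>The terms free of b are o(n) because y tends to infinity. The cheapest edges cost b ln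
  n, which is o(n) by \<open>lim\<close>, and b sqrt y, which is at most sqrt (b n) because y <= n /
  b.\<close>

lemma log_dev_tendsto:
  assumes \<eta>: "0 < \<eta>" "\<And>n. \<eta> \<le> b n" and lim: "(\<lambda>n. b n * ln (real n) / real n) \<longlonglongrightarrow> 0"
  shows "eventually (\<lambda>n. integrable (env_measure n) (log_dev n (b n))) sequentially"
    and "(\<lambda>n. (\<integral>\<omega>. log_dev n (b n) \<omega> \<partial>env_measure n) / real n) \<longlonglongrightarrow> 0"
proof -
  have b0: "0 < b n" for n using \<eta>(1) \<eta>(2)[of n] by linarith
  define y where "y n = real n * mean_weight (b n)" for n
  note bn = expected_weighted_degree_tendsto(1)[OF assms]
  note yt = expected_weighted_degree_tendsto(2)[OF assms, folded y_def]
  have ev: "eventually (\<lambda>n. 256 \<le> y n) sequentially" using yt by (auto simp: filterlim_at_top)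
  have ev2: "eventually (\<lambda>n :: nat. 2 \<le> n) sequentially" by (rule eventually_ge_at_top)
  show "eventually (\<lambda>n. integrable (env_measure n) (log_dev n (b n))) sequentially"
    using ev ev2
  proof eventually_elim
    case (elim n)
    interpret prob_space "env_measure n" by (rule prob_space_env_measure)
    have "integrable (env_measure n) (log_partition n (b n))"
      by (rule log_partition_mean_deviation) (use elim b0 in \<open>auto simp: y_def\<close>)
    then show ?case unfolding log_dev_def[abs_def] by auto
  qed
  let ?g = "\<lambda>y :: real. 6 * (ln y / sqrt y) + 17 / sqrt y + 4 / sqrt (sqrt y) + ln y / y"
  let ?R = "\<lambda>n. ?g (y n) + (b n * ln (real n) / real n + sqrt (b n / real n))"
  have "(?g \<longlongrightarrow> 0) at_top" by real_asymp
  then have g: "(\<lambda>n. ?g (y n)) \<longlonglongrightarrow> 0" by (rule filterlim_compose[OF _ yt])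
  have "(\<lambda>n. sqrt (b n / real n)) \<longlonglongrightarrow> sqrt 0" by (rule tendsto_real_sqrt[OF bn])
  then have R: "?R \<longlonglongrightarrow> 0" using tendsto_add[OF g tendsto_add[OF lim]] by simp
  show "(\<lambda>n. (\<integral>\<omega>. log_dev n (b n) \<omega> \<partial>env_measure n) / real n) \<longlonglongrightarrow> 0"
  proof (rule tendsto_sandwich[OF _ _ tendsto_const R])
    show "eventually (\<lambda>n. (\<integral>\<omega>. log_dev n (b n) \<omega> \<partial>env_measure n) / real n \<le> ?R n) sequentially"
      using ev ev2
    proof eventually_elim
      case (elim n)
      have n0: "0 < real n" using elim by simp
      have yn: "y n \<le> n" "y n \<le> n / b n" using mean_weight_bounds[OF b0[of n]] mult_left_mono[of "mean_weight (b n)" "1 / b n" "real n"]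
        by (auto simp: y_def mult_left_le)
      have "(\<integral>\<omega>. log_dev n (b n) \<omega> \<partial>env_measure n) \<le>
          n * (6 * (ln (y n) / sqrt (y n)) + 17 / sqrt (y n) + 4 / sqrt (sqrt (y n))) + ln (y n) + b n * (ln n + sqrt (y n))"
        unfolding log_dev_def y_def by (rule log_partition_mean_deviation) (use elim b0 in \<open>auto simp: y_def\<close>)
      then have "(\<integral>\<omega>. log_dev n (b n) \<omega> \<partial>env_measure n) / real n \<le>
          (n * (6 * (ln (y n) / sqrt (y n)) + 17 / sqrt (y n) + 4 / sqrt (sqrt (y n))) + ln (y n) + b n * (ln n + sqrt (y n))) / n"
        using n0 by (intro divide_right_mono) auto
      also have "\<dots> = 6 * (ln (y n) / sqrt (y n)) + 17 / sqrt (y n) + 4 / sqrt (sqrt (y n)) + ln (y n) / n +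
          (b n * ln n / n + b n * sqrt (y n) / n)"
        using n0 by (simp add: add_divide_distrib distrib_left)
      also have "ln (y n) / n \<le> ln (y n) / y n" using yn elim n0 by (intro divide_left_mono) auto
      also have "b n * sqrt (y n) / n \<le> sqrt (b n / n)"
      proof -
        have "b n * sqrt (y n) / n \<le> b n * sqrt (n / b n) / n"
          using yn b0[of n] n0 by (intro divide_right_mono mult_left_mono) auto
        also have "\<dots> = sqrt (b n / n)"
        proof -
          have "b n = sqrt (b n) * sqrt (b n)" "real n = sqrt n * sqrt n" using b0[of n] by auto
          then show ?thesis using b0[of n] n0 by (simp add: real_sqrt_divide field_simps)
        qed
        finally show ?thesis .
      qed
      finally show ?case by simp
    qed
  qed (auto simp: log_dev_def intro!: always_eventually)
qed

text \<open>Relative to n \<open>tilted_mean\<close> b the deviations of ln Z contribute o(n) /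
  (\<open>\<epsilon>\<close> b n \<open>tilted_mean\<close> b). Monotonicity bounds b
  \<open>tilted_mean\<close> b from below by its value \<open>h\<close> at \<open>\<eta>\<close>, so
  the quotient vanishes however large b is within the regime. This is where b has to stay away from
  0.\<close>

lemma mean_length_concentration_away:
  assumes \<eta>: "0 < \<eta>" "\<And>n. \<eta> \<le> b n" and lim: "(\<lambda>n. b n * ln (real n) / real n) \<longlonglongrightarrow> 0"
  shows "(\<lambda>n. \<integral>\<omega>. \<bar>rstre_mean_length n (b n) \<omega> / (real n * tilted_mean (b n)) - 1\<bar> \<partial>env_measure n) \<longlonglongrightarrow> 0"
    (is "?E \<longlonglongrightarrow> 0")
proof (rule LIMSEQ_I)
  fix r :: real assume r: "0 < r"
  define \<epsilon> where "\<epsilon> = min (1 / 2) (r / 8)"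
  have \<epsilon>: "0 < \<epsilon>" "\<epsilon> \<le> 1 / 2" "2 * \<epsilon> \<le> r / 4" using r by (auto simp: \<epsilon>_def)
  have b0: "0 < b n" for n using \<eta>(1) \<eta>(2)[of n] by linarith
  let ?D = "\<lambda>c n. \<integral>\<omega>. log_dev n (b n * c) \<omega> \<partial>env_measure n"
  let ?I = "\<lambda>c n. integrable (env_measure n) (log_dev n (b n * c))"
  define h where "h = \<eta> * tilted_mean \<eta>"
  have h: "0 < h" using \<eta> tilted_mean_pos by (simp add: h_def)
  have D: "eventually (?I c) sequentially" "(\<lambda>n. ?D c n / real n) \<longlonglongrightarrow> 0" if c: "1 / 2 \<le> c" for c
  proof -
    \<comment> \<open>As \<open>\<epsilon>\<close> is at most 1 / 2, all three inverse temperatures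
      of the difference quotients stay above \<open>\<eta> / 2\<close>.\<close>
    have 1: "0 < \<eta> / 2" using \<eta> by simp
    have 2: "\<eta> / 2 \<le> b n * c" for n using mult_mono[OF \<eta>(2)[of n] c] \<eta> b0[of n] by simp
    have 3: "(\<lambda>n. (b n * c) * ln (real n) / real n) \<longlonglongrightarrow> 0"
      using tendsto_mult_left[OF lim, of c] by (simp add: ac_simps)
    show "eventually (?I c) sequentially" "(\<lambda>n. ?D c n / real n) \<longlonglongrightarrow> 0"
      using log_dev_tendsto[OF 1 2 3] by auto
  qed
  have c: "1 / 2 \<le> 1 - \<epsilon>" "1 / 2 \<le> (1 :: real)" "1 / 2 \<le> 1 + \<epsilon>" using \<epsilon> by auto
  have "(\<lambda>n. (?D (1 - \<epsilon>) n / n + ?D 1 n / n + ?D (1 + \<epsilon>) n / n) / (\<epsilon> * h)) \<longlonglongrightarrow> (0 + 0 + 0) / (\<epsilon> * h)"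
    using \<epsilon> h by (intro tendsto_intros D c) auto
  then have ev1: "eventually (\<lambda>n. (?D (1 - \<epsilon>) n / n + ?D 1 n / n + ?D (1 + \<epsilon>) n / n) / (\<epsilon> * h) < r / 4) sequentially"
    using r by (intro order_tendstoD(2)) auto
  have "eventually (\<lambda>n :: nat. 1 / real n < r / 4) sequentially"
    using order_tendstoD(2)[OF lim_1_over_n, of "r / 4"] r by simp
  then have "eventually (\<lambda>n. ?E n < r) sequentially"
    using ev1 D(1)[OF c(1)] D(1)[OF c(2)] D(1)[OF c(3)] eventually_ge_at_top[of 1]
  proof eventually_elim
    case (elim n)
    interpret prob_space "env_measure n" by (rule prob_space_env_measure)
    define m where "m = tilted_mean (b n)"
    have m: "0 < m" unfolding m_def by (rule tilted_mean_pos[OF b0])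
    have hb: "h \<le> b n * m" unfolding h_def m_def using \<eta> by (intro times_tilted_mean_mono) auto
    have n0: "0 < real n" using elim by simp
    let ?S = "\<lambda>\<omega>. log_dev n (b n * (1 - \<epsilon>)) \<omega> + log_dev n (b n * 1) \<omega> + log_dev n (b n * (1 + \<epsilon>)) \<omega>"
    have pt: "\<bar>rstre_mean_length n (b n) \<omega> / (real n * m) - 1\<bar> \<le> (2 * \<epsilon> + 1 / n) + ?S \<omega> / (\<epsilon> * h * n)" for \<omega>
    proof -
      have S0: "0 \<le> ?S \<omega>" by (simp add: log_dev_def)
      have nm: "0 < n * m" using n0 m by simp
      have "\<bar>rstre_mean_length n (b n) \<omega> / (real n * m) - 1\<bar> = \<bar>rstre_mean_length n (b n) \<omega> - n * m\<bar> / (n * m)"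
      proof -
        have "rstre_mean_length n (b n) \<omega> / (real n * m) - 1 = (rstre_mean_length n (b n) \<omega> - n * m) / (n * m)"
          using nm n0 m by (simp add: diff_divide_distrib)
        then show ?thesis using nm by (simp only: abs_divide; simp)
      qed
      also have "\<dots> \<le> (n * m * (2 * \<epsilon> + 1 / n) + ?S \<omega> / (\<epsilon> * b n)) / (n * m)"
        using mean_length_deviation[OF _ b0[of n] \<epsilon>(1,2), of n \<omega>] elim nm
        by (intro divide_right_mono) (auto simp: m_def)
      also have "\<dots> = (2 * \<epsilon> + 1 / n) + ?S \<omega> / (\<epsilon> * b n) / (n * m)"
        using n0 m by (simp add: add_divide_distrib)
      also have "?S \<omega> / (\<epsilon> * b n) / (n * m) = ?S \<omega> / (\<epsilon> * (b n * m) * n)" by (simp add: ac_simps)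
      also have "\<dots> \<le> ?S \<omega> / (\<epsilon> * h * n)"
        using S0 hb h \<epsilon> n0 m b0[of n]
        by (intro divide_left_mono mult_right_mono mult_left_mono mult_pos_pos) auto
      finally show ?thesis by simp
    qed
    have "?E n \<le> (\<integral>\<omega>. (2 * \<epsilon> + 1 / n) + ?S \<omega> / (\<epsilon> * h * n) \<partial>env_measure n)"
      unfolding m_def[symmetric]
    proof (rule integral_mono)
      show "integrable (env_measure n) (\<lambda>\<omega>. \<bar>rstre_mean_length n (b n) \<omega> / (real n * m) - 1\<bar>)"
        using integrable_mean_length[of n "b n"] by auto
      show "integrable (env_measure n) (\<lambda>\<omega>. (2 * \<epsilon> + 1 / n) + ?S \<omega> / (\<epsilon> * h * n))"
        using elim by (intro Bochner_Integration.integrable_add integrable_divide) auto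
    qed (rule pt)
    also have "\<dots> = (2 * \<epsilon> + 1 / n) + (\<integral>\<omega>. ?S \<omega> \<partial>env_measure n) / (\<epsilon> * h * n)"
      using elim by (simp add: prob_space)
    also have "(\<integral>\<omega>. ?S \<omega> \<partial>env_measure n) = ?D (1 - \<epsilon>) n + ?D 1 n + ?D (1 + \<epsilon>) n"
      using elim by simp
    also have "\<dots> / (\<epsilon> * h * n) = (?D (1 - \<epsilon>) n / n + ?D 1 n / n + ?D (1 + \<epsilon>) n / n) / (\<epsilon> * h)"
      by (simp add: add_divide_distrib ac_simps)
    finally show "?E n < r" using elim(1,2) \<epsilon>(3) r by linarith
  qed
  then obtain N where N: "\<And>n. n \<ge> N \<Longrightarrow> ?E n < r" by (auto simp: eventually_sequentially)
  show "\<exists>N. \<forall>n\<ge>N. norm (?E n - 0) < r"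
    by (intro exI[of _ N] allI impI) (use N in simp)
qed

text \<open>For inverse temperatures below a small threshold eta the length is squeezed, by monotonicity,
  between the values at eta and at 0, whose means are close to each other.\<close>

lemma mean_length_concentration:
  assumes b0: "\<And>n. 0 < b n" and lim: "(\<lambda>n. b n * ln (real n) / real n) \<longlonglongrightarrow> 0"
  shows "(\<lambda>n. \<integral>\<omega>. \<bar>rstre_mean_length n (b n) \<omega> / (real n * tilted_mean (b n)) - 1\<bar> \<partial>env_measure n) \<longlonglongrightarrow> 0"
    (is "?E \<longlonglongrightarrow> 0")
proof (rule LIMSEQ_I)
  fix r :: real assume r: "0 < r"
  \<comment> \<open>The final bound is 20 q + r / 2, and q <= 1 / 4 keeps the normalisation
    \<open>a\<close> above n / 4.\<close>
  define q where "q = min (1 / 4) (r / 100)"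
  have q: "0 < q" "q \<le> 1 / 4" "20 * q \<le> r / 4" using r by (auto simp: q_def)
  have "eventually (\<lambda>x. dist (tilted_mean x) (1 / 2) < q) (at_right 0)"
    using tilted_mean_limit q by (auto simp: tendsto_iff)
  then obtain \<eta>' where \<eta>': "0 < \<eta>'" "\<And>x. 0 < x \<Longrightarrow> x < \<eta>' \<Longrightarrow> dist (tilted_mean x) (1 / 2) < q"
    unfolding eventually_at_right_field by auto
  define \<eta> where "\<eta> = \<eta>' / 2"
  have \<eta>: "0 < \<eta>" "\<And>x. 0 < x \<Longrightarrow> x \<le> \<eta> \<Longrightarrow> \<bar>tilted_mean x - 1 / 2\<bar> < q"
    using \<eta>' by (auto simp: \<eta>_def dist_real_def)
  define b' where "b' n = max (b n) \<eta>" for n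
  let ?E' = "\<lambda>n. \<integral>\<omega>. \<bar>rstre_mean_length n (b' n) \<omega> / (real n * tilted_mean (b' n)) - 1\<bar> \<partial>env_measure n"
  have "?E' \<longlonglongrightarrow> 0"
  proof (rule mean_length_concentration_away[OF \<eta>(1)])
    show "\<eta> \<le> b' n" for n by (simp add: b'_def)
    have "(\<lambda>n :: nat. \<eta> * ln (real n) / real n) \<longlonglongrightarrow> 0" by real_asymp
    from tendsto_max[OF lim this] have "(\<lambda>n. max (b n * ln (real n) / real n) (\<eta> * ln (real n) / real n)) \<longlonglongrightarrow> 0" by simp
    moreover have "max (b n * ln (real n) / real n) (\<eta> * ln (real n) / real n) = b' n * ln (real n) / real n" for n
    proof (cases "n = 0")
      case False
      have "0 \<le> ln (real n) / real n" using False by auto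
      then show ?thesis unfolding b'_def
        by (cases "b n \<le> \<eta>") (use mult_right_mono[of "b n" \<eta> "ln n / n"] mult_right_mono[of \<eta> "b n" "ln n / n"] in auto)
    qed auto
    ultimately show "(\<lambda>n. b' n * ln (real n) / real n) \<longlonglongrightarrow> 0" by simp
  qed
  then have "eventually (\<lambda>n. ?E' n < r / 16) sequentially" using r by (intro order_tendstoD(2)) auto
  then have "eventually (\<lambda>n. ?E n < r) sequentially" using eventually_ge_at_top[of 1]
  proof eventually_elim
    case (elim n)
    interpret prob_space "env_measure n" by (rule prob_space_env_measure)
    have n0: "0 < real n" using elim by simp
    show "?E n < r"
    proof (cases "\<eta> \<le> b n")
      case True
      then have "b' n = b n" by (simp add: b'_def)
      then show ?thesis using elim r by simp
    next
      case False
      then have b': "b' n = \<eta>" by (simp add: b'_def)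
      define a where "a = n * tilted_mean (b n)"
      define X where "X = rstre_mean_length n (b n)"
      define Y where "Y = rstre_mean_length n \<eta>"
      define a' where "a' = n * tilted_mean \<eta>"
      have m: "\<bar>tilted_mean (b n) - 1 / 2\<bar> < q" "\<bar>tilted_mean \<eta> - 1 / 2\<bar> < q" using \<eta> b0[of n] False by auto
      have a: "\<bar>a - n * (1 / 2)\<bar> \<le> n * q" "\<bar>a' - n * (1 / 2)\<bar> \<le> n * q"
        using m n0 unfolding a_def a'_def right_diff_distrib[symmetric] abs_mult by (auto intro!: mult_left_mono)
      have a_le: "n * (1 / 2) - a \<le> n * q" "a - n * (1 / 2) \<le> n * q"
        "n * (1 / 2) - a' \<le> n * q" "a' - n * (1 / 2) \<le> n * q"
        using a[THEN abs_le_D1] a[THEN abs_le_D2] by linarith+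
      have aa: "\<bar>a' - a\<bar> \<le> 2 * (n * q)" using a_le by (intro abs_leI) linarith+
      have nq: "n * q \<le> n * (1 / 4)" using q n0 by (intro mult_left_mono) auto
      have a4: "n / 4 \<le> a" "0 < a'" "a' \<le> n" using a_le nq n0 by linarith+
      have intX: "integrable (env_measure n) X" "integrable (env_measure n) Y"
        by (auto simp: X_def Y_def integrable_mean_length)
      have XY: "Y \<omega> \<le> X \<omega>" for \<omega> unfolding X_def Y_def using False by (intro rstre_mean_length_antimono) auto
      have "X \<omega> \<le> rstre_mean_length n 0 \<omega>" for \<omega>
        unfolding X_def using b0[of n] by (intro rstre_mean_length_antimono) auto
      then have "(\<integral>\<omega>. X \<omega> \<partial>env_measure n) \<le> (\<integral>\<omega>. rstre_mean_length n 0 \<omega> \<partial>env_measure n)"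
        using intX integrable_mean_length by (intro integral_mono) auto
      then have EX: "(\<integral>\<omega>. X \<omega> \<partial>env_measure n) \<le> n / 2" using expectation_mean_length_zero[of n] by simp
      have gen: "x - y + 2 * (i + c) \<le> z + 2 * (i + 2 * z)" if "x \<le> h" "h - y \<le> z" "c \<le> 2 * z"
        for x y h i c z :: real using that by argo
      \<comment> \<open>As X >= Y, the negative part of X - a is bounded pointwise by the deviation
        of Y and the gap between \<open>a'\<close> and \<open>a\<close>; in |x| = x + 2 max(-x, 0)
        the rest is controlled by the mean of X alone.\<close>
      have pt: "\<bar>X \<omega> - a\<bar> \<le> (X \<omega> - a) + 2 * (\<bar>Y \<omega> - a'\<bar> + \<bar>a' - a\<bar>)" for \<omega>
        using XY[of \<omega>] abs_ge_minus_self[of "Y \<omega> - a'"] abs_ge_self[of "a' - a"] abs_ge_minus_self[of "a' - a"]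
        by (cases "X \<omega> - a < 0") (simp_all add: abs_of_neg abs_of_nonneg)
      have "(\<integral>\<omega>. \<bar>X \<omega> - a\<bar> \<partial>env_measure n) \<le> (\<integral>\<omega>. (X \<omega> - a) + 2 * (\<bar>Y \<omega> - a'\<bar> + \<bar>a' - a\<bar>) \<partial>env_measure n)"
        using intX by (intro integral_mono pt) auto
      also have "\<dots> = (\<integral>\<omega>. X \<omega> \<partial>env_measure n) - a + 2 * ((\<integral>\<omega>. \<bar>Y \<omega> - a'\<bar> \<partial>env_measure n) + \<bar>a' - a\<bar>)"
        using intX by (simp add: prob_space)
      also have "\<dots> \<le> n * q + 2 * ((\<integral>\<omega>. \<bar>Y \<omega> - a'\<bar> \<partial>env_measure n) + 2 * (n * q))"
        by (rule gen[OF _ a_le(1) aa]) (use EX in simp)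
      also have "(\<integral>\<omega>. \<bar>Y \<omega> - a'\<bar> \<partial>env_measure n) = a' * ?E' n"
      proof -
        have "\<bar>Y \<omega> - a'\<bar> = a' * \<bar>Y \<omega> / a' - 1\<bar>" for \<omega>
        proof -
          have "a' * \<bar>Y \<omega> / a' - 1\<bar> = \<bar>a' * (Y \<omega> / a' - 1)\<bar>" using a4 by (simp add: abs_mult)
          also have "a' * (Y \<omega> / a' - 1) = Y \<omega> - a'" using a4 by (simp add: right_diff_distrib)
          finally show ?thesis by simp
        qed
        then show ?thesis by (simp add: b' Y_def a'_def)
      qed
      also have "a' * ?E' n \<le> n * (r / 16)" using a4 elim by (intro mult_mono) auto
      finally have "(\<integral>\<omega>. \<bar>X \<omega> - a\<bar> \<partial>env_measure n) \<le> n * (5 * q + r / 8)" by (simp add: algebra_simps)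
      moreover have "?E n = (\<integral>\<omega>. \<bar>X \<omega> - a\<bar> \<partial>env_measure n) / a"
      proof -
        have "\<bar>X \<omega> / a - 1\<bar> = \<bar>X \<omega> - a\<bar> / a" for \<omega>
        proof -
          have "X \<omega> / a - 1 = (X \<omega> - a) / a" using a4 n0 by (simp add: diff_divide_distrib)
          then show ?thesis using a4 n0 by (simp only: abs_divide; simp)
        qed
        then show ?thesis by (simp add: X_def a_def)
      qed
      ultimately have "?E n \<le> n * (5 * q + r / 8) / a" using a4 n0 by (simp add: divide_right_mono)
      also have "\<dots> \<le> n * (5 * q + r / 8) / (n / 4)"
        using a4 n0 q r by (intro divide_left_mono) auto
      also have "\<dots> = 20 * q + r / 2" using n0 by simp
      finally show ?thesis using q r by linarith
    qed
  qed
  then obtain N where N: "\<And>n. n \<ge> N \<Longrightarrow> ?E n < r" by (auto simp: eventually_sequentially)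
  show "\<exists>N. \<forall>n\<ge>N. norm (?E n - 0) < r"
    by (intro exI[of _ N] allI impI) (use N in simp)
qed

lemma mean_length_small_beta:
  assumes b0: "\<And>n. 0 < b n" and b: "b \<in> o(\<lambda>n. real n / ln (real n))"
  shows "whp_asymp_equiv env_measure (\<lambda>n. rstre_mean_length n (b n)) (\<lambda>n. real n * tilted_mean (b n))"
    and "(\<lambda>n. \<integral>\<omega>. rstre_mean_length n (b n) \<omega> \<partial>env_measure n) \<sim>[sequentially] (\<lambda>n. real n * tilted_mean (b n))"
proof -
  have "(\<lambda>n. b n / (real n / ln (real n))) \<longlonglongrightarrow> 0" using b by (rule smalloD_tendsto)
  then have lim: "(\<lambda>n. b n * ln (real n) / real n) \<longlonglongrightarrow> 0" by simp
  have nz: "eventually (\<lambda>n. real n * tilted_mean (b n) \<noteq> 0) sequentially"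
    using eventually_gt_at_top[of 0]
  proof eventually_elim
    case (elim n)
    then show ?case using tilted_mean_pos[OF b0[of n]] by simp
  qed
  note * = mean_convergence_imp[where M = env_measure and X = "\<lambda>n. rstre_mean_length n (b n)"
      and a = "\<lambda>n. real n * tilted_mean (b n)", OF prob_space_env_measure integrable_mean_length
      mean_length_concentration[OF b0 lim] nz]
  show "whp_asymp_equiv env_measure (\<lambda>n. rstre_mean_length n (b n)) (\<lambda>n. real n * tilted_mean (b n))"
    by (rule *(1))
  show "(\<lambda>n. \<integral>\<omega>. rstre_mean_length n (b n) \<omega> \<partial>env_measure n) \<sim>[sequentially] (\<lambda>n. real n * tilted_mean (b n))"
    by (rule *(2))
qed


section \<open>Components and their spanning trees\<close>

lemma comps_memD:
  assumes "A \<in> components V H" "u \<in> A"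
  shows "u \<in> V" "A = component V H u"
proof -
  obtain v where v: "v \<in> V" "A = component V H v" using assms(1) by (auto simp: components_def)
  then show u: "u \<in> V" using assms(2) by (auto simp: component_def)
  have "(v, u) \<in> conn H" using v assms(2) by (auto simp: component_def)
  then show "A = component V H u" using component_eq_iff[OF u] v by metis
qed

lemma comps_disjoint: "A \<in> components V H \<Longrightarrow> B \<in> components V H \<Longrightarrow> A \<noteq> B \<Longrightarrow> A \<inter> B = {}"
  using comps_memD by (metis Int_iff equals0I)

lemma comps_nonempty: "A \<in> components V H \<Longrightarrow> A \<noteq> {}"
  by (auto simp: components_def component_def)

lemma comps_subset: "A \<in> components V H \<Longrightarrow> A \<subseteq> V"
  by (auto simp: components_def component_def)

lemma Union_comps: "\<Union> (components V H) = V"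
  by (auto simp: components_def component_def)

lemma sum_card_comps:
  assumes "finite V"
  shows "(\<Sum>A\<in>components V H. card A) = card V"
proof -
  have "card (\<Union> (components V H)) = (\<Sum>A\<in>components V H. card A)"
    using assms by (intro card_Union_disjoint)
      (auto simp: pairwise_def disjnt_def dest: comps_disjoint intro: finite_subset[OF comps_subset])
  then show ?thesis by (simp add: Union_comps)
qed

lemma comps_isolated:
  assumes "A \<in> components V H" "H \<subseteq> all_edges V" "e \<in> H" "e \<inter> A \<noteq> {}"
  shows "e \<subseteq> A"
proof -
  obtain a where a: "a \<in> e" "a \<in> A" using assms by auto
  obtain x y where e: "e = {x, y}" using assms(2,3) by (auto simp: all_edges_def card_2_iff)
  have xy: "x \<in> V" "y \<in> V" using assms(2,3) e by (auto simp: all_edges_def)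
  have A: "A = component V H a" using comps_memD[OF assms(1) a(2)] by simp
  have "(x, y) \<in> conn H" using assms(3) e by (auto intro: conn_edge)
  then show ?thesis using a(1) xy unfolding A e component_def by (auto intro: conn_sym)
qed

lemma isolated_conn:
  assumes iso: "\<And>e. e \<in> H \<Longrightarrow> e \<inter> A \<noteq> {} \<Longrightarrow> e \<subseteq> A" and "(u, v) \<in> conn H" "u \<in> A"
  shows "v \<in> A \<and> (u, v) \<in> conn {e\<in>H. e \<subseteq> A}"
  using assms(2) unfolding conn_def[of H]
proof (induction rule: rtrancl_induct)
  case base
  then show ?case using assms(3) by simp
next
  case (step y z)
  then have "{y, z} \<subseteq> A" using iso[of "{y, z}"] by auto
  moreover have "(y, z) \<in> conn {e\<in>H. e \<subseteq> A}" using step calculation by (intro conn_edge) auto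
  ultimately show ?case using step by (auto intro: conn_trans)
qed

text \<open>Kruskal's construction with all weights 0 thins the edges inside \<open>A\<close> to a
  spanning tree.\<close>

lemma comps_spanning_tree:
  assumes "A \<in> components V H" "H \<subseteq> all_edges V" "finite V"
  shows "\<exists>T\<in>spanning_trees A (all_edges A). T \<subseteq> H"
proof -
  let ?E = "{e\<in>H. e \<subseteq> A}"
  have fin: "finite ?E" using assms(2,3) finite_all_edges finite_subset by (metis (no_types, lifting) mem_Collect_eq subsetD subsetI)
  have c2: "card e = 2" if "e \<in> ?E" for e using that assms(2) by (auto simp: all_edges_def)
  obtain T where T: "T \<subseteq> ?E" "\<nexists>p. is_cycle T p"
    "\<And>t :: real. conn {e\<in>T. 0 \<le> t} = conn {e\<in>?E. 0 \<le> t}"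
    using ex_minimal_spanning_forest[OF fin c2, of "\<lambda>_. 0"] by auto
  have TE: "conn T = conn ?E" using T(3)[of 0] by simp
  have iso: "\<And>e. e \<in> H \<Longrightarrow> e \<inter> A \<noteq> {} \<Longrightarrow> e \<subseteq> A" using comps_isolated[OF assms(1,2)] by blast
  have "(u, v) \<in> conn T" if "u \<in> A" "v \<in> A" for u v
  proof -
    have "v \<in> component V H u" using comps_memD[OF assms(1) that(1)] that(2) by simp
    then have "(u, v) \<in> conn H" by (simp add: component_def)
    then show ?thesis unfolding TE using isolated_conn[OF iso _ that(1)] by blast
  qed
  then have "edges_connect A T" by (simp add: edges_connect_conn)
  moreover have "T \<subseteq> all_edges A" using T(1) c2 by (auto simp: all_edges_def)
  ultimately show ?thesis using T by (auto simp: spanning_trees_def)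
qed

lemma spanning_tree_compsI:
  assumes "T \<in> spanning_trees A (all_edges A)" "T \<subseteq> H" "A \<subseteq> V" "A \<noteq> {}"
    and iso: "\<And>e. e \<in> H \<Longrightarrow> e \<inter> A \<noteq> {} \<Longrightarrow> e \<subseteq> A"
  shows "A \<in> components V H"
proof -
  obtain a where a: "a \<in> A" using assms(4) by auto
  have "component V H a = A"
  proof
    show "component V H a \<subseteq> A" using isolated_conn[OF iso _ a] by (auto simp: component_def)
    have "(a, v) \<in> conn H" if "v \<in> A" for v
    proof -
      have "(a, v) \<in> conn T" using assms(1) a that by (auto simp: spanning_trees_def edges_connect_conn)
      then show ?thesis using conn_mono[OF assms(2)] by auto
    qed
    then show "A \<subseteq> component V H a" using assms(3) by (auto simp: component_def)
  qed
  then show ?thesis using a assms(3) by (auto simp: components_def)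
qed

lemma card_small_comps:
  assumes "finite V"
  shows "card {A\<in>components V H. card A \<le> K} = (\<Sum>k=1..K. card {A\<in>components V H. card A = k})"
proof -
  have eq: "{A\<in>components V H. card A \<le> K} = (\<Union>k\<in>{1..K}. {A\<in>components V H. card A = k})"
  proof safe
    fix A assume A: "A \<in> components V H" "card A \<le> K"
    have "finite A" using comps_subset[OF A(1)] assms finite_subset by auto
    then have "1 \<le> card A" using comps_nonempty[OF A(1)] by (simp add: Suc_le_eq card_gt_0_iff)
    then show "A \<in> (\<Union>k\<in>{1..K}. {A\<in>components V H. card A = k})" using A by auto
  qed auto
  show ?thesis unfolding eq
    by (rule card_UN_disjoint) (use finite_components[OF assms] in auto)
qed

text \<open>Components with more than K vertices are at most |V| / K in number, by counting
  vertices. This crude bound serves at levels of order 1 / n, an interval so short that n / K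
  contributes only O(1 / K).\<close>

lemma comps_bound_size:
  assumes "finite V" "1 \<le> K"
  shows "real (card (components V H)) \<le> (\<Sum>k=1..K. real (card {A\<in>components V H. card A = k})) + card V / K"
proof -
  let ?C = "components V H"
  have fin: "finite ?C" using assms(1) by (rule finite_components)
  have fA: "finite A" if "A \<in> ?C" for A using that comps_subset assms(1) finite_subset by metis
  note small = card_small_comps[OF assms(1), of H K]
  have "K * card {A\<in>?C. \<not> card A \<le> K} = (\<Sum>A\<in>{A\<in>?C. \<not> card A \<le> K}. K)"
    by (simp only: sum_constant of_nat_id mult.commute)
  also have "\<dots> \<le> (\<Sum>A\<in>{A\<in>?C. \<not> card A \<le> K}. card A)" by (intro sum_mono) auto
  also have "\<dots> \<le> (\<Sum>A\<in>?C. card A)" using fin by (intro sum_mono2) auto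
  also have "\<dots> = card V" by (rule sum_card_comps[OF assms(1)])
  finally have "real K * card {A\<in>?C. \<not> card A \<le> K} \<le> card V" by (simp flip: of_nat_mult)
  then have "real (card {A\<in>?C. \<not> card A \<le> K}) \<le> card V / K" using assms(2) by (simp add: le_divide_eq mult.commute)
  moreover have "card ?C = card {A\<in>?C. card A \<le> K} + card {A\<in>?C. \<not> card A \<le> K}"
    using fin by (subst card_Un_disjoint[symmetric]) (auto intro!: arg_cong[of _ _ card])
  ultimately show ?thesis unfolding small by simp
qed

text \<open>Two components cannot both contain more than half of the vertices. The spare 1 stands
  for a giant component and later cancels the -1 in the length formula.\<close>

lemma comps_bound_half:
  assumes "finite V"
  shows "card (components V H) \<le> (\<Sum>k=1..card V div 2. card {A\<in>components V H. card A = k}) + 1"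
proof -
  let ?C = "components V H" and ?h = "card V div 2"
  have fin: "finite ?C" using assms(1) by (rule finite_components)
  have fA: "finite A" if "A \<in> ?C" for A using that comps_subset assms(1) finite_subset by metis
  note small = card_small_comps[OF assms(1), of H ?h]
  have "card {A\<in>?C. \<not> card A \<le> ?h} \<le> 1"
  proof (rule card_le_Suc0_iff_eq[THEN iffD2, folded One_nat_def])
    show "\<forall>A\<in>{A\<in>?C. \<not> card A \<le> ?h}. \<forall>B\<in>{A\<in>?C. \<not> card A \<le> ?h}. A = B"
    proof (intro ballI, rule ccontr)
      fix A B assume A: "A \<in> {A\<in>?C. \<not> card A \<le> ?h}" and B: "B \<in> {A\<in>?C. \<not> card A \<le> ?h}" and "A \<noteq> B"
      then have "card (A \<union> B) = card A + card B" using fA comps_disjoint[of A V H B] by (intro card_Un_disjoint) auto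
      moreover have "card (A \<union> B) \<le> card V" using A B comps_subset assms by (intro card_mono) auto
      ultimately show False using A B by auto
    qed
  qed (use fin in auto)
  moreover have "card ?C = card {A\<in>?C. card A \<le> ?h} + card {A\<in>?C. \<not> card A \<le> ?h}"
    using fin by (subst card_Un_disjoint[symmetric]) (auto intro!: arg_cong[of _ _ card])
  ultimately show ?thesis unfolding small by simp
qed

section \<open>Trees on k vertices and the edges around them\<close>

definition tree_subgraphs :: "nat \<Rightarrow> nat \<Rightarrow> (nat set \<times> nat set set) set" where
  "tree_subgraphs n k = (SIGMA A:{A. A \<subseteq> {..<n} \<and> card A = k}. spanning_trees A (all_edges A))"

definition cut :: "nat \<Rightarrow> nat set \<Rightarrow> nat set set" where
  "cut n A = {e\<in>complete_edges n. e \<inter> A \<noteq> {} \<and> \<not> e \<subseteq> A}"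

definition touch :: "nat \<Rightarrow> nat set \<Rightarrow> nat set set" where
  "touch n A = {e\<in>complete_edges n. e \<inter> A \<noteq> {}}"

lemma finite_spanning_trees: "finite A \<Longrightarrow> finite (spanning_trees A (all_edges A))"
  by (rule finite_subset[of _ "Pow (all_edges A)"]) (auto simp: spanning_trees_def finite_all_edges)

lemma finite_tree_subgraphs: "finite (tree_subgraphs n k)"
  unfolding tree_subgraphs_def by (intro finite_SigmaI) (auto intro: finite_spanning_trees finite_subset)

lemma card_tree_subgraphs:
  assumes "1 \<le> k"
  shows "real (card (tree_subgraphs n k)) = real (n choose k) * (real k ^ (k - 1) / k)"
proof -
  have *: "real (card (spanning_trees A (all_edges A))) = real k ^ (k - 1) / k"
    if "A \<subseteq> {..<n}" "card A = k" for A
  proof -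
    have "A \<noteq> {}" "finite A" using that assms finite_subset[of A "{..<n}"] by auto
    then have "k * card (spanning_trees A (all_edges A)) = k ^ (k - 1)" using cayley[of A] that by simp
    then have "real k * card (spanning_trees A (all_edges A)) = real k ^ (k - 1)"
      by (metis of_nat_mult of_nat_power)
    then show ?thesis using assms by (simp add: field_simps)
  qed
  have "real (card (tree_subgraphs n k)) = (\<Sum>A\<in>{A. A \<subseteq> {..<n} \<and> card A = k}. real (card (spanning_trees A (all_edges A))))"
    unfolding tree_subgraphs_def by (subst card_SigmaI) (auto intro: finite_spanning_trees finite_subset)
  also have "\<dots> = (\<Sum>A\<in>{A. A \<subseteq> {..<n} \<and> card A = k}. real k ^ (k - 1) / k)"
    using * by (intro sum.cong) auto
  also have "\<dots> = real (n choose k) * (real k ^ (k - 1) / k)"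
    using n_subsets[of "{..<n}" k] by simp
  finally show ?thesis .
qed

lemma tree_subgraphsD:
  assumes "(A, T) \<in> tree_subgraphs n k" "1 \<le> k"
  shows "A \<subseteq> {..<n}" "card A = k" "A \<noteq> {}" "finite A" "T \<in> spanning_trees A (all_edges A)"
    "T \<subseteq> all_edges A" "T \<subseteq> complete_edges n" "card T = k - 1" "finite T" "T \<subseteq> touch n A"
proof -
  show A: "A \<subseteq> {..<n}" "card A = k" and T: "T \<in> spanning_trees A (all_edges A)"
    using assms(1) by (auto simp: tree_subgraphs_def)
  show ne: "A \<noteq> {}" and fA: "finite A" using A assms(2) finite_subset[of A "{..<n}"] by auto
  show TA: "T \<subseteq> all_edges A" using T by (auto simp: spanning_trees_def)
  then show TE: "T \<subseteq> complete_edges n" using A by (auto simp: all_edges_def complete_edges_def complete_verts_def)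
  show "card T = k - 1" using card_spanning_tree[OF fA ne T] A by simp
  show "finite T" using TA finite_all_edges[OF fA] finite_subset by auto
  show "T \<subseteq> touch n A"
  proof
    fix e assume e: "e \<in> T"
    then have "e \<subseteq> A" "card e = 2" using TA by (auto simp: all_edges_def)
    moreover from this have "e \<noteq> {}" by auto
    ultimately have "e \<inter> A \<noteq> {}" by blast
    then show "e \<in> touch n A" using e TE by (auto simp: touch_def)
  qed
qed

lemma card_all_edges: "finite A \<Longrightarrow> card (all_edges A) = card A choose 2"
  unfolding all_edges_def by (rule n_subsets)

lemma card_bipartite_edges:
  assumes "finite A" "finite B" "A \<inter> B = {}"
  shows "card ((\<lambda>(a, b). {a, b}) ` (A \<times> B)) = card A * card B"
proof -
  have "inj_on (\<lambda>(a, b). {a, b}) (A \<times> B)"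
    using assms(3) by (auto simp: inj_on_def doubleton_eq_iff)
  then show ?thesis by (simp add: card_image card_cartesian_product)
qed

lemma card_cut:
  assumes "A \<subseteq> {..<n}"
  shows "card (cut n A) = card A * (n - card A)"
proof -
  have fA: "finite A" using assms finite_subset by auto
  have "cut n A = (\<lambda>(a, b). {a, b}) ` (A \<times> ({..<n} - A))"
  proof (intro equalityI subsetI)
    fix e assume e: "e \<in> cut n A"
    then obtain x y where xy: "e = {x, y}" by (auto simp: cut_def complete_edges_def card_2_iff)
    have "x \<in> A \<and> y \<in> {..<n} - A \<or> y \<in> A \<and> x \<in> {..<n} - A"
      using e unfolding xy by (auto simp: cut_def complete_edges_def complete_verts_def)
    then show "e \<in> (\<lambda>(a, b). {a, b}) ` (A \<times> ({..<n} - A))" unfolding xy by (auto simp: insert_commute)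
  next
    fix e assume "e \<in> (\<lambda>(a, b). {a, b}) ` (A \<times> ({..<n} - A))"
    then show "e \<in> cut n A" using assms
      by (auto simp: cut_def complete_edges_def complete_verts_def card_insert_if)
  qed
  then show ?thesis using card_bipartite_edges[of A "{..<n} - A"] fA assms
    by (simp add: card_Diff_subset)
qed

lemma finite_touch: "finite (touch n A)" "finite (cut n A)"
  by (auto simp: touch_def cut_def finite_complete_edges)

lemma card_touch:
  assumes "A \<subseteq> {..<n}"
  shows "card (touch n A) = (card A choose 2) + card A * (n - card A)"
proof -
  have fA: "finite A" using assms finite_subset by auto
  have "touch n A = all_edges A \<union> cut n A"
  proof (intro equalityI subsetI)
    fix e assume "e \<in> touch n A"
    then show "e \<in> all_edges A \<union> cut n A" by (auto simp: touch_def cut_def all_edges_def complete_edges_def)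
  next
    fix e assume e: "e \<in> all_edges A \<union> cut n A"
    then have "e \<noteq> {}" by (auto simp: all_edges_def cut_def)
    then show "e \<in> touch n A" using e assms
      by (auto simp: touch_def cut_def all_edges_def complete_edges_def complete_verts_def)
  qed
  moreover have "all_edges A \<inter> cut n A = {}" by (auto simp: all_edges_def cut_def)
  ultimately show ?thesis
    using card_Un_disjoint[of "all_edges A" "cut n A"] card_cut[OF assms] fA
    by (simp add: card_all_edges finite_all_edges finite_touch)
qed

text \<open>An edge that meets both of the disjoint sets joins them, so the overlap has |A| |B|
  edges.\<close>

lemma card_touch_Un:
  assumes "A \<subseteq> {..<n}" "B \<subseteq> {..<n}" "A \<inter> B = {}"
  shows "card (touch n A \<union> touch n B) + card A * card B = card (touch n A) + card (touch n B)"
proof -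
  have fA: "finite A" "finite B" using assms(1,2) by (auto intro: finite_subset)
  have "touch n A \<inter> touch n B = (\<lambda>(a, b). {a, b}) ` (A \<times> B)"
  proof (intro equalityI subsetI)
    fix e assume e: "e \<in> touch n A \<inter> touch n B"
    then obtain x y where xy: "e = {x, y}" by (auto simp: touch_def complete_edges_def card_2_iff)
    have "x \<in> A \<and> y \<in> B \<or> y \<in> A \<and> x \<in> B"
      using e assms(3) unfolding xy by (auto simp: touch_def)
    then show "e \<in> (\<lambda>(a, b). {a, b}) ` (A \<times> B)" unfolding xy by (auto simp: insert_commute)
  next
    fix e assume "e \<in> (\<lambda>(a, b). {a, b}) ` (A \<times> B)"
    then obtain a b where ab: "a \<in> A" "b \<in> B" "e = {a, b}" by auto
    then have "a \<noteq> b" using assms(3) by auto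
    then show "e \<in> touch n A \<inter> touch n B" using assms ab
      by (auto simp: touch_def complete_edges_def complete_verts_def)
  qed
  then show ?thesis
    using card_Un_Int[of "touch n A" "touch n B"] card_bipartite_edges[OF fA assms(3)]
    by (simp add: finite_touch)
qed

section \<open>The graph of the edges up to level t\<close>

definition below :: "nat \<Rightarrow> real \<Rightarrow> environment \<Rightarrow> nat set set" where
  "below n t \<omega> = {e\<in>complete_edges n. \<omega> e \<le> t}"

definition num_comps :: "nat \<Rightarrow> real \<Rightarrow> environment \<Rightarrow> nat" where
  "num_comps n t \<omega> = card (components {..<n} (below n t \<omega>))"

text \<open>Further edges inside \<open>A\<close> are allowed. Every component has at least one
  spanning tree, so summing these indicators overcounts components.\<close>

definition tree_cut :: "nat \<Rightarrow> real \<Rightarrow> environment \<Rightarrow> nat set \<times> nat set set \<Rightarrow> real" where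
  "tree_cut n t \<omega> = (\<lambda>(A, T). of_bool ((\<forall>e\<in>T. \<omega> e \<le> t) \<and> (\<forall>e\<in>cut n A. t < \<omega> e)))"

text \<open>Here \<open>A\<close> is a component whose edges are exactly \<open>T\<close>, so the
  sum counts each tree component once and undercounts all components.\<close>

definition tree_comp :: "nat \<Rightarrow> real \<Rightarrow> environment \<Rightarrow> nat set \<times> nat set set \<Rightarrow> real" where
  "tree_comp n t \<omega> = (\<lambda>(A, T). of_bool ((\<forall>e\<in>T. \<omega> e \<le> t) \<and> (\<forall>e\<in>touch n A - T. t < \<omega> e)))"

lemma below_subset: "below n t \<omega> \<subseteq> all_edges {..<n}"
  by (auto simp: below_def complete_edges_all_edges)

lemma num_comps_pos: "1 \<le> n \<Longrightarrow> 1 \<le> num_comps n t \<omega>"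
proof -
  assume "1 \<le> n"
  then have "component {..<n} (below n t \<omega>) 0 \<in> components {..<n} (below n t \<omega>)" by (auto simp: components_def)
  then show ?thesis unfolding num_comps_def using finite_components[of "{..<n}" "below n t \<omega>"]
    by (auto simp: Suc_le_eq card_gt_0_iff)
qed

lemma num_comps_le: "num_comps n t \<omega> \<le> n"
  unfolding num_comps_def components_def using card_image_le[of "{..<n}"] by simp

lemma card_comps_le_tree_cut:
  "real (card {A\<in>components {..<n} (below n t \<omega>). card A = k}) \<le> (\<Sum>i\<in>tree_subgraphs n k. tree_cut n t \<omega> i)"
proof -
  let ?C = "{A\<in>components {..<n} (below n t \<omega>). card A = k}"
  have "\<forall>A\<in>?C. \<exists>T. T \<in> spanning_trees A (all_edges A) \<and> T \<subseteq> below n t \<omega>"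
    using comps_spanning_tree[OF _ below_subset] by blast
  then obtain \<tau> where \<tau>: "\<And>A. A \<in> ?C \<Longrightarrow> \<tau> A \<in> spanning_trees A (all_edges A) \<and> \<tau> A \<subseteq> below n t \<omega>"
    by metis
  have sub: "(\<lambda>A. (A, \<tau> A)) ` ?C \<subseteq> tree_subgraphs n k"
    using \<tau> comps_subset by (fastforce simp: tree_subgraphs_def)
  have "tree_cut n t \<omega> (A, \<tau> A) = 1" if A: "A \<in> ?C" for A
  proof -
    have "t < \<omega> e" if e: "e \<in> cut n A" for e
    proof (rule ccontr)
      assume "\<not> t < \<omega> e"
      then have "e \<in> below n t \<omega>" using e by (auto simp: below_def cut_def)
      then show False using comps_isolated[OF _ below_subset, of A n t \<omega> e] A e by (auto simp: cut_def)
    qed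
    then show ?thesis using \<tau>[OF A] by (auto simp: tree_cut_def below_def)
  qed
  then have "real (card ?C) = (\<Sum>A\<in>?C. tree_cut n t \<omega> (A, \<tau> A))" by simp
  also have "\<dots> = (\<Sum>i\<in>(\<lambda>A. (A, \<tau> A)) ` ?C. tree_cut n t \<omega> i)"
    by (subst sum.reindex) (auto simp: inj_on_def)
  also have "\<dots> \<le> (\<Sum>i\<in>tree_subgraphs n k. tree_cut n t \<omega> i)"
    using sub by (intro sum_mono2 finite_tree_subgraphs) (auto simp: tree_cut_def)
  finally show ?thesis .
qed

text \<open>Two versions for two ranges of levels: the expected sum over large sizes is estimated
  only once t exceeds a multiple of 1 / n, and below that sizes above K are counted through their
  vertices.\<close>

lemma num_comps_upper:
  assumes K: "1 \<le> K"
  shows "real (num_comps n t \<omega>) - 1 \<le> (\<Sum>k=1..K. \<Sum>i\<in>tree_subgraphs n k. tree_cut n t \<omega> i) + n / K"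
    and "real (num_comps n t \<omega>) - 1 \<le> (\<Sum>k=1..K. \<Sum>i\<in>tree_subgraphs n k. tree_cut n t \<omega> i) +
      (\<Sum>k=Suc K..n div 2. \<Sum>i\<in>tree_subgraphs n k. tree_cut n t \<omega> i)"
proof -
  let ?c = "\<lambda>k. card {A\<in>components {..<n} (below n t \<omega>). card A = k}"
  let ?U = "\<lambda>k. \<Sum>i\<in>tree_subgraphs n k. tree_cut n t \<omega> i"
  have U0: "0 \<le> ?U k" for k by (intro sum_nonneg) (auto simp: tree_cut_def)
  have le: "(\<Sum>k\<in>S. real (?c k)) \<le> (\<Sum>k\<in>S. ?U k)" for S
    by (intro sum_mono card_comps_le_tree_cut)
  show "real (num_comps n t \<omega>) - 1 \<le> (\<Sum>k=1..K. ?U k) + n / K"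
    using comps_bound_size[of "{..<n}" K "below n t \<omega>"] K le[of "{1..K}"] by (simp add: num_comps_def)
  have "real (num_comps n t \<omega>) \<le> real ((\<Sum>k=1..n div 2. ?c k) + 1)"
    using comps_bound_half[of "{..<n}" "below n t \<omega>"] unfolding num_comps_def
    by (subst of_nat_le_iff) simp
  also have "\<dots> = (\<Sum>k=1..n div 2. real (?c k)) + 1" by simp
  also have "(\<Sum>k=1..n div 2. real (?c k)) \<le> (\<Sum>k=1..n div 2. ?U k)" by (rule le)
  also have "\<dots> \<le> (\<Sum>k\<in>{1..K} \<union> {Suc K..n div 2}. ?U k)" using U0 by (intro sum_mono2) auto
  also have "\<dots> = (\<Sum>k=1..K. ?U k) + (\<Sum>k=Suc K..n div 2. ?U k)"
    by (subst sum.union_disjoint) auto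
  finally show "real (num_comps n t \<omega>) - 1 \<le> (\<Sum>k=1..K. ?U k) + (\<Sum>k=Suc K..n div 2. ?U k)" by simp
qed

lemma tree_compD:
  assumes "(A, T) \<in> tree_subgraphs n k" "1 \<le> k" "tree_comp n t \<omega> (A, T) \<noteq> 0"
  shows "A \<in> components {..<n} (below n t \<omega>)" "T = below n t \<omega> \<inter> all_edges A"
proof -
  note * = tree_subgraphsD[OF assms(1,2)]
  have 1: "\<And>e. e \<in> T \<Longrightarrow> \<omega> e \<le> t" and 2: "\<And>e. e \<in> touch n A - T \<Longrightarrow> t < \<omega> e"
    using assms(3) by (auto simp: tree_comp_def)
  have Tb: "T \<subseteq> below n t \<omega>" using 1 *(7) by (auto simp: below_def)
  have touch: "e \<in> T" if "e \<in> below n t \<omega>" "e \<inter> A \<noteq> {}" for e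
    using 2[of e] that by (force simp: below_def touch_def)
  show "A \<in> components {..<n} (below n t \<omega>)"
    by (rule spanning_tree_compsI[OF *(5) Tb *(1,3)]) (use touch *(6) in \<open>auto simp: all_edges_def\<close>)
  have "e \<in> T" if e: "e \<in> below n t \<omega>" "e \<in> all_edges A" for e
  proof -
    have "e \<noteq> {}" "e \<subseteq> A" using e(2) by (auto simp: all_edges_def)
    then show ?thesis using touch[OF e(1)] by auto
  qed
  then show "T = below n t \<omega> \<inter> all_edges A" using Tb *(6) by auto
qed

text \<open>Components are disjoint or equal, and a tree component determines its tree, so distinct
  overlapping candidates exclude each other.\<close>

lemma tree_comp_disjoint:
  assumes "(A, T) \<in> tree_subgraphs n k" "(B, S) \<in> tree_subgraphs n l" "1 \<le> k" "1 \<le> l" "(A, T) \<noteq> (B, S)" "A \<inter> B \<noteq> {}"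
  shows "tree_comp n t \<omega> (A, T) * tree_comp n t \<omega> (B, S) = 0"
proof (rule ccontr)
  assume "tree_comp n t \<omega> (A, T) * tree_comp n t \<omega> (B, S) \<noteq> 0"
  then have "tree_comp n t \<omega> (A, T) \<noteq> 0" "tree_comp n t \<omega> (B, S) \<noteq> 0" by auto
  note A = tree_compD[OF assms(1,3) this(1)] and B = tree_compD[OF assms(2,4) this(2)]
  have "A = B" using comps_disjoint[OF A(1) B(1)] assms(6) by auto
  then show False using A(2) B(2) assms(5) by simp
qed

lemma sum_tree_comp_le:
  "(\<Sum>k=1..K. \<Sum>i\<in>tree_subgraphs n k. tree_comp n t \<omega> i) \<le> real (num_comps n t \<omega>)"
proof -
  let ?I = "SIGMA k:{1..K}. tree_subgraphs n k"
  let ?J = "{x\<in>?I. tree_comp n t \<omega> (snd x) \<noteq> 0}"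
  have finI: "finite ?I" by (intro finite_SigmaI finite_tree_subgraphs) auto
  have "(\<Sum>k=1..K. \<Sum>i\<in>tree_subgraphs n k. tree_comp n t \<omega> i) = (\<Sum>x\<in>?I. tree_comp n t \<omega> (snd x))"
    by (subst sum.Sigma) (auto simp: finite_tree_subgraphs case_prod_unfold)
  also have "\<dots> = (\<Sum>x\<in>?J. 1)"
    using finI by (intro sum.mono_neutral_cong_right) (auto simp: tree_comp_def case_prod_unfold split: if_splits)
  also have "\<dots> = real (card ?J)" by simp
  also have "card ?J \<le> card (components {..<n} (below n t \<omega>))"
  proof (rule card_inj_on_le[where f = "\<lambda>x. fst (snd x)"])
    show "inj_on (\<lambda>x. fst (snd x)) ?J"
    proof (rule inj_onI)
      fix x y assume x: "x \<in> ?J" and y: "y \<in> ?J" and eq: "fst (snd x) = fst (snd y)"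
      obtain k A T where xx: "x = (k, A, T)" by (cases x) auto
      obtain l B S where yy: "y = (l, B, S)" by (cases y) auto
      have 1: "(A, T) \<in> tree_subgraphs n k" "1 \<le> k" "tree_comp n t \<omega> (A, T) \<noteq> 0" using x xx by auto
      have 2: "(B, S) \<in> tree_subgraphs n l" "1 \<le> l" "tree_comp n t \<omega> (B, S) \<noteq> 0" using y yy by auto
      have AB: "A = B" using eq xx yy by simp
      then have "T = S" using tree_compD(2)[OF 1] tree_compD(2)[OF 2] by simp
      moreover have "k = l" using tree_subgraphsD(2)[OF 1(1,2)] tree_subgraphsD(2)[OF 2(1,2)] AB by simp
      ultimately show "x = y" using xx yy AB by simp
    qed
    show "(\<lambda>x. fst (snd x)) ` ?J \<subseteq> components {..<n} (below n t \<omega>)"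
    proof safe
      fix k A T assume 1: "k \<in> {1..K}" "(A, T) \<in> tree_subgraphs n k" "tree_comp n t \<omega> (snd (k, A, T)) \<noteq> 0"
      then show "fst (snd (k, A, T)) \<in> components {..<n} (below n t \<omega>)"
        using tree_compD(1)[of A T n k t \<omega>] by simp
    qed
  qed (auto intro: finite_components)
  finally show ?thesis by (simp add: num_comps_def)
qed

text \<open>Adding the edges of \<open>T\<close> above \<open>t\<close> to the graph below
  \<open>t\<close> connects it, and each added edge removes at most one component.\<close>

lemma tree_exceedances:
  assumes "1 \<le> n" "T \<in> complete_spanning_trees n"
  shows "real (num_comps n t \<omega>) - 1 \<le> (\<Sum>e\<in>T. of_bool (t < \<omega> e) :: real)"
proof -
  have T: "T \<subseteq> complete_edges n" "edges_connect {..<n} T" using assms(2)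
    by (auto simp: spanning_trees_def complete_verts_def)
  have finT: "finite T" using T(1) finite_complete_edges finite_subset by auto
  let ?F = "{e\<in>T. t < \<omega> e}"
  have "card (components {..<n} (below n t \<omega>)) \<le> card (components {..<n} (below n t \<omega> \<union> ?F)) + card ?F"
    using finT T(1) by (intro card_components_Un) (auto simp: complete_edges_def)
  also have "card (components {..<n} (below n t \<omega> \<union> ?F)) = 1"
  proof (rule comps_connected)
    show "{..<n} \<noteq> {}" using assms(1) by (auto simp: lessThan_empty_iff)
    have "T \<subseteq> below n t \<omega> \<union> ?F" using T(1) by (auto simp: below_def)
    then show "edges_connect {..<n} (below n t \<omega> \<union> ?F)"
      using T(2) conn_mono unfolding edges_connect_conn by (meson subsetD)
  qed
  finally have "num_comps n t \<omega> \<le> 1 + card ?F" by (simp add: num_comps_def)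
  moreover have "(\<Sum>e\<in>T. of_bool (t < \<omega> e) :: real) = real (card ?F)"
    using finT by (subst sum_of_bool_eq) (auto intro!: arg_cong[of _ _ card])
  ultimately show ?thesis by simp
qed

text \<open>Kruskal's tree has the right components at every level simultaneously. Starting from n
  isolated vertices, it needs at least n - \<open>num_comps\<close> edges up to \<open>t\<close>,
  and the remaining ones of its n - 1 edges lie above.\<close>

lemma ex_tree_exceedances:
  assumes n: "1 \<le> n" and \<omega>: "\<And>e. e \<in> complete_edges n \<Longrightarrow> \<omega> e \<le> 1"
  shows "\<exists>T\<in>complete_spanning_trees n. \<forall>t. (\<Sum>e\<in>T. of_bool (t < \<omega> e) :: real) \<le> real (num_comps n t \<omega>) - 1"
proof -
  obtain T where T: "T \<subseteq> complete_edges n" "\<nexists>p. is_cycle T p"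
    "\<And>t. conn {e\<in>T. \<omega> e \<le> t} = conn {e\<in>complete_edges n. \<omega> e \<le> t}"
    using ex_minimal_spanning_forest[OF finite_complete_edges, of n \<omega>] by (auto simp: complete_edges_def)
  have finT: "finite T" using T(1) finite_complete_edges finite_subset by auto
  have "{e\<in>T. \<omega> e \<le> 1} = T" "{e\<in>complete_edges n. \<omega> e \<le> 1} = complete_edges n" using T(1) \<omega> by auto
  then have c: "conn T = conn (complete_edges n)" using T(3)[of 1] by simp
  have "(u, v) \<in> conn T" if "u < n" "v < n" for u v
  proof (cases "u = v")
    case False
    then have "{u, v} \<in> complete_edges n" using that by (auto simp: complete_edges_def complete_verts_def)
    then show ?thesis unfolding c by (rule conn_edge)
  qed simp
  then have ST: "T \<in> complete_spanning_trees n" using T(1,2)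
    by (auto simp: spanning_trees_def edges_connect_conn complete_verts_def)
  have cT: "Suc (card T) = n"
    using card_spanning_tree[of "{..<n}" T] ST n by (auto simp: complete_spanning_trees_eq lessThan_empty_iff)
  have "(\<Sum>e\<in>T. of_bool (t < \<omega> e) :: real) \<le> real (num_comps n t \<omega>) - 1" for t
  proof -
    let ?F = "{e\<in>T. \<omega> e \<le> t}"
    have "card (components {..<n} {}) \<le> card (components {..<n} ({} \<union> ?F)) + card ?F"
      using finT T(1) by (intro card_components_Un) (auto simp: complete_edges_def)
    also have "components {..<n} ({} \<union> ?F) = components {..<n} (below n t \<omega>)"
      using T(3)[of t] by (simp add: components_def component_def below_def)
    finally have "n \<le> num_comps n t \<omega> + card ?F" by (simp add: comps_empty num_comps_def)
    moreover have "card T = card ?F + card {e\<in>T. t < \<omega> e}"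
      using finT by (subst card_Un_disjoint[symmetric]) (auto intro!: arg_cong[of _ _ card])
    moreover have "(\<Sum>e\<in>T. of_bool (t < \<omega> e) :: real) = real (card {e\<in>T. t < \<omega> e})"
      using finT by (subst sum_of_bool_eq) (auto intro!: arg_cong[of _ _ card])
    ultimately show ?thesis using cT by simp
  qed
  then show ?thesis using ST by blast
qed


section \<open>The minimal length as an integral over thresholds\<close>

text \<open>For environments in [0, 1] this is the minimum of \<open>tree_length\<close> over
  spanning trees. The integral form allows component counts to be averaged level by level.\<close>

definition mst_length :: "nat \<Rightarrow> environment \<Rightarrow> real" where
  "mst_length n \<omega> = (\<integral>t. real (num_comps n t \<omega>) - 1 \<partial>unif)"

text \<open>Splits according to the graph below \<open>t\<close>, one of finitely many edge sets, so
  that measurability reduces to threshold events.\<close>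

lemma num_comps_sum:
  "real (num_comps n t \<omega>) = (\<Sum>H\<in>Pow (complete_edges n). real (card (components {..<n} H)) *
     of_bool ((\<forall>e\<in>H. \<omega> e \<le> t) \<and> (\<forall>e\<in>complete_edges n - H. t < \<omega> e)))"
proof -
  have eq: "(\<forall>e\<in>H. \<omega> e \<le> t) \<and> (\<forall>e\<in>complete_edges n - H. t < \<omega> e) \<longleftrightarrow> H = below n t \<omega>"
    if "H \<in> Pow (complete_edges n)" for H
  proof
    assume *: "(\<forall>e\<in>H. \<omega> e \<le> t) \<and> (\<forall>e\<in>complete_edges n - H. t < \<omega> e)"
    have "e \<in> H \<longleftrightarrow> e \<in> below n t \<omega>" for e
      using * that by (cases "e \<in> H") (auto simp: below_def not_le)
    then show "H = below n t \<omega>" by blast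
  next
    assume "H = below n t \<omega>"
    then show "(\<forall>e\<in>H. \<omega> e \<le> t) \<and> (\<forall>e\<in>complete_edges n - H. t < \<omega> e)"
      by (auto simp: below_def)
  qed
  have "(\<Sum>H\<in>Pow (complete_edges n). real (card (components {..<n} H)) *
      of_bool ((\<forall>e\<in>H. \<omega> e \<le> t) \<and> (\<forall>e\<in>complete_edges n - H. t < \<omega> e))) =
    (\<Sum>H\<in>Pow (complete_edges n). if H = below n t \<omega> then real (card (components {..<n} H)) else 0)"
    by (intro sum.cong refl) (simp add: eq del: Diff_iff)
  also have "\<dots> = real (card (components {..<n} (below n t \<omega>)))"
    by (subst sum.delta) (auto simp: finite_complete_edges below_def)
  finally show ?thesis by (simp add: num_comps_def)
qed

lemma num_comps_measurable:
  "(\<lambda>x. real (num_comps n (fst x) (snd x))) \<in> borel_measurable (unif \<Otimes>\<^sub>M env_measure n)"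
  unfolding num_comps_sum
  by (intro borel_measurable_sum borel_measurable_times borel_measurable_const env_threshold_measurable) auto

lemma num_comps_integrable: "integrable unif (\<lambda>t. real (num_comps n t \<omega>))"
proof (rule integrable_unif[of _ "real n"])
  show "(\<lambda>t. real (num_comps n t \<omega>)) \<in> borel_measurable borel"
    unfolding num_comps_sum
  proof (intro borel_measurable_sum borel_measurable_times borel_measurable_const)
    fix H
    assume "H \<in> Pow (complete_edges n)"
    then have fin: "finite H" using finite_complete_edges finite_subset by blast
    have [measurable]: "Measurable.pred borel (\<lambda>t. \<forall>e\<in>H. \<omega> e \<le> t)"
      by (rule pred_intros_finite(3)[OF fin]) measurable
    have [measurable]: "Measurable.pred borel (\<lambda>t. \<forall>e\<in>complete_edges n - H. t < \<omega> e)"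
      by (rule pred_intros_finite(3)[OF finite_Diff[OF finite_complete_edges]]) measurable
    show "(\<lambda>t. of_bool ((\<forall>e\<in>H. \<omega> e \<le> t) \<and> (\<forall>e\<in>complete_edges n - H. t < \<omega> e)) :: real)
        \<in> borel_measurable borel"
      by measurable
  qed
qed (use num_comps_le in auto)

lemma integrable_of_bool_less: "integrable unif (\<lambda>t. of_bool (t < (a::real)) :: real)"
  by (rule integrable_unif[of _ 1]) auto

text \<open>An edge of length x lies above the level for a set of levels of measure x.\<close>

lemma tree_length_integral:
  assumes T: "T \<subseteq> complete_edges n" and \<omega>: "\<And>e. e \<in> complete_edges n \<Longrightarrow> 0 \<le> \<omega> e \<and> \<omega> e \<le> 1"
  shows "tree_length \<omega> T = (\<integral>t. (\<Sum>e\<in>T. of_bool (t < \<omega> e) :: real) \<partial>unif)"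
proof -
  have "(\<integral>t. (\<Sum>e\<in>T. of_bool (t < \<omega> e) :: real) \<partial>unif) = (\<Sum>e\<in>T. \<integral>t. (of_bool (t < \<omega> e) :: real) \<partial>unif)"
    by (rule Bochner_Integration.integral_sum) (rule integrable_of_bool_less)
  also have "\<dots> = (\<Sum>e\<in>T. \<omega> e)" using T \<omega> by (intro sum.cong refl integral_unif_of_bool(1)) auto
  finally show ?thesis by (simp add: tree_length_def)
qed

lemma mst_length_le:
  assumes n: "1 \<le> n" and T: "T \<in> complete_spanning_trees n"
    and \<omega>: "\<And>e. e \<in> complete_edges n \<Longrightarrow> 0 \<le> \<omega> e \<and> \<omega> e \<le> 1"
  shows "mst_length n \<omega> \<le> tree_length \<omega> T"
proof -
  interpret U: prob_space unif by (rule prob_space_unif)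
  have sub: "T \<subseteq> complete_edges n" using T by (auto simp: spanning_trees_def)
  have eq: "tree_length \<omega> T = (\<integral>t. (\<Sum>e\<in>T. of_bool (t < \<omega> e) :: real) \<partial>unif)"
    by (rule tree_length_integral[OF sub]) (use \<omega> in auto)
  show ?thesis unfolding mst_length_def eq
    by (intro integral_mono tree_exceedances[OF n T] Bochner_Integration.integrable_sum
        Bochner_Integration.integrable_diff num_comps_integrable integrable_of_bool_less U.integrable_const)
qed

lemma ex_mst:
  assumes n: "1 \<le> n" and \<omega>: "\<And>e. e \<in> complete_edges n \<Longrightarrow> 0 \<le> \<omega> e \<and> \<omega> e \<le> 1"
  shows "\<exists>T\<in>complete_spanning_trees n. tree_length \<omega> T \<le> mst_length n \<omega>"
proof -
  interpret U: prob_space unif by (rule prob_space_unif)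
  obtain T where T: "T \<in> complete_spanning_trees n"
    "\<And>t. (\<Sum>e\<in>T. of_bool (t < \<omega> e) :: real) \<le> real (num_comps n t \<omega>) - 1"
    using ex_tree_exceedances[OF n, of \<omega>] \<omega> by auto
  have sub: "T \<subseteq> complete_edges n" using T by (auto simp: spanning_trees_def)
  have eq: "tree_length \<omega> T = (\<integral>t. (\<Sum>e\<in>T. of_bool (t < \<omega> e) :: real) \<partial>unif)"
    by (rule tree_length_integral[OF sub]) (use \<omega> in auto)
  have "tree_length \<omega> T \<le> mst_length n \<omega>" unfolding mst_length_def eq
    by (intro integral_mono T(2) Bochner_Integration.integrable_sum
        Bochner_Integration.integrable_diff num_comps_integrable integrable_of_bool_less U.integrable_const)
  then show ?thesis using T by auto
qed

text \<open>The upper bound is the entropy bound: the log-partition function at 0 is the logarithm of the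
  number of trees, at most n ln n.\<close>

lemma mean_length_mst_bounds:
  assumes n: "1 \<le> n" and b: "0 < b" and \<omega>: "\<And>e. e \<in> complete_edges n \<Longrightarrow> 0 \<le> \<omega> e \<and> \<omega> e \<le> 1"
  shows "mst_length n \<omega> \<le> rstre_mean_length n b \<omega>"
    and "rstre_mean_length n b \<omega> \<le> mst_length n \<omega> + n * ln n / b"
proof -
  let ?S = "complete_spanning_trees n"
  have Z: "0 < (\<Sum>T\<in>?S. tree_weight b \<omega> T)" by (rule sum_tree_weight_pos)
  have "(\<Sum>T\<in>?S. mst_length n \<omega> * tree_weight b \<omega> T) \<le> (\<Sum>T\<in>?S. tree_length \<omega> T * tree_weight b \<omega> T)"
    using mst_length_le[OF n _ \<omega>] by (intro sum_mono mult_right_mono less_imp_le[OF tree_weight_pos]) auto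
  then show "mst_length n \<omega> \<le> rstre_mean_length n b \<omega>"
    unfolding rstre_mean_length_eq using Z by (simp add: le_divide_eq sum_distrib_left)
  obtain T where T: "T \<in> ?S" "tree_length \<omega> T \<le> mst_length n \<omega>" using ex_mst[OF n, of \<omega>] \<omega> by auto
  have "tree_weight b \<omega> T \<le> (\<Sum>T\<in>?S. tree_weight b \<omega> T)"
    by (rule member_le_sum[OF T(1)]) (auto intro: less_imp_le[OF tree_weight_pos] finite_complete_spanning_trees)
  then have "ln (exp (- b * tree_length \<omega> T)) \<le> log_partition n b \<omega>"
    unfolding log_partition_def tree_weight_exp[OF T(1), symmetric]
    using Z tree_weight_pos by (subst ln_le_cancel_iff) auto
  then have 1: "- b * tree_length \<omega> T \<le> log_partition n b \<omega>" by simp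
  have "log_partition n 0 \<omega> = ln (real (card ?S))"
    by (simp add: log_partition_def tree_weight_def)
  also have "\<dots> \<le> ln (real n ^ n)"
  proof -
    have "n * card ?S = n ^ (n - 1)"
      using cayley[of "{..<n}"] n by (simp add: complete_spanning_trees_eq lessThan_empty_iff)
    moreover have "card ?S \<le> n * card ?S" using n by simp
    moreover have "n ^ (n - 1) \<le> n ^ n" using n by (intro power_increasing) auto
    ultimately have "card ?S \<le> n ^ n" by linarith
    then have le: "real (card ?S) \<le> real n ^ n" by (metis of_nat_le_iff of_nat_power)
    have "0 < card ?S" using complete_spanning_trees_nonempty finite_complete_spanning_trees
      by (simp add: card_gt_0_iff)
    then show ?thesis using le n by (subst ln_le_cancel_iff) auto
  qed
  also have "\<dots> = n * ln n" using n by (simp add: ln_realpow)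
  finally have "log_partition n 0 \<omega> \<le> n * ln n" .
  \<comment> \<open>The tangent at \<open>b\<close>, read off at 0, bounds b times the mean length
    by the growth of ln Z between \<open>b\<close> and 0; a single minimal tree bounds ln Z at
    \<open>b\<close> from below.\<close>
  moreover have "log_partition n b \<omega> + b * rstre_mean_length n b \<omega> \<le> log_partition n 0 \<omega>"
    using log_partition_tangent[of n b \<omega> 0] by simp
  ultimately have "b * rstre_mean_length n b \<omega> \<le> n * ln n + b * tree_length \<omega> T" using 1 by simp
  also have "\<dots> \<le> n * ln n + b * mst_length n \<omega>" using T(2) b by simp
  also have "\<dots> = b * (mst_length n \<omega> + n * ln n / b)" using b by (simp add: field_simps)
  finally show "rstre_mean_length n b \<omega> \<le> mst_length n \<omega> + n * ln n / b"
    using b by (simp only: mult_le_cancel_left_pos)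
qed

section \<open>Expected numbers of tree components\<close>

text \<open>Combines C(n, k) <= n^k / k! with k^k / k! <= exp k, a single term of the exponential
  series, and e <= 3.\<close>

lemma binomial_power_bound:
  assumes "1 \<le> k"
  shows "real (n choose k) * (real k ^ (k - 1) / k) \<le> (3 * real n) ^ k"
proof -
  have "real k ^ k / fact k \<le> exp (real k)"
  proof -
    have s: "(\<lambda>i. real k ^ i /\<^sub>R fact i) sums exp (real k)" by (rule exp_converges)
    have "(\<Sum>i\<in>{k}. real k ^ i /\<^sub>R fact i) \<le> exp (real k)"
      using s unfolding sums_unique[OF s] by (intro sum_le_suminf) (auto dest: sums_summable)
    then show ?thesis by (simp add: field_simps)
  qed
  also have "exp (real k) = exp 1 ^ k" by (simp add: exp_of_nat_mult[symmetric])
  also have "\<dots> \<le> 3 ^ k" using exp_le by (intro power_mono) auto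
  finally have 1: "real k ^ k / fact k \<le> 3 ^ k" .
  have "real (n choose k) * fact k \<le> real n ^ k"
    using binomial_fact_pow[of n k] by (metis of_nat_fact of_nat_le_iff of_nat_mult of_nat_power)
  then have 2: "real (n choose k) \<le> real n ^ k / fact k" by (simp add: le_divide_eq)
  have 3: "real k ^ (k - 1) / k \<le> real k ^ k"
  proof -
    have "real k ^ (k - 1) / k \<le> real k ^ (k - 1)" using assms by (simp add: divide_le_eq mult_le_cancel_left1)
    also have "\<dots> \<le> real k ^ k" using assms by (intro power_increasing) auto
    finally show ?thesis .
  qed
  have "real (n choose k) * (real k ^ (k - 1) / k) \<le> real n ^ k / fact k * real k ^ k"
    using 2 3 by (intro mult_mono) auto
  also have "\<dots> = real n ^ k * (real k ^ k / fact k)" by simp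
  also have "\<dots> \<le> real n ^ k * 3 ^ k" using 1 by (intro mult_left_mono) auto
  finally show ?thesis by (simp add: power_mult_distrib mult.commute)
qed

lemma power_one_minus_le_exp:
  fixes t :: real
  assumes "t \<le> 1"
  shows "(1 - t) ^ m \<le> exp (- (t * m))"
proof -
  have "(1 - t) ^ m \<le> exp (- t) ^ m" using exp_ge_add_one_self[of "- t"] assms by (intro power_mono) auto
  then show ?thesis by (simp add: exp_of_nat_mult[symmetric] mult.commute)
qed

text \<open>For k <= n / 2 at least k n / 2 edges leave a k-set. With s = n t the expression is at
  most (3 n)^k t^(k-1) exp (- s / 2)^k, geometric in k with ratio 3 s exp (- s / 2). From s >= 48
  on, s^2 / 8 >= 6 s, which makes the ratio at most 1 / 2. One factor exp (- s / 2) is kept for the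
  integration over t.\<close>

lemma large_tree_subgraphs_bound:
  fixes t :: real
  assumes k: "1 \<le> k" "k \<le> n div 2" and t: "48 / real n \<le> t" "t \<le> 1"
  shows "real (card (tree_subgraphs n k)) * (t ^ (k - 1) * (1 - t) ^ (k * (n - k))) \<le> 3 * real n * exp (- (real n / 2) * t) * (1 / 2) ^ (k - 1)"
proof -
  have n0: "0 < real n" using k by simp
  have t0: "0 \<le> t" using t n0 by (rule_tac order_trans[OF _ t(1)]) simp
  define s where "s = real n * t"
  have s: "48 \<le> s" using t n0 by (simp add: s_def divide_le_eq mult.commute)
  define E where "E = exp (- (s / 2))"
  have E: "3 * s * E \<le> 1 / 2"
  proof -
    have "6 * s \<le> (s / 2)\<^sup>2 / 2" using mult_left_mono[OF s, of s] s by (simp add: power2_eq_square)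
    also have "\<dots> \<le> exp (s / 2)" using exp_lower_Taylor_quadratic[of "s / 2"] s by linarith
    finally have "6 * s * E \<le> exp (s / 2) * E" by (simp add: E_def)
    also have "\<dots> = 1" by (simp add: E_def mult_exp_exp)
    finally show ?thesis by simp
  qed
  have "(1 - t) ^ (k * (n - k)) \<le> exp (- (t * real (k * (n - k))))" by (rule power_one_minus_le_exp[OF t(2)])
  also have "\<dots> \<le> exp (- (s / 2) * real k)"
  proof -
    have "real n / 2 \<le> real (n - k)" using k by (simp add: of_nat_diff; linarith)
    then have "t * real k * (real n / 2) \<le> t * real k * real (n - k)" using t0 by (intro mult_left_mono) auto
    then have "s / 2 * real k \<le> t * real (k * (n - k))" by (simp add: s_def ac_simps)
    then show ?thesis by simp
  qed
  also have "\<dots> = E ^ k" by (simp add: E_def exp_of_nat_mult[symmetric] mult.commute)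
  finally have 1: "(1 - t) ^ (k * (n - k)) \<le> E ^ k" .
  have "real (card (tree_subgraphs n k)) * (t ^ (k - 1) * (1 - t) ^ (k * (n - k))) \<le> (3 * real n) ^ k * (t ^ (k - 1) * E ^ k)"
    using card_tree_subgraphs[OF k(1), of n] binomial_power_bound[OF k(1), of n] 1 t0 t
    by (intro mult_mono mult_left_mono mult_nonneg_nonneg zero_le_power) auto
  also have "\<dots> = 3 * real n * E * (3 * s * E) ^ (k - 1)"
  proof -
    obtain j where j: "k = Suc j" using k by (cases k) auto
    show ?thesis by (simp add: j s_def power_mult_distrib)
  qed
  also have "\<dots> \<le> 3 * real n * E * (1 / 2) ^ (k - 1)"
    using E s by (intro mult_left_mono power_mono) (auto simp: E_def)
  finally show ?thesis by (simp add: E_def s_def mult.commute)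
qed

lemma tree_cut_measurable:
  assumes "i \<in> tree_subgraphs n k" "1 \<le> k"
  shows "(\<lambda>x. tree_cut n (fst x) (snd x) i) \<in> borel_measurable (unif \<Otimes>\<^sub>M env_measure n)"
proof -
  obtain A T where i: "i = (A, T)" by (cases i)
  have "T \<subseteq> complete_edges n" "cut n A \<subseteq> complete_edges n"
    using tree_subgraphsD(7)[OF assms[unfolded i]] by (auto simp: cut_def)
  then show ?thesis unfolding tree_cut_def i prod.case by (rule env_threshold_measurable)
qed

lemma tree_comp_measurable:
  assumes "i \<in> tree_subgraphs n k" "1 \<le> k"
  shows "(\<lambda>x. tree_comp n (fst x) (snd x) i) \<in> borel_measurable (unif \<Otimes>\<^sub>M env_measure n)"
proof -
  obtain A T where i: "i = (A, T)" by (cases i)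
  have "T \<subseteq> complete_edges n" "touch n A - T \<subseteq> complete_edges n"
    using tree_subgraphsD(7)[OF assms[unfolded i]] by (auto simp: touch_def)
  then show ?thesis unfolding tree_comp_def i prod.case by (rule env_threshold_measurable)
qed

lemma measurable_section:
  fixes f :: "real \<Rightarrow> environment \<Rightarrow> real"
  assumes "(\<lambda>x. f (fst x) (snd x)) \<in> borel_measurable (unif \<Otimes>\<^sub>M env_measure n)"
  shows "f t \<in> borel_measurable (env_measure n)"
  using measurable_compose[OF measurable_Pair1'[of t unif "env_measure n"] assms] by simp

lemma integrable_env_bounded:
  fixes f :: "environment \<Rightarrow> real"
  assumes "f \<in> borel_measurable (env_measure n)" "\<And>\<omega>. \<bar>f \<omega>\<bar> \<le> B"
  shows "integrable (env_measure n) f"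
proof -
  interpret prob_space "env_measure n" by (rule prob_space_env_measure)
  show ?thesis using assms by (intro integrable_const_bound[of _ B]) auto
qed

lemma integrable_tree_cut:
  assumes "i \<in> tree_subgraphs n k" "1 \<le> k"
  shows "integrable (env_measure n) (\<lambda>\<omega>. tree_cut n t \<omega> i)"
  by (rule integrable_env_bounded[where B = 1])
    (use measurable_section[OF tree_cut_measurable[OF assms]] in \<open>auto simp: tree_cut_def case_prod_unfold\<close>)

lemma integrable_tree_comp:
  assumes "i \<in> tree_subgraphs n k" "1 \<le> k"
  shows "integrable (env_measure n) (\<lambda>\<omega>. tree_comp n t \<omega> i)"
  by (rule integrable_env_bounded[where B = 1])
    (use measurable_section[OF tree_comp_measurable[OF assms]] in \<open>auto simp: tree_comp_def case_prod_unfold\<close>)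

lemma expectation_tree_cut:
  assumes "i \<in> tree_subgraphs n k" "1 \<le> k" "0 \<le> t" "t \<le> 1"
  shows "(\<integral>\<omega>. tree_cut n t \<omega> i \<partial>env_measure n) = (t :: real) ^ (k - 1) * (1 - t) ^ (k * (n - k))"
proof -
  obtain A T where i: "i = (A, T)" by (cases i)
  note * = tree_subgraphsD[OF assms(1,2)[unfolded i]]
  have "T \<inter> cut n A = {}" using *(6) by (auto simp: cut_def all_edges_def)
  then show ?thesis unfolding i tree_cut_def prod.case
    using env_pattern[of T n "cut n A" t] * assms(3,4) card_cut[OF *(1)]
    by (simp add: cut_def)
qed

text \<open>The number of edges that must be absent for a given tree on k vertices to be a
  component.\<close>

definition touch_count :: "nat \<Rightarrow> nat \<Rightarrow> nat" where
  "touch_count n k = (k choose 2) + k * (n - k) - (k - 1)"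

lemma expectation_tree_comp:
  assumes "i \<in> tree_subgraphs n k" "1 \<le> k" "0 \<le> t" "t \<le> 1"
  shows "(\<integral>\<omega>. tree_comp n t \<omega> i \<partial>env_measure n) = t ^ (k - 1) * (1 - t) ^ touch_count n k"
proof -
  obtain A T where i: "i = (A, T)" by (cases i)
  note * = tree_subgraphsD[OF assms(1,2)[unfolded i]]
  have sub: "touch n A - T \<subseteq> complete_edges n" by (auto simp: touch_def)
  have "card (touch n A - T) = touch_count n k"
    using card_Diff_subset[OF *(9,10)] card_touch[OF *(1)] *(2,8) by (simp add: touch_count_def)
  then show ?thesis unfolding i tree_comp_def prod.case
    using env_pattern[OF *(7) sub _ assms(3,4)] *(8) by (simp add: Diff_Int_distrib)
qed

text \<open>These leave room for subtracting k * k shared edges, give decay in t, and feed the Beta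
  integral; the last one says that the subtraction in \<open>touch_count\<close> is not
  truncated.\<close>

lemma touch_count_bounds:
  assumes "1 \<le> k" "2 * k \<le> n"
  shows "k * k \<le> 2 * touch_count n k" "n - k \<le> touch_count n k" "touch_count n k + k \<le> k * n"
    "k - 1 \<le> (k choose 2) + k * (n - k)"
proof -
  have ch: "k - 1 \<le> k choose 2 \<or> k = 1"
  proof (cases "k = 1")
    case False
    then have "2 * (k - 1) \<le> k * (k - 1)" using assms by (intro mult_right_mono) auto
    then have "2 * (k - 1) div 2 \<le> k * (k - 1) div 2" by (rule div_le_mono)
    then show ?thesis by (simp add: choose_two)
  qed simp
  then have ch': "k - 1 \<le> k choose 2" by auto
  then show "k - 1 \<le> (k choose 2) + k * (n - k)" by simp
  have ge: "k * (n - k) \<le> touch_count n k" using ch' by (simp add: touch_count_def)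
  have "1 * (n - k) \<le> k * (n - k)" using assms by (intro mult_right_mono) auto
  then show "n - k \<le> touch_count n k" using ge by (metis mult_1 order_trans)
  have "k * k \<le> k * (n - k)" using assms by (intro mult_left_mono) auto
  then show "k * k \<le> 2 * touch_count n k" using ge by linarith
  have "2 * (k choose 2) \<le> k * (k - 1)" by (simp add: choose_two)
  also have "k * (k - 1) = k * k - k" by (simp add: diff_mult_distrib2)
  finally have "2 * (k choose 2) \<le> k * k - k" .
  moreover have "1 \<le> k * k" using mult_le_mono[OF assms(1) assms(1)] by simp
  ultimately have "(k choose 2) + 1 \<le> k * k" using assms(1) by linarith
  moreover have "k * (n - k) + k * k = k * (n - k + k)" by (simp only: distrib_left)
  moreover have "n - k + k = n" using assms by simp
  ultimately show "touch_count n k + k \<le> k * n"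
    using assms ch' by (simp add: touch_count_def)
qed

text \<open>The two events concern different edges except for the k * k edges between the sets,
  whose absence is demanded by both and paid for once.\<close>

lemma expectation_tree_comp_pair:
  assumes i: "(A, T) \<in> tree_subgraphs n k" and j: "(B, S) \<in> tree_subgraphs n k" and k: "1 \<le> k" and AB: "A \<inter> B = {}"
    and t: "0 \<le> t" "t \<le> 1"
  shows "(\<integral>\<omega>. tree_comp n t \<omega> (A, T) * tree_comp n t \<omega> (B, S) \<partial>env_measure n) =
    t ^ (2 * (k - 1)) * (1 - t) ^ (2 * touch_count n k - k * k)"
proof -
  note A = tree_subgraphsD[OF i k] and B = tree_subgraphsD[OF j k]
  have TB: "T \<inter> touch n B = {}" using A(6) AB by (auto simp: touch_def all_edges_def)
  have SA: "S \<inter> touch n A = {}" using B(6) AB by (auto simp: touch_def all_edges_def)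
  have TS: "T \<inter> S = {}" using TB B(10) by auto
  let ?F = "T \<union> S" and ?F' = "(touch n A - T) \<union> (touch n B - S)"
  have eq: "tree_comp n t \<omega> (A, T) * tree_comp n t \<omega> (B, S) =
      of_bool ((\<forall>e\<in>?F. \<omega> e \<le> t) \<and> (\<forall>e\<in>?F'. t < \<omega> e))" for \<omega>
    unfolding tree_comp_def prod.case by (auto simp: ball_Un)
  have F': "?F' = (touch n A \<union> touch n B) - ?F" using TB SA by auto
  have cF: "card ?F = 2 * (k - 1)" using card_Un_disjoint[OF A(9) B(9) TS] A(8) B(8) by simp
  have "card ?F' = card (touch n A \<union> touch n B) - card ?F"
    unfolding F' using A B by (intro card_Diff_subset) auto
  also have "card (touch n A \<union> touch n B) = 2 * ((k choose 2) + k * (n - k)) - k * k"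
    using card_touch_Un[OF A(1) B(1) AB] card_touch[OF A(1)] card_touch[OF B(1)] A(2) B(2) by simp
  also have "\<dots> - card ?F = 2 * touch_count n k - k * k"
    unfolding cF touch_count_def by simp
  finally have cF': "card ?F' = 2 * touch_count n k - k * k" .
  have disj: "?F \<inter> ?F' = {}" using F' by auto
  have sub: "?F \<subseteq> complete_edges n" "?F' \<subseteq> complete_edges n" using A(7) B(7) by (auto simp: touch_def)
  show ?thesis unfolding eq using env_pattern[OF sub disj t] cF cF' by simp
qed

definition tree_comps :: "nat \<Rightarrow> nat \<Rightarrow> real \<Rightarrow> environment \<Rightarrow> real" where
  "tree_comps n k t \<omega> = (\<Sum>i\<in>tree_subgraphs n k. tree_comp n t \<omega> i)"

definition tree_comps_mean :: "nat \<Rightarrow> nat \<Rightarrow> real \<Rightarrow> real" where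
  "tree_comps_mean n k t = real (card (tree_subgraphs n k)) * (t ^ (k - 1) * (1 - t) ^ touch_count n k)"

lemma tree_comps_bounds:
  assumes "1 \<le> k"
  shows "0 \<le> tree_comps n k t \<omega>" "tree_comps n k t \<omega> \<le> n"
proof -
  have nn: "0 \<le> tree_comps n k t \<omega>" for k unfolding tree_comps_def
    by (intro sum_nonneg) (auto simp: tree_comp_def)
  then show "0 \<le> tree_comps n k t \<omega>" .
  have "tree_comps n k t \<omega> \<le> (\<Sum>k=1..k. tree_comps n k t \<omega>)"
    using assms nn by (intro member_le_sum) auto
  also have "\<dots> \<le> n" using sum_tree_comp_le[of n t \<omega> k] num_comps_le[of n t \<omega>] by (simp add: tree_comps_def)
  finally show "tree_comps n k t \<omega> \<le> n" .
qed

lemma expectation_tree_comps: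
  assumes "1 \<le> k" "0 \<le> t" "t \<le> 1"
  shows "(\<integral>\<omega>. tree_comps n k t \<omega> \<partial>env_measure n) = tree_comps_mean n k t"
proof -
  have "(\<integral>\<omega>. tree_comps n k t \<omega> \<partial>env_measure n) = (\<Sum>i\<in>tree_subgraphs n k. \<integral>\<omega>. tree_comp n t \<omega> i \<partial>env_measure n)"
    unfolding tree_comps_def
    by (rule Bochner_Integration.integral_sum) (rule integrable_tree_comp[OF _ assms(1)])
  also have "\<dots> = (\<Sum>i\<in>tree_subgraphs n k. t ^ (k - 1) * (1 - t) ^ touch_count n k)"
    using assms by (intro sum.cong refl expectation_tree_comp)
  finally show ?thesis by (simp add: tree_comps_mean_def)
qed

lemma tree_comps_joint_measurable:
  "1 \<le> k \<Longrightarrow> (\<lambda>x. tree_comps n k (fst x) (snd x)) \<in> borel_measurable (unif \<Otimes>\<^sub>M env_measure n)"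
  unfolding tree_comps_def by (intro borel_measurable_sum tree_comp_measurable)

text \<open>Two disjoint vertex sets of size k share the k * k absent edges between them; this is the only
  source of positive correlation.\<close>

lemma tree_comps_deviation:
  assumes k: "1 \<le> k" "2 * k \<le> n" and t: "0 \<le> t" "t \<le> \<tau>" and \<tau>: "real (k * k) * \<tau> \<le> 1 / 2"
  shows "(\<integral>\<omega>. \<bar>tree_comps n k t \<omega> - tree_comps_mean n k t\<bar> \<partial>env_measure n) \<le>
    sqrt (n + (real n)\<^sup>2 * (2 * real (k * k) * \<tau>))"
proof -
  interpret P: prob_space "env_measure n" by (rule prob_space_env_measure)
  let ?I = "tree_subgraphs n k"
  define q where "q = real (k * k) * \<tau>"
  have \<tau>0: "0 \<le> \<tau>" using t by simp
  have "1 * \<tau> \<le> real (k * k) * \<tau>" using k \<tau>0 by (intro mult_right_mono) (auto simp flip: of_nat_mult simp: Suc_le_eq)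
  then have t1: "t \<le> 1" using \<tau> t by linarith
  define p where "p = t ^ (k - 1) * (1 - t) ^ touch_count n k"
  define m where "m = tree_comps_mean n k t"
  have mp: "m = card ?I * p" by (simp add: m_def tree_comps_mean_def p_def)
  have p0: "0 \<le> p" using t t1 by (simp add: p_def)
  have meas: "tree_comps n k t \<in> borel_measurable (env_measure n)"
    by (rule measurable_section[OF tree_comps_joint_measurable[OF k(1)]])
  have intN: "integrable (env_measure n) (tree_comps n k t)"
    by (rule integrable_env_bounded[OF meas, of "real n"]) (use tree_comps_bounds[OF k(1)] in \<open>auto simp: abs_le_iff intro: order_trans[of _ 0]\<close>)
  have EN: "(\<integral>\<omega>. tree_comps n k t \<omega> \<partial>env_measure n) = m"
    unfolding m_def by (rule expectation_tree_comps[OF k(1) t(1) t1])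
  have mn: "0 \<le> m" "m \<le> n"
  proof -
    show "0 \<le> m" unfolding mp using p0 by simp
    have "(\<integral>\<omega>. tree_comps n k t \<omega> \<partial>env_measure n) \<le> (\<integral>\<omega>. real n \<partial>env_measure n)"
      using intN tree_comps_bounds[OF k(1)] by (intro integral_mono) auto
    then show "m \<le> n" using EN by (simp add: P.prob_space)
  qed
  have int2: "integrable (env_measure n) (\<lambda>\<omega>. tree_comp n t \<omega> i * tree_comp n t \<omega> j)" if "i \<in> ?I" "j \<in> ?I" for i j
  proof (rule integrable_env_bounded[where B = 1])
    show "(\<lambda>\<omega>. tree_comp n t \<omega> i * tree_comp n t \<omega> j) \<in> borel_measurable (env_measure n)"
      using that k by (intro borel_measurable_times borel_measurable_integrable[OF integrable_tree_comp])
  qed (auto simp: tree_comp_def case_prod_unfold)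
  have sq: "(tree_comps n k t \<omega>)\<^sup>2 = (\<Sum>i\<in>?I. \<Sum>j\<in>?I. tree_comp n t \<omega> i * tree_comp n t \<omega> j)" for \<omega>
    by (simp add: tree_comps_def power2_eq_square sum_product)
  have intsq: "integrable (env_measure n) (\<lambda>\<omega>. (tree_comps n k t \<omega>)\<^sup>2)"
    unfolding sq by (intro Bochner_Integration.integrable_sum int2)
  have pair: "(\<integral>\<omega>. tree_comp n t \<omega> i * tree_comp n t \<omega> j \<partial>env_measure n) \<le> (if j = i then p else 0) + p\<^sup>2 * (1 + 2 * q)"
    if ij: "i \<in> ?I" "j \<in> ?I" for i j
  proof -
    have q0: "0 \<le> p\<^sup>2 * (1 + 2 * q)" using \<tau>0 by (simp add: q_def)
    obtain A T where i: "i = (A, T)" by (cases i)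
    obtain B S where j: "j = (B, S)" by (cases j)
    show ?thesis
    proof (cases "i = j")
      case True
      have idem: "tree_comp n t \<omega> i * tree_comp n t \<omega> i = tree_comp n t \<omega> i" for \<omega>
        by (auto simp: tree_comp_def case_prod_unfold)
      have "(\<integral>\<omega>. tree_comp n t \<omega> i * tree_comp n t \<omega> i \<partial>env_measure n) = p"
        unfolding idem p_def by (rule expectation_tree_comp[OF ij(1) k(1) t(1) t1])
      then show ?thesis using True q0 by (simp only: simp_thms if_True le_add_same_cancel1)
    next
      case False
      show ?thesis
      proof (cases "A \<inter> B = {}")
        case AB: False
        then have "tree_comp n t \<omega> i * tree_comp n t \<omega> j = 0" for \<omega>
          using tree_comp_disjoint[OF ij[unfolded i j] k(1) k(1)] False i j by simp
        then have "(\<integral>\<omega>. tree_comp n t \<omega> i * tree_comp n t \<omega> j \<partial>env_measure n) = 0"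
          by (simp only: integral_zero)
        then show ?thesis using q0 p0 False by simp
      next
        case AB: True
        have "(\<integral>\<omega>. tree_comp n t \<omega> i * tree_comp n t \<omega> j \<partial>env_measure n) =
            t ^ (2 * (k - 1)) * (1 - t) ^ (2 * touch_count n k - k * k)"
          unfolding i j using ij i j k AB t t1 by (intro expectation_tree_comp_pair) auto
        \<comment> \<open>Bernoulli's inequality gives 1 - q <= (1 - t)^(k * k), and (1 - q) (1 + 2
          q) >= 1 for q <= 1 / 2. So the price 1 + 2 q makes up for the k * k missing factors 1 -
          t.\<close>
        also have "\<dots> \<le> t ^ (2 * (k - 1)) * (1 - t) ^ (2 * touch_count n k - k * k) * ((1 - t) ^ (k * k) * (1 + 2 * q))"
        proof -
          have "1 - q \<le> 1 + real (k * k) * (- t)"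
            using t mult_left_mono[of t \<tau> "real (k * k)"] by (simp add: q_def)
          also have "\<dots> \<le> (1 + - t) ^ (k * k)" using t1 by (intro Bernoulli_inequality) auto
          finally have "(1 - q) * (1 + 2 * q) \<le> (1 - t) ^ (k * k) * (1 + 2 * q)"
            using \<tau>0 by (intro mult_right_mono) (auto simp: q_def)
          moreover have "1 \<le> (1 - q) * (1 + 2 * q)"
          proof -
            have "0 \<le> q" "q \<le> 1 / 2" using \<tau>0 \<tau> by (auto simp: q_def)
            then have "q * q \<le> q * (1 / 2)" by (intro mult_left_mono) auto
            then show ?thesis by (simp add: algebra_simps)
          qed
          ultimately have "1 \<le> (1 - t) ^ (k * k) * (1 + 2 * q)" by linarith
          then have "t ^ (2 * (k - 1)) * (1 - t) ^ (2 * touch_count n k - k * k) * 1 \<le>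
              t ^ (2 * (k - 1)) * (1 - t) ^ (2 * touch_count n k - k * k) * ((1 - t) ^ (k * k) * (1 + 2 * q))"
            by (rule mult_left_mono) (use t t1 in auto)
          then show ?thesis by (simp only: mult_1_right)
        qed
        also have "\<dots> = t ^ (2 * (k - 1)) * (1 - t) ^ (2 * touch_count n k - k * k + k * k) * (1 + 2 * q)"
          by (simp only: power_add ac_simps)
        also have "2 * touch_count n k - k * k + k * k = 2 * touch_count n k"
          using touch_count_bounds[OF k] by simp
        also have "t ^ (2 * (k - 1)) * (1 - t) ^ (2 * touch_count n k) = p\<^sup>2"
          unfolding p_def power_mult_distrib power_mult[symmetric] by (simp only: mult.commute)
        finally show ?thesis using False by auto
      qed
    qed
  qed
  have "(\<integral>\<omega>. (tree_comps n k t \<omega>)\<^sup>2 \<partial>env_measure n) = (\<Sum>i\<in>?I. \<Sum>j\<in>?I. \<integral>\<omega>. tree_comp n t \<omega> i * tree_comp n t \<omega> j \<partial>env_measure n)"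
    unfolding sq using int2 by (simp add: Bochner_Integration.integral_sum)
  also have "\<dots> \<le> (\<Sum>i\<in>?I. \<Sum>j\<in>?I. (if j = i then p else 0) + p\<^sup>2 * (1 + 2 * q))"
    by (intro sum_mono pair)
  also have "\<dots> = m + m\<^sup>2 * (1 + 2 * q)"
    using finite_tree_subgraphs[of n k] by (simp add: sum.distrib mp power2_eq_square algebra_simps)
  finally have E2: "(\<integral>\<omega>. (tree_comps n k t \<omega>)\<^sup>2 \<partial>env_measure n) \<le> m + m\<^sup>2 * (1 + 2 * q)" .
  \<comment> \<open>\<open>s * s\<close> bounds the variance because the mean \<open>m\<close> is at
    most n; the first absolute moment then follows from 2 x s <= x^2 + s^2.\<close>
  define s where "s = sqrt (n + (real n)\<^sup>2 * (2 * q))"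
  have n0: "0 < real n" using k by simp
  have q0: "0 \<le> q" using \<tau>0 by (simp add: q_def)
  have s: "0 < s" "s * s = n + (real n)\<^sup>2 * (2 * q)"
    unfolding s_def using n0 q0 by (auto intro!: add_pos_nonneg)
  have "(\<integral>\<omega>. \<bar>tree_comps n k t \<omega> - m\<bar> \<partial>env_measure n) \<le>
      (\<integral>\<omega>. (((tree_comps n k t \<omega>)\<^sup>2 - 2 * m * tree_comps n k t \<omega> + m\<^sup>2) / s + s) / 2 \<partial>env_measure n)"
  proof (rule integral_mono)
    fix \<omega>
    define x where "x = \<bar>tree_comps n k t \<omega> - m\<bar>"
    have "0 \<le> (x - s)\<^sup>2" by simp
    then have "2 * x * s \<le> x\<^sup>2 + s * s" by (simp add: power2_eq_square algebra_simps)
    then have "x \<le> (x\<^sup>2 / s + s) / 2" using s(1) by (simp add: field_simps power2_eq_square)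
    moreover have "x\<^sup>2 = (tree_comps n k t \<omega>)\<^sup>2 - 2 * m * tree_comps n k t \<omega> + m\<^sup>2"
      by (simp add: x_def power2_diff)
    ultimately show "\<bar>tree_comps n k t \<omega> - m\<bar> \<le> (((tree_comps n k t \<omega>)\<^sup>2 - 2 * m * tree_comps n k t \<omega> + m\<^sup>2) / s + s) / 2"
      unfolding x_def by simp
  qed (use intN intsq in auto)
  also have "\<dots> = (((\<integral>\<omega>. (tree_comps n k t \<omega>)\<^sup>2 \<partial>env_measure n) - 2 * m * m + m\<^sup>2) / s + s) / 2"
    using intN intsq EN by (simp add: P.prob_space)
  also have "\<dots> \<le> (s * s / s + s) / 2"
  proof (intro divide_right_mono add_right_mono)
    have "m\<^sup>2 * (2 * q) \<le> (real n)\<^sup>2 * (2 * q)" using mn q0 by (intro mult_right_mono power_mono) auto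
    then show "(\<integral>\<omega>. (tree_comps n k t \<omega>)\<^sup>2 \<partial>env_measure n) - 2 * m * m + m\<^sup>2 \<le> s * s"
      using E2 mn unfolding s(2) by (simp add: power2_eq_square algebra_simps)
  qed (use s in auto)
  also have "\<dots> = s" using s(1) by simp
  finally show ?thesis unfolding m_def s_def q_def by (simp only: mult.assoc)
qed


section \<open>Beta integrals and the weights k^(-3)\<close>

lemma fact_add_bounds:
  shows "fact b * real b ^ k \<le> fact (b + k)" "fact (b + k) \<le> fact b * (real b + real k) ^ k"
proof -
  show "fact b * real b ^ k \<le> fact (b + k)"
  proof (induction k)
    case (Suc k)
    have "fact b * real b ^ Suc k = real b * (fact b * real b ^ k)" by simp
    also have "\<dots> \<le> real (Suc (b + k)) * fact (b + k)" using Suc by (intro mult_mono) auto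
    finally show ?case by simp
  qed simp
  show "fact (b + k) \<le> fact b * (real b + real k) ^ k"
  proof (induction k)
    case (Suc k)
    have "fact (b + Suc k) = real (Suc (b + k)) * fact (b + k)" by simp
    also have "\<dots> \<le> (real b + real (Suc k)) * (fact b * (real b + real k) ^ k)"
      using Suc by (intro mult_mono) auto
    also have "\<dots> \<le> (real b + real (Suc k)) * (fact b * (real b + real (Suc k)) ^ k)"
      by (intro mult_left_mono power_mono) auto
    finally show ?case by (simp only: power_Suc mult.left_commute mult.commute mult.assoc)
  qed simp
qed

lemma binomial_fact_bounds:
  assumes "k \<le> n"
  shows "(real n - real k) ^ k \<le> real (n choose k) * fact k" "real (n choose k) * fact k \<le> real n ^ k"
proof -
  have "fact k * fact (n - k) * (n choose k) = fact n" using assms by (rule binomial_fact_lemma)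
  then have "real (fact k * fact (n - k) * (n choose k)) = fact n" by (metis of_nat_fact)
  then have "fact k * fact (n - k) * real (n choose k) = fact n" by (simp only: of_nat_mult of_nat_fact)
  moreover have "fact (n - k) * real (n - k) ^ k \<le> fact n" using fact_add_bounds(1)[of "n - k" k] assms by simp
  ultimately have "fact (n - k) * real (n - k) ^ k \<le> fact (n - k) * (real (n choose k) * fact k)"
    by (simp only: ac_simps)
  then show "(real n - real k) ^ k \<le> real (n choose k) * fact k"
    using assms by (simp add: of_nat_diff)
  show "real (n choose k) * fact k \<le> real n ^ k"
    using binomial_fact_pow[of n k] by (metis of_nat_fact of_nat_le_iff of_nat_mult of_nat_power)
qed

text \<open>Isolates k^(-3): Cayley's k^(k-2) times (k - 1)! is k! k^k / k^3. In both uses x is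
  close to k n, which makes the factor C(n, k) k! k^k / x^k close to 1.\<close>

lemma tree_subgraphs_beta:
  assumes k: "1 \<le> k"
  shows "real (card (tree_subgraphs n k)) * (fact (k - 1) / x ^ k) = real (n choose k) * fact k / (x ^ k * real k ^ 3) * real k ^ k"
proof -
  obtain j where j: "k = Suc j" using k by (cases k) auto
  show ?thesis
    unfolding card_tree_subgraphs[OF k] by (simp add: j power3_eq_cube field_simps del: of_nat_Suc)
qed

text \<open>Here x = k (n - k) is the size of the cut, and b! / (b + k)! <= b^(-k) loses nothing in
  the limit for fixed k.\<close>

lemma tree_cut_mass:
  assumes k: "1 \<le> k" "k < n"
  shows "real (card (tree_subgraphs n k)) * (\<integral>t. t ^ (k - 1) * (1 - t) ^ (k * (n - k)) \<partial>unif) \<le>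
    1 / real k ^ 3 * (real n / (real n - real k)) ^ k"
proof -
  define b where "b = k * (n - k)"
  have b0: "0 < real b" using k by (simp add: b_def)
  have "(\<integral>t. t ^ (k - 1) * (1 - t) ^ b \<partial>unif) = fact (k - 1) * fact b / fact (b + k)"
    unfolding integral_unif_beta using k by (simp add: add.commute)
  also have "\<dots> \<le> fact (k - 1) * fact b / (fact b * real b ^ k)"
    using fact_add_bounds(1)[of b k] b0 by (intro divide_left_mono) auto
  also have "\<dots> = fact (k - 1) / real b ^ k" by simp
  finally have "real (card (tree_subgraphs n k)) * (\<integral>t. t ^ (k - 1) * (1 - t) ^ b \<partial>unif) \<le>
      real (card (tree_subgraphs n k)) * (fact (k - 1) / real b ^ k)"
    by (rule mult_left_mono) auto
  also have "\<dots> = real (n choose k) * fact k / (real b ^ k * real k ^ 3) * real k ^ k"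
    by (rule tree_subgraphs_beta[OF k(1)])
  also have "\<dots> \<le> real n ^ k / (real b ^ k * real k ^ 3) * real k ^ k"
    using binomial_fact_bounds(2)[of k n] k by (intro mult_right_mono divide_right_mono) auto
  also have "real b = real k * (real n - real k)" using k by (simp add: b_def of_nat_diff)
  also have "real n ^ k / ((real k * (real n - real k)) ^ k * real k ^ 3) * real k ^ k =
      1 / real k ^ 3 * (real n / (real n - real k)) ^ k"
    using k by (simp add: power_mult_distrib power_divide)
  finally show ?thesis by (simp add: b_def)
qed

text \<open>The lower counterpart, with x = k n. Cutting the integral at \<open>\<tau>\<close> loses
  only what lies beyond, where (1 - t)^\<open>touch_count\<close> is at most exp (-
  \<open>\<tau>\<close> n / 2).\<close>

lemma tree_comp_mass:
  assumes k: "1 \<le> k" "2 * k \<le> n" and \<tau>: "0 \<le> \<tau>" "\<tau> \<le> 1"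
  shows "1 / real k ^ 3 * ((real n - real k) / real n) ^ k - (3 * real n) ^ k * exp (- (\<tau> * (real n / 2))) \<le>
    (\<integral>t. of_bool (0 \<le> t \<and> t \<le> \<tau>) * tree_comps_mean n k t \<partial>unif)"
proof -
  interpret U: prob_space unif by (rule prob_space_unif)
  define c where "c = touch_count n k"
  define M where "M = real (card (tree_subgraphs n k))"
  note tc = touch_count_bounds[OF k, folded c_def]
  have M: "0 \<le> M" "M \<le> (3 * real n) ^ k"
    using card_tree_subgraphs[OF k(1), of n] binomial_power_bound[OF k(1), of n] by (auto simp: M_def)
  define f where "f t = t ^ (k - 1) * (1 - t) ^ c" for t :: real
  have intf: "integrable unif f" unfolding f_def[abs_def] by (intro integrable_unif_continuous continuous_intros)
  have ff: "integrable unif (\<lambda>t. of_bool (0 \<le> t \<and> t \<le> \<tau>) * f t)"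
  proof (rule integrable_unif[of _ 1])
    show "(\<lambda>t. of_bool (0 \<le> t \<and> t \<le> \<tau>) * f t) \<in> borel_measurable borel" unfolding f_def by measurable
    fix t :: real assume t: "0 \<le> t" "t \<le> 1"
    then have "t ^ (k - 1) \<le> 1" "(1 - t) ^ c \<le> 1" by (auto intro!: power_le_one)
    then have "t ^ (k - 1) * (1 - t) ^ c \<le> 1 * 1" using t by (intro mult_mono) auto
    then show "\<bar>of_bool (0 \<le> t \<and> t \<le> \<tau>) * f t\<bar> \<le> 1" using t by (auto simp: f_def abs_mult)
  qed
  have "(\<integral>t. f t - exp (- (\<tau> * (real n / 2))) \<partial>unif) \<le> (\<integral>t. of_bool (0 \<le> t \<and> t \<le> \<tau>) * f t \<partial>unif)"
  proof (rule integral_mono_AE)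
    show "AE t in unif. f t - exp (- (\<tau> * (real n / 2))) \<le> of_bool (0 \<le> t \<and> t \<le> \<tau>) * f t"
      using AE_unif
    proof eventually_elim
      case (elim t)
      have "f t \<le> exp (- (\<tau> * (real n / 2)))" if "\<tau> < t"
      proof -
        have "f t \<le> 1 * (1 - t) ^ c" unfolding f_def using elim by (intro mult_right_mono power_le_one) auto
        also have "\<dots> \<le> exp (- (t * real c))" using power_one_minus_le_exp[of t c] elim by simp
        also have "\<dots> \<le> exp (- (\<tau> * (real n / 2)))"
        proof -
          have "n \<le> 2 * c" using tc(2) k by linarith
          then have "real n / 2 \<le> real c" by linarith
          then have "\<tau> * (real n / 2) \<le> t * real c" using that \<tau> by (intro mult_mono) auto
          then show ?thesis by simp
        qed
        finally show ?thesis .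
      qed
      then show ?case using elim by (auto simp: not_le)
    qed
  qed (use intf ff in auto)
  then have 1: "(\<integral>t. f t \<partial>unif) - exp (- (\<tau> * (real n / 2))) \<le> (\<integral>t. of_bool (0 \<le> t \<and> t \<le> \<tau>) * f t \<partial>unif)"
    using intf by (simp add: U.prob_space)
  have "M * (\<integral>t. f t \<partial>unif) - (3 * real n) ^ k * exp (- (\<tau> * (real n / 2))) \<le>
      M * (\<integral>t. f t \<partial>unif) - M * exp (- (\<tau> * (real n / 2)))"
    using M by (intro diff_left_mono mult_right_mono) auto
  also have "\<dots> = M * ((\<integral>t. f t \<partial>unif) - exp (- (\<tau> * (real n / 2))))" by (simp add: right_diff_distrib)
  also have "\<dots> \<le> M * (\<integral>t. of_bool (0 \<le> t \<and> t \<le> \<tau>) * f t \<partial>unif)"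
    using 1 M by (rule_tac mult_left_mono) auto
  also have "\<dots> = (\<integral>t. of_bool (0 \<le> t \<and> t \<le> \<tau>) * tree_comps_mean n k t \<partial>unif)"
    by (simp add: tree_comps_mean_def M_def f_def c_def mult.left_commute)
  finally have 2: "M * (\<integral>t. f t \<partial>unif) - (3 * real n) ^ k * exp (- (\<tau> * (real n / 2))) \<le>
      (\<integral>t. of_bool (0 \<le> t \<and> t \<le> \<tau>) * tree_comps_mean n k t \<partial>unif)" .
  have n0: "0 < real n" and k0: "0 < real k" using k by auto
  have "1 / real k ^ 3 * ((real n - real k) / real n) ^ k =
      (real n - real k) ^ k / ((real k * real n) ^ k * real k ^ 3) * real k ^ k"
    using k0 n0 by (simp add: power_mult_distrib power_divide)
  also have "\<dots> \<le> real (n choose k) * fact k / ((real k * real n) ^ k * real k ^ 3) * real k ^ k"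
    using binomial_fact_bounds(1)[of k n] k by (intro mult_right_mono divide_right_mono) auto
  also have "\<dots> = M * (fact (k - 1) / (real k * real n) ^ k)"
    unfolding M_def by (rule tree_subgraphs_beta[OF k(1), symmetric])
  also have "\<dots> \<le> M * (\<integral>t. f t \<partial>unif)"
  proof (rule mult_left_mono[OF _ M(1)])
    have "fact (c + k) \<le> fact c * (real c + real k) ^ k" by (rule fact_add_bounds)
    also have "\<dots> \<le> fact c * (real k * real n) ^ k"
    proof (intro mult_left_mono power_mono)
      show "real c + real k \<le> real k * real n" using tc(3) by (metis of_nat_add of_nat_le_iff of_nat_mult)
    qed auto
    finally have "fact (k - 1) * fact c / (fact c * (real k * real n) ^ k) \<le> fact (k - 1) * fact c / fact (c + k)"
      by (intro divide_left_mono) (use k0 n0 in auto)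
    then show "fact (k - 1) / (real k * real n) ^ k \<le> (\<integral>t. f t \<partial>unif)"
      unfolding f_def integral_unif_beta using k by (simp add: add.commute)
  qed
  finally show ?thesis using 2 by linarith
qed

text \<open>Sizes up to K give the truncated zeta sum. Larger ones cost at most n / K at each level
  up to 48 / n, together 48 / K; above that the geometric bound leaves 6 n / 2^K times the integral
  of exp (- n t / 2), which is at most 2 / n, together 12 / 2^K.\<close>

lemma expectation_mst_upper:
  assumes K: "1 \<le> K" "K < n"
  shows "integrable (env_measure n) (mst_length n)"
    and "(\<integral>\<omega>. mst_length n \<omega> \<partial>env_measure n) \<le>
      (\<Sum>k=1..K. 1 / real k ^ 3 * (real n / (real n - real k)) ^ k) + 48 / K + 12 / 2 ^ K"
proof -
  interpret U: prob_space unif by (rule prob_space_unif)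
  interpret P: prob_space "env_measure n" by (rule prob_space_env_measure)
  have n0: "0 < real n" using K by simp
  define Us where "Us k t \<omega> = (\<Sum>i\<in>tree_subgraphs n k. tree_cut n t \<omega> i)" for k t \<omega>
  define c where "c k = real (card (tree_subgraphs n k))" for k
  define g where "g t \<omega> = (\<Sum>k=1..K. Us k t \<omega>) +
    (if t \<le> 48 / real n then real n / real K else \<Sum>k=Suc K..n div 2. Us k t \<omega>)" for t \<omega>
  have Ub: "0 \<le> Us k t \<omega>" "Us k t \<omega> \<le> c k" for k t \<omega>
  proof -
    show "0 \<le> Us k t \<omega>" unfolding Us_def by (intro sum_nonneg) (auto simp: tree_cut_def)
    have "Us k t \<omega> \<le> (\<Sum>i\<in>tree_subgraphs n k. 1)" unfolding Us_def
      by (intro sum_mono) (auto simp: tree_cut_def)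
    then show "Us k t \<omega> \<le> c k" by (simp add: c_def)
  qed
  have Um: "(\<lambda>x. Us k (fst x) (snd x)) \<in> borel_measurable (unif \<Otimes>\<^sub>M env_measure n)" if "1 \<le> k" for k
    unfolding Us_def using that by (intro borel_measurable_sum tree_cut_measurable)
  have gm: "(\<lambda>x. g (fst x) (snd x)) \<in> borel_measurable (unif \<Otimes>\<^sub>M env_measure n)"
    unfolding g_def
  proof (intro borel_measurable_add measurable_If borel_measurable_const borel_measurable_sum Um)
    show "{x \<in> space (unif \<Otimes>\<^sub>M env_measure n). fst x \<le> 48 / real n} \<in> sets (unif \<Otimes>\<^sub>M env_measure n)"
      by measurable
  qed auto
  define B where "B = (\<Sum>k=1..K. c k) + (real n / real K + (\<Sum>k=Suc K..n div 2. c k))"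
  have gb: "\<bar>g t \<omega>\<bar> \<le> B" for t \<omega>
  proof -
    have 1: "0 \<le> (\<Sum>k\<in>S. Us k t \<omega>)" "(\<Sum>k\<in>S. Us k t \<omega>) \<le> (\<Sum>k\<in>S. c k)" "0 \<le> (\<Sum>k\<in>S. c k)" for S
      using Ub by (auto intro!: sum_nonneg sum_mono simp: c_def)
    have 2: "0 \<le> real n / real K" by simp
    have "0 \<le> g t \<omega>" unfolding g_def using 1(1) 2 by (auto intro!: add_nonneg_nonneg)
    moreover have "g t \<omega> \<le> B"
      unfolding g_def B_def using 1 2 by (intro add_mono 1) (auto intro: add_increasing add_increasing2)
    ultimately show ?thesis by simp
  qed
  have gm': "(\<lambda>(t, \<omega>). g t \<omega>) \<in> borel_measurable (unif \<Otimes>\<^sub>M env_measure n)"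
    using gm by (simp add: case_prod_unfold)
  note F = env_unif_Fubini[OF gm' gb]
  have km: "(\<lambda>(t, \<omega>). real (num_comps n t \<omega>) - 1) \<in> borel_measurable (unif \<Otimes>\<^sub>M env_measure n)"
    using num_comps_measurable[of n] by (simp add: case_prod_unfold)
  have kb: "\<bar>real (num_comps n t \<omega>) - 1\<bar> \<le> real n + 1" for t \<omega>
    using num_comps_le[of n t \<omega>] by (intro abs_leI) auto
  show intY: "integrable (env_measure n) (mst_length n)"
    unfolding mst_length_def[abs_def] by (rule env_unif_Fubini(1)[OF km kb])
  have "(\<integral>\<omega>. mst_length n \<omega> \<partial>env_measure n) \<le> (\<integral>\<omega>. (\<integral>t. g t \<omega> \<partial>unif) \<partial>env_measure n)"
  proof (rule integral_mono[OF intY F(1)])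
    fix \<omega> assume \<omega>: "\<omega> \<in> space (env_measure n)"
    show "mst_length n \<omega> \<le> (\<integral>t. g t \<omega> \<partial>unif)" unfolding mst_length_def
    proof (rule integral_mono)
      show "integrable unif (\<lambda>t. real (num_comps n t \<omega>) - 1)"
        by (intro Bochner_Integration.integrable_diff num_comps_integrable U.integrable_const)
      have "(\<lambda>t. g t \<omega>) \<in> borel_measurable unif"
        using measurable_compose[OF measurable_Pair2'[OF \<omega>, of unif] gm] by simp
      then show "integrable unif (\<lambda>t. g t \<omega>)"
        by (intro U.integrable_const_bound[of _ B]) (use gb in auto)
      fix t
      show "real (num_comps n t \<omega>) - 1 \<le> g t \<omega>"
        using num_comps_upper[OF K(1), of n t \<omega>] by (auto simp: g_def Us_def)
    qed
  qed
  also have "\<dots> = (\<integral>t. (\<integral>\<omega>. g t \<omega> \<partial>env_measure n) \<partial>unif)" by (rule F(3))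
  also have "\<dots> \<le> (\<integral>t. (\<Sum>k=1..K. c k * (t ^ (k - 1) * (1 - t) ^ (k * (n - k)))) +
      (real n / real K * of_bool (t \<le> 48 / real n) + 6 * real n / 2 ^ K * exp (- (real n / 2) * t)) \<partial>unif)"
  proof (rule integral_mono_AE[OF F(2)])
    show "integrable unif (\<lambda>t. (\<Sum>k=1..K. c k * (t ^ (k - 1) * (1 - t) ^ (k * (n - k)))) +
      (real n / real K * of_bool (t \<le> 48 / real n) + 6 * real n / 2 ^ K * exp (- (real n / 2) * t)))"
    proof (intro Bochner_Integration.integrable_add)
      show "integrable unif (\<lambda>t. \<Sum>k=1..K. c k * (t ^ (k - 1) * (1 - t) ^ (k * (n - k))))"
        by (intro integrable_unif_continuous continuous_intros)
      show "integrable unif (\<lambda>t. 6 * real n / 2 ^ K * exp (- (real n / 2) * t))"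
        by (intro integrable_unif_continuous continuous_intros)
      show "integrable unif (\<lambda>t. real n / real K * of_bool (t \<le> 48 / real n))"
        by (intro integrable_mult_right integrable_unif[of _ 1]) auto
    qed
    show "AE t in unif. (\<integral>\<omega>. g t \<omega> \<partial>env_measure n) \<le> (\<Sum>k=1..K. c k * (t ^ (k - 1) * (1 - t) ^ (k * (n - k)))) +
      (real n / real K * of_bool (t \<le> 48 / real n) + 6 * real n / 2 ^ K * exp (- (real n / 2) * t))"
      using AE_unif
    proof eventually_elim
      case (elim t)
      have iU: "integrable (env_measure n) (Us k t)" if "1 \<le> k" for k
        unfolding Us_def[abs_def] using that by (intro Bochner_Integration.integrable_sum integrable_tree_cut)
      have EU: "(\<integral>\<omega>. Us k t \<omega> \<partial>env_measure n) = c k * (t ^ (k - 1) * (1 - t) ^ (k * (n - k)))" if k: "1 \<le> k" for k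
      proof -
        have "(\<integral>\<omega>. Us k t \<omega> \<partial>env_measure n) = (\<Sum>i\<in>tree_subgraphs n k. \<integral>\<omega>. tree_cut n t \<omega> i \<partial>env_measure n)"
          unfolding Us_def by (rule Bochner_Integration.integral_sum) (rule integrable_tree_cut[OF _ k])
        also have "\<dots> = (\<Sum>i\<in>tree_subgraphs n k. t ^ (k - 1) * (1 - t) ^ (k * (n - k)))"
          using elim k by (intro sum.cong refl expectation_tree_cut) auto
        finally show ?thesis by (simp add: c_def)
      qed
      have iS: "integrable (env_measure n) (\<lambda>\<omega>. \<Sum>k=a..b. Us k t \<omega>)"
        and ES: "(\<integral>\<omega>. (\<Sum>k=a..b. Us k t \<omega>) \<partial>env_measure n) = (\<Sum>k=a..b. c k * (t ^ (k - 1) * (1 - t) ^ (k * (n - k))))"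
        if "1 \<le> a" for a b
      proof -
        show "integrable (env_measure n) (\<lambda>\<omega>. \<Sum>k=a..b. Us k t \<omega>)"
          using that by (intro Bochner_Integration.integrable_sum iU) auto
        have "(\<integral>\<omega>. (\<Sum>k=a..b. Us k t \<omega>) \<partial>env_measure n) = (\<Sum>k=a..b. \<integral>\<omega>. Us k t \<omega> \<partial>env_measure n)"
          using that by (intro Bochner_Integration.integral_sum iU) auto
        then show "(\<integral>\<omega>. (\<Sum>k=a..b. Us k t \<omega>) \<partial>env_measure n) = (\<Sum>k=a..b. c k * (t ^ (k - 1) * (1 - t) ^ (k * (n - k))))"
          using that EU by simp
      qed
      show ?case
      proof (cases "t \<le> 48 / real n")
        case True
        have "(\<integral>\<omega>. g t \<omega> \<partial>env_measure n) = (\<integral>\<omega>. (\<Sum>k=1..K. Us k t \<omega>) + real n / real K \<partial>env_measure n)"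
          using True by (simp add: g_def)
        also have "\<dots> = (\<integral>\<omega>. (\<Sum>k=1..K. Us k t \<omega>) \<partial>env_measure n) + real n / real K"
          using iS[of 1 K] by (subst Bochner_Integration.integral_add) (auto simp: P.prob_space)
        finally show ?thesis using True ES[of 1 K] by simp
      next
        case False
        have "(\<integral>\<omega>. g t \<omega> \<partial>env_measure n) = (\<integral>\<omega>. (\<Sum>k=1..K. Us k t \<omega>) + (\<Sum>k=Suc K..n div 2. Us k t \<omega>) \<partial>env_measure n)"
          using False by (simp add: g_def)
        also have "\<dots> = (\<integral>\<omega>. (\<Sum>k=1..K. Us k t \<omega>) \<partial>env_measure n) + (\<integral>\<omega>. (\<Sum>k=Suc K..n div 2. Us k t \<omega>) \<partial>env_measure n)"
          by (intro Bochner_Integration.integral_add iS) auto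
        also have "\<dots> = (\<Sum>k=1..K. c k * (t ^ (k - 1) * (1 - t) ^ (k * (n - k)))) +
            (\<Sum>k=Suc K..n div 2. c k * (t ^ (k - 1) * (1 - t) ^ (k * (n - k))))" by (simp add: ES)
        also have "(\<Sum>k=Suc K..n div 2. c k * (t ^ (k - 1) * (1 - t) ^ (k * (n - k)))) \<le>
            (\<Sum>k=Suc K..n div 2. 3 * real n * exp (- (real n / 2) * t) * (1 / 2) ^ (k - 1))"
          unfolding c_def using False elim by (intro sum_mono large_tree_subgraphs_bound) auto
        also have "\<dots> = 3 * real n * exp (- (real n / 2) * t) * (\<Sum>k=Suc K..n div 2. (1 / 2) ^ (k - 1))"
          by (simp add: sum_distrib_left)
        also have "(\<Sum>k=Suc K..n div 2. (1 / 2 :: real) ^ (k - 1)) \<le> 2 / 2 ^ K"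
        proof -
          have "(\<Sum>k=Suc K..m. (1 / 2 :: real) ^ (k - 1)) \<le> 2 / 2 ^ K - 2 / 2 ^ m" if "K \<le> m" for m
            using that
          proof (induction m rule: nat_induct_at_least)
            case (Suc m)
            have "(\<Sum>k=Suc K..Suc m. (1 / 2 :: real) ^ (k - 1)) = (\<Sum>k=Suc K..m. (1 / 2) ^ (k - 1)) + 1 / 2 ^ m"
              using Suc by (simp add: power_one_over)
            moreover have "2 / 2 ^ Suc m = (1 / 2 ^ m :: real)" "2 / 2 ^ m = (2 * (1 / 2 ^ m) :: real)" by simp_all
            ultimately show ?case using Suc by linarith
          qed simp
          note * = this[of "n div 2"]
          show ?thesis
          proof (cases "K \<le> n div 2")
            case True
            have "0 \<le> 2 / (2 :: real) ^ (n div 2)" by simp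
            then show ?thesis using *[OF True] by linarith
          qed simp
        qed
        finally show ?thesis using False by (simp add: mult_left_mono)
      qed
    qed
  qed
  also have "\<dots> = (\<Sum>k=1..K. c k * (\<integral>t. t ^ (k - 1) * (1 - t) ^ (k * (n - k)) \<partial>unif)) +
      (real n / real K * (\<integral>t. of_bool (t \<le> 48 / real n) \<partial>unif) + 6 * real n / 2 ^ K * (\<integral>t. exp (- (real n / 2) * t) \<partial>unif))"
  proof -
    have i1: "integrable unif (\<lambda>t. c k * (t ^ (k - 1) * (1 - t) ^ (k * (n - k))))" for k
      by (intro integrable_unif_continuous continuous_intros)
    have i2: "integrable unif (\<lambda>t. real n / real K * of_bool (t \<le> 48 / real n))"
      by (intro integrable_mult_right integrable_unif[of _ 1]) auto
    have i3: "integrable unif (\<lambda>t. 6 * real n / 2 ^ K * exp (- (real n / 2) * t))"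
      by (intro integrable_unif_continuous continuous_intros)
    show ?thesis
      by (subst Bochner_Integration.integral_add[OF Bochner_Integration.integrable_sum[OF i1]
            Bochner_Integration.integrable_add[OF i2 i3]],
          subst Bochner_Integration.integral_sum[OF i1],
          subst Bochner_Integration.integral_add[OF i2 i3]) simp
  qed
  also have "(\<Sum>k=1..K. c k * (\<integral>t. t ^ (k - 1) * (1 - t) ^ (k * (n - k)) \<partial>unif)) \<le>
      (\<Sum>k=1..K. 1 / real k ^ 3 * (real n / (real n - real k)) ^ k)"
    unfolding c_def using K by (intro sum_mono tree_cut_mass) auto
  also have "real n / real K * (\<integral>t. of_bool (t \<le> 48 / real n) \<partial>unif) \<le> real n / real K * (48 / real n)"
  proof (rule mult_left_mono)
    show "(\<integral>t. of_bool (t \<le> 48 / real n) \<partial>unif) \<le> 48 / real n"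
    proof (cases "48 / real n \<le> 1")
      case True
      then show ?thesis using integral_unif_of_bool(3)[of "48 / real n"] n0 by simp
    next
      case False
      have "(\<integral>t. of_bool (t \<le> 48 / real n) \<partial>unif) \<le> (\<integral>t. (1::real) \<partial>unif)"
        by (intro integral_mono integrable_unif[of _ 1]) auto
      then show ?thesis using False by (simp add: U.prob_space)
    qed
  qed simp
  also have "real n / real K * (48 / real n) = 48 / K" using n0 by simp
  also have "6 * real n / 2 ^ K * (\<integral>t. exp (- (real n / 2) * t) \<partial>unif) \<le> 6 * real n / 2 ^ K * (1 / (real n / 2))"
    using integral_exp_unif[of "real n / 2"] mean_weight_bounds(3)[of "real n / 2"] n0
    by (intro mult_left_mono) auto
  also have "6 * real n / 2 ^ K * (1 / (real n / 2)) = 12 / 2 ^ K" using n0 by simp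
  finally show "(\<integral>\<omega>. mst_length n \<omega> \<partial>env_measure n) \<le>
      (\<Sum>k=1..K. 1 / real k ^ 3 * (real n / (real n - real k)) ^ k) + 48 / K + 12 / 2 ^ K" by simp
qed


section \<open>The zeta(3) limit\<close>

text \<open>Tree components bound the length from below in each environment, while from above only
  its mean is controlled; |x| = x + 2 max(-x, 0) combines the two. Levels are cut at
  \<open>\<tau>\<close> because the variance estimate is for small t, and the last summand
  \<open>\<tau>\<close> integrates the -1 of the length formula over these levels.\<close>

lemma mst_mean_error:
  fixes z \<tau> :: real
  assumes K: "1 \<le> K" "2 * K \<le> n" and \<tau>: "0 \<le> \<tau>" "real (K * K) * \<tau> \<le> 1 / 2"
    and z: "(\<Sum>k=1..K. 1 / real k ^ 3) \<le> z"
  shows "(\<integral>\<omega>. \<bar>mst_length n \<omega> - z\<bar> \<partial>env_measure n) \<le> (\<integral>\<omega>. mst_length n \<omega> \<partial>env_measure n) - z +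
    2 * ((z - (\<Sum>k=1..K. 1 / real k ^ 3)) +
      (\<Sum>k=1..K. 1 / real k ^ 3 * (1 - ((real n - real k) / real n) ^ k) +
        (3 * real n) ^ k * exp (- (\<tau> * (real n / 2))) +
        \<tau> * sqrt (real n + (real n)\<^sup>2 * (2 * real (k * k) * \<tau>))) + \<tau>)"
proof -
  interpret U: prob_space unif by (rule prob_space_unif)
  interpret P: prob_space "env_measure n" by (rule prob_space_env_measure)
  have n1: "1 \<le> n" "K < n" and n0: "0 < real n" using K by auto
  have "1 * \<tau> \<le> real (K * K) * \<tau>" using K \<tau> by (intro mult_right_mono) (auto simp flip: of_nat_mult simp: Suc_le_eq)
  then have \<tau>1: "\<tau> \<le> 1" using \<tau> by linarith
  let ?I = "\<lambda>t. of_bool (0 \<le> t \<and> t \<le> \<tau>) :: real"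
  define m where "m k = tree_comps_mean n k" for k
  \<comment> \<open>\<open>w\<close> is the mean and \<open>W\<close> the actual contribution of
    tree components with k vertices up to level \<open>\<tau>\<close>; \<open>D\<close> dominates
    their difference, and \<open>e\<close> the gap between \<open>w\<close> and 1 / k^3.\<close>
  define w where "w k = (\<integral>t. ?I t * m k t \<partial>unif)" for k
  define W where "W k \<omega> = (\<integral>t. ?I t * tree_comps n k t \<omega> \<partial>unif)" for k \<omega>
  define D where "D k \<omega> = (\<integral>t. ?I t * \<bar>tree_comps n k t \<omega> - m k t\<bar> \<partial>unif)" for k \<omega>
  define e where "e k = 1 / real k ^ 3 * (1 - ((real n - real k) / real n) ^ k) +
    (3 * real n) ^ k * exp (- (\<tau> * (real n / 2)))" for k
  define s where "s k = sqrt (real n + (real n)\<^sup>2 * (2 * real (k * k) * \<tau>))" for k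
  have Em: "\<bar>?I t * m k t\<bar> \<le> real (card (tree_subgraphs n k))" for k t
  proof (cases "0 \<le> t \<and> t \<le> \<tau>")
    case True
    then have "t ^ (k - 1) \<le> 1" "(1 - t) ^ touch_count n k \<le> 1" using \<tau>1 by (auto intro!: power_le_one)
    then have "t ^ (k - 1) * (1 - t) ^ touch_count n k \<le> 1 * 1" using True \<tau>1 by (intro mult_mono) auto
    then have "m k t \<le> real (card (tree_subgraphs n k)) * 1"
      unfolding m_def tree_comps_mean_def by (intro mult_left_mono) auto
    moreover have "0 \<le> m k t" unfolding m_def tree_comps_mean_def using True \<tau>1 by simp
    ultimately show ?thesis using True by simp
  qed auto
  have mm: "m k \<in> borel_measurable borel" for k
    unfolding m_def tree_comps_mean_def[abs_def]
    by (intro borel_measurable_continuous_onI continuous_intros)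
  have im: "integrable unif (\<lambda>t. ?I t * m k t)" for k
  proof (rule integrable_unif[of _ "real (card (tree_subgraphs n k))"])
    note [measurable] = mm
    show "(\<lambda>t. ?I t * m k t) \<in> borel_measurable borel" by measurable
  qed (rule Em)
  have joint: "(\<lambda>x. ?I (fst x) * tree_comps n k (fst x) (snd x)) \<in> borel_measurable (unif \<Otimes>\<^sub>M env_measure n)"
    "(\<lambda>x. ?I (fst x) * \<bar>tree_comps n k (fst x) (snd x) - m k (fst x)\<bar>) \<in> borel_measurable (unif \<Otimes>\<^sub>M env_measure n)"
    if k: "1 \<le> k" for k
  proof -
    note [measurable] = tree_comps_joint_measurable[OF k, of n] mm
    have [measurable]: "(\<lambda>x. m k (fst x)) \<in> borel_measurable (unif \<Otimes>\<^sub>M env_measure n)"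
      by (rule measurable_compose[OF measurable_fst]) (simp add: mm)
    show "(\<lambda>x. ?I (fst x) * tree_comps n k (fst x) (snd x)) \<in> borel_measurable (unif \<Otimes>\<^sub>M env_measure n)"
      by measurable
    show "(\<lambda>x. ?I (fst x) * \<bar>tree_comps n k (fst x) (snd x) - m k (fst x)\<bar>) \<in> borel_measurable (unif \<Otimes>\<^sub>M env_measure n)"
      by measurable
  qed
  have bN: "\<bar>?I t * tree_comps n k t \<omega>\<bar> \<le> real n" if k: "1 \<le> k" for k t \<omega>
    using tree_comps_bounds[OF k, of n t \<omega>] by auto
  have bD: "\<bar>?I t * \<bar>tree_comps n k t \<omega> - m k t\<bar>\<bar> \<le> real n + real (card (tree_subgraphs n k))" if k: "1 \<le> k" for k t \<omega>
    using bN[OF k, of t \<omega>] Em[of t k] by (auto simp: abs_mult)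
  have iN: "integrable unif (\<lambda>t. ?I t * tree_comps n k t \<omega>)"
    and iD: "integrable unif (\<lambda>t. ?I t * \<bar>tree_comps n k t \<omega> - m k t\<bar>)"
    if k: "1 \<le> k" and \<omega>: "\<omega> \<in> space (env_measure n)" for k \<omega>
  proof -
    have "(\<lambda>t. ?I t * tree_comps n k t \<omega>) \<in> borel_measurable unif"
      using measurable_compose[OF measurable_Pair2'[OF \<omega>, of unif] joint(1)[OF k]] by simp
    then show "integrable unif (\<lambda>t. ?I t * tree_comps n k t \<omega>)"
      by (intro U.integrable_const_bound[of _ "real n"]) (use bN[OF k] in auto)
    have "(\<lambda>t. ?I t * \<bar>tree_comps n k t \<omega> - m k t\<bar>) \<in> borel_measurable unif"
      using measurable_compose[OF measurable_Pair2'[OF \<omega>, of unif] joint(2)[OF k]] by simp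
    then show "integrable unif (\<lambda>t. ?I t * \<bar>tree_comps n k t \<omega> - m k t\<bar>)"
      by (intro U.integrable_const_bound[of _ "real n + real (card (tree_subgraphs n k))"]) (use bD[OF k] in auto)
  qed
  have II: "(\<integral>t. ?I t \<partial>unif) = \<tau>"
  proof -
    have "(\<integral>t. ?I t \<partial>unif) = (\<integral>t. of_bool (t \<le> \<tau>) \<partial>unif)"
      by (rule integral_cong_AE) (use AE_unif in \<open>auto elim!: eventually_mono\<close>)
    then show ?thesis using integral_unif_of_bool(3)[OF \<tau>(1) \<tau>1] by simp
  qed
  have iI: "integrable unif ?I" by (rule integrable_unif[of _ 1]) auto
  have wD: "w k - W k \<omega> \<le> D k \<omega>" if k: "1 \<le> k" and \<omega>: "\<omega> \<in> space (env_measure n)" for k \<omega>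
  proof -
    have "w k - W k \<omega> = (\<integral>t. ?I t * m k t - ?I t * tree_comps n k t \<omega> \<partial>unif)"
      unfolding w_def W_def using im iN[OF k \<omega>] by simp
    also have "\<dots> \<le> D k \<omega>" unfolding D_def
      using im iN[OF k \<omega>] iD[OF k \<omega>] by (intro integral_mono) (auto simp: abs_if)
    finally show ?thesis .
  qed
  have Yge: "(\<Sum>k=1..K. W k \<omega>) - \<tau> \<le> mst_length n \<omega>" if \<omega>: "\<omega> \<in> space (env_measure n)" for \<omega>
  proof -
    have i1: "integrable unif (\<lambda>t. \<Sum>k=1..K. ?I t * tree_comps n k t \<omega>)"
      using iN[OF _ \<omega>] by (intro Bochner_Integration.integrable_sum) auto
    have "(\<integral>t. (\<Sum>k=1..K. ?I t * tree_comps n k t \<omega>) \<partial>unif) = (\<Sum>k=1..K. W k \<omega>)"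
      unfolding W_def using iN[OF _ \<omega>] by (intro Bochner_Integration.integral_sum) auto
    then have "(\<Sum>k=1..K. W k \<omega>) - \<tau> = (\<integral>t. (\<Sum>k=1..K. ?I t * tree_comps n k t \<omega>) - ?I t \<partial>unif)"
      using Bochner_Integration.integral_diff[OF i1 iI] II by simp
    also have "\<dots> \<le> mst_length n \<omega>" unfolding mst_length_def
    proof (rule integral_mono)
      show "integrable unif (\<lambda>t. (\<Sum>k=1..K. ?I t * tree_comps n k t \<omega>) - ?I t)"
        using i1 iI by (rule Bochner_Integration.integrable_diff)
      show "integrable unif (\<lambda>t. real (num_comps n t \<omega>) - 1)"
        by (intro Bochner_Integration.integrable_diff num_comps_integrable U.integrable_const)
      fix t
      show "(\<Sum>k=1..K. ?I t * tree_comps n k t \<omega>) - ?I t \<le> real (num_comps n t \<omega>) - 1"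
        using sum_tree_comp_le[of n t \<omega> K] num_comps_pos[OF n1(1), of t \<omega>]
        by (cases "0 \<le> t \<and> t \<le> \<tau>") (auto simp: tree_comps_def)
    qed
    finally show ?thesis .
  qed
  have we: "1 / real k ^ 3 - w k \<le> e k" if k: "k \<in> {1..K}" for k
  proof -
    have "1 / real k ^ 3 * ((real n - real k) / real n) ^ k - (3 * real n) ^ k * exp (- (\<tau> * (real n / 2))) \<le> w k"
      unfolding w_def m_def using k K \<tau> \<tau>1 by (intro tree_comp_mass) auto
    then show ?thesis by (simp add: e_def right_diff_distrib)
  qed
  have e0: "0 \<le> e k" if k: "k \<in> {1..K}" for k
  proof -
    have "((real n - real k) / real n) ^ k \<le> 1"
      using k K n0 by (intro power_le_one) (auto simp: divide_le_eq)
    then show ?thesis unfolding e_def by (intro add_nonneg_nonneg mult_nonneg_nonneg) auto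
  qed
  have D0: "0 \<le> D k \<omega>" for k \<omega> unfolding D_def by (intro Bochner_Integration.integral_nonneg) auto
  let ?S = "\<Sum>k=1..K. 1 / real k ^ 3"
  have pt: "\<bar>mst_length n \<omega> - z\<bar> \<le> (mst_length n \<omega> - z) + 2 * ((z - ?S) + (\<Sum>k=1..K. e k + D k \<omega>) + \<tau>)"
    if \<omega>: "\<omega> \<in> space (env_measure n)" for \<omega>
  proof -
    have "?S \<le> (\<Sum>k=1..K. W k \<omega> + (e k + D k \<omega>))"
    proof (rule sum_mono)
      fix k assume k: "k \<in> {1..K}"
      then show "1 / real k ^ 3 \<le> W k \<omega> + (e k + D k \<omega>)" using we[OF k] wD[OF _ \<omega>, of k] by simp
    qed
    also have "\<dots> = (\<Sum>k=1..K. W k \<omega>) + (\<Sum>k=1..K. e k + D k \<omega>)" by (rule sum.distrib)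
    finally have 1: "z - mst_length n \<omega> \<le> (z - ?S) + (\<Sum>k=1..K. e k + D k \<omega>) + \<tau>" using Yge[OF \<omega>] by linarith
    have "0 \<le> (\<Sum>k=1..K. e k + D k \<omega>)" using e0 D0 by (intro sum_nonneg add_nonneg_nonneg) auto
    then have 2: "0 \<le> (z - ?S) + (\<Sum>k=1..K. e k + D k \<omega>) + \<tau>" using z \<tau> by linarith
    have gen: "\<bar>a\<bar> \<le> a + 2 * c" if "- a \<le> c" "0 \<le> c" for a c :: real using that by (auto simp: abs_if)
    show ?thesis by (rule gen) (use 1 2 in auto)
  qed
  have DF: "integrable (env_measure n) (D k)" "(\<integral>\<omega>. D k \<omega> \<partial>env_measure n) \<le> \<tau> * s k" if k: "k \<in> {1..K}" for k
  proof -
    have k1: "1 \<le> k" "2 * k \<le> n" using k K by auto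
    have "k * k \<le> K * K" using k by (intro mult_le_mono) auto
    then have "real (k * k) * \<tau> \<le> real (K * K) * \<tau>" using \<tau> by (intro mult_right_mono) (auto simp only: of_nat_le_iff)
    then have k\<tau>: "real (k * k) * \<tau> \<le> 1 / 2" using \<tau> by linarith
    have jm: "(\<lambda>(t, \<omega>). ?I t * \<bar>tree_comps n k t \<omega> - m k t\<bar>) \<in> borel_measurable (unif \<Otimes>\<^sub>M env_measure n)"
      using joint(2)[OF k1(1)] by (simp add: case_prod_unfold)
    note F = env_unif_Fubini[OF jm bD[OF k1(1)]]
    show "integrable (env_measure n) (D k)" unfolding D_def[abs_def] by (rule F(1))
    have "(\<integral>\<omega>. D k \<omega> \<partial>env_measure n) = (\<integral>t. (\<integral>\<omega>. ?I t * \<bar>tree_comps n k t \<omega> - m k t\<bar> \<partial>env_measure n) \<partial>unif)"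
      unfolding D_def by (rule F(3))
    also have "\<dots> \<le> (\<integral>t. ?I t * s k \<partial>unif)"
    proof (rule integral_mono[OF F(2)])
      show "integrable unif (\<lambda>t. ?I t * s k)" using iI by (rule integrable_mult_left)
      fix t
      have "(\<integral>\<omega>. \<bar>tree_comps n k t \<omega> - m k t\<bar> \<partial>env_measure n) \<le> s k" if "0 \<le> t" "t \<le> \<tau>"
        unfolding s_def m_def using k1 that k\<tau> by (intro tree_comps_deviation)
      then show "(\<integral>\<omega>. ?I t * \<bar>tree_comps n k t \<omega> - m k t\<bar> \<partial>env_measure n) \<le> ?I t * s k"
        by (cases "0 \<le> t \<and> t \<le> \<tau>") auto
    qed
    also have "\<dots> = \<tau> * s k" using II by simp
    finally show "(\<integral>\<omega>. D k \<omega> \<partial>env_measure n) \<le> \<tau> * s k" .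
  qed
  note iY = expectation_mst_upper(1)[OF K(1) n1(2)]
  have iS: "integrable (env_measure n) (\<lambda>\<omega>. \<Sum>k=1..K. e k + D k \<omega>)"
    by (intro Bochner_Integration.integrable_sum Bochner_Integration.integrable_add DF P.integrable_const)
  have "(\<integral>\<omega>. \<bar>mst_length n \<omega> - z\<bar> \<partial>env_measure n) \<le>
      (\<integral>\<omega>. (mst_length n \<omega> - z) + 2 * ((z - ?S) + (\<Sum>k=1..K. e k + D k \<omega>) + \<tau>) \<partial>env_measure n)"
    by (rule integral_mono[OF _ _ pt]) (use iY iS in auto)
  also have "\<dots> = (\<integral>\<omega>. mst_length n \<omega> \<partial>env_measure n) - z + 2 * ((z - ?S) + (\<integral>\<omega>. (\<Sum>k=1..K. e k + D k \<omega>) \<partial>env_measure n) + \<tau>)"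
    using iY iS by (simp add: P.prob_space)
  finally have 1: "(\<integral>\<omega>. \<bar>mst_length n \<omega> - z\<bar> \<partial>env_measure n) \<le> (\<integral>\<omega>. mst_length n \<omega> \<partial>env_measure n) - z +
      2 * ((z - ?S) + (\<integral>\<omega>. (\<Sum>k=1..K. e k + D k \<omega>) \<partial>env_measure n) + \<tau>)" .
  have 2: "(\<integral>\<omega>. (\<Sum>k=1..K. e k + D k \<omega>) \<partial>env_measure n) \<le> (\<Sum>k=1..K. e k + \<tau> * s k)"
  proof -
    have "(\<integral>\<omega>. (\<Sum>k=1..K. e k + D k \<omega>) \<partial>env_measure n) = (\<Sum>k=1..K. \<integral>\<omega>. e k + D k \<omega> \<partial>env_measure n)"
      by (intro Bochner_Integration.integral_sum Bochner_Integration.integrable_add DF P.integrable_const)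
    also have "\<dots> \<le> (\<Sum>k=1..K. e k + \<tau> * s k)"
      using DF by (intro sum_mono) (simp add: P.prob_space)
    finally show ?thesis .
  qed
  have gen: "a \<le> b + 2 * (c + y + d)" if "a \<le> b + 2 * (c + x + d)" "x \<le> y" for a b c d x y :: real
    using that by argo
  show ?thesis using gen[OF 1 2] by (simp only: e_def s_def)
qed

text \<open>The cut-off n^(-3/4) meets two demands: n \<open>\<tau>\<close> = n^(1/4) has to beat k
  ln n in the exponent, and the integrated standard deviation, of order n
  \<open>\<tau>\<close>^(3/2) = n^(-1/8), has to vanish.\<close>

lemma error_terms_tendsto:
  fixes k :: nat
  assumes "1 \<le> k"
  shows "(\<lambda>n. (real n / (real n - real k)) ^ k) \<longlonglongrightarrow> 1"
    and "(\<lambda>n. ((real n - real k) / real n) ^ k) \<longlonglongrightarrow> 1"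
    and "(\<lambda>n. (3 * real n) ^ k * exp (- (real n powr (-3/4) * (real n / 2)))) \<longlonglongrightarrow> 0"
    and "(\<lambda>n. real n powr (-3/4) * sqrt (real n + (real n)\<^sup>2 * (2 * real (k * k) * real n powr (-3/4)))) \<longlonglongrightarrow> 0"
proof -
  have "(\<lambda>n::nat. real n / (real n - real k)) \<longlonglongrightarrow> 1" by real_asymp
  from tendsto_power[OF this, of k] show "(\<lambda>n. (real n / (real n - real k)) ^ k) \<longlonglongrightarrow> 1" by simp
  have "(\<lambda>n::nat. (real n - real k) / real n) \<longlonglongrightarrow> 1" by real_asymp
  from tendsto_power[OF this, of k] show "(\<lambda>n. ((real n - real k) / real n) ^ k) \<longlonglongrightarrow> 1" by simp
  have k: "0 < k" using assms by simp
  show "(\<lambda>n. (3 * real n) ^ k * exp (- (real n powr (-3/4) * (real n / 2)))) \<longlonglongrightarrow> 0"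
    using k by real_asymp
  have gen: "(\<lambda>n::nat. real n powr (-3/4) * sqrt (real n + (real n)\<^sup>2 * (2 * c * real n powr (-3/4)))) \<longlonglongrightarrow> 0"
    if "0 < c" for c :: real using that by real_asymp
  have "0 < real (k * k)" using k by simp
  from gen[OF this] show "(\<lambda>n. real n powr (-3/4) * sqrt (real n + (real n)\<^sup>2 * (2 * real (k * k) * real n powr (-3/4)))) \<longlonglongrightarrow> 0" .
qed

text \<open>The size bound K is fixed first, so that the zeta tail and the terms 48 / K and 12 / 2^K
  are small; with K fixed the other errors vanish as n grows.\<close>

lemma mst_length_tendsto:
  "(\<lambda>n. \<integral>\<omega>. \<bar>mst_length n \<omega> - (\<Sum>k. 1 / real (Suc k) ^ 3)\<bar> \<partial>env_measure n) \<longlonglongrightarrow> 0"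
    (is "?E \<longlonglongrightarrow> 0")
proof (rule LIMSEQ_I)
  fix r :: real assume r: "0 < r"
  define z where "z = (\<Sum>k. 1 / real (Suc k) ^ 3)"
  have "summable (\<lambda>k. inverse (real k ^ 3))" by (rule inverse_power_summable) auto
  then have sm: "summable (\<lambda>k. 1 / real (Suc k) ^ 3)"
    by (subst (asm) summable_Suc_iff[symmetric]) (simp add: divide_inverse)
  define S where "S K = (\<Sum>k=1..K. 1 / real k ^ 3)" for K
  have S: "S K = (\<Sum>k<K. 1 / real (Suc k) ^ 3)" for K
    unfolding S_def by (simp add: sum.atLeast1_atMost_eq)
  have Sz: "S K \<le> z" for K unfolding S z_def by (intro sum_le_suminf sm) auto
  have "S \<longlonglongrightarrow> z" unfolding S[abs_def] z_def by (rule summable_LIMSEQ[OF sm])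
  then have "(\<lambda>K. 2 * (z - S K)) \<longlonglongrightarrow> 2 * (z - z)" by (intro tendsto_intros)
  moreover have "(\<lambda>K::nat. 48 / real K) \<longlonglongrightarrow> 0" "(\<lambda>K::nat. 12 / 2 ^ K :: real) \<longlonglongrightarrow> 0"
    by real_asymp+
  ultimately have "(\<lambda>K. 2 * (z - S K) + 48 / real K + 12 / 2 ^ K) \<longlonglongrightarrow> 2 * (z - z) + 0 + 0"
    by (intro tendsto_add)
  then have "eventually (\<lambda>K. 2 * (z - S K) + 48 / real K + 12 / 2 ^ K < r / 2) sequentially"
    using r by (intro order_tendstoD(2)) auto
  moreover have "eventually (\<lambda>K. 1 \<le> K) sequentially" by (rule eventually_ge_at_top)
  ultimately have "eventually (\<lambda>K. 2 * (z - S K) + 48 / real K + 12 / 2 ^ K < r / 2 \<and> 1 \<le> K) sequentially"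
    by (rule eventually_conj)
  then obtain K where K: "2 * (z - S K) + 48 / real K + 12 / 2 ^ K < r / 2" "1 \<le> K"
    by (auto simp: eventually_sequentially)
  define \<tau> where "\<tau> n = real n powr (-3/4)" for n :: nat
  have \<tau>: "\<tau> \<longlonglongrightarrow> 0" unfolding \<tau>_def by real_asymp
  define a where "a n = (\<Sum>k=1..K. 1 / real k ^ 3 * (real n / (real n - real k)) ^ k) - S K" for n :: nat
  define b where "b n = (\<Sum>k=1..K. 1 / real k ^ 3 * (1 - ((real n - real k) / real n) ^ k) +
        (3 * real n) ^ k * exp (- (\<tau> n * (real n / 2))) +
        \<tau> n * sqrt (real n + (real n)\<^sup>2 * (2 * real (k * k) * \<tau> n))) + \<tau> n" for n :: nat
  have "a \<longlonglongrightarrow> (\<Sum>k=1..K. 1 / real k ^ 3 * 1) - S K"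
    unfolding a_def by (intro tendsto_intros error_terms_tendsto) auto
  then have a: "a \<longlonglongrightarrow> 0" by (simp add: S_def)
  have "b \<longlonglongrightarrow> (\<Sum>k=1..K. 1 / real k ^ 3 * (1 - 1) + 0 + 0) + 0"
    unfolding b_def \<tau>_def
    by (intro tendsto_add tendsto_sum tendsto_mult tendsto_diff tendsto_const error_terms_tendsto \<tau>[unfolded \<tau>_def]) auto
  then have b: "b \<longlonglongrightarrow> 0" by simp
  have "(\<lambda>n. a n + 2 * b n) \<longlonglongrightarrow> 0 + 2 * 0" by (intro tendsto_intros a b)
  then have ev1: "eventually (\<lambda>n. a n + 2 * b n < r / 2) sequentially"
    using r by (intro order_tendstoD(2)) auto
  have "(\<lambda>n. real (K * K) * \<tau> n) \<longlonglongrightarrow> real (K * K) * 0" by (intro tendsto_intros \<tau>)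
  then have ev2: "eventually (\<lambda>n. real (K * K) * \<tau> n < 1 / 2) sequentially"
    by (intro order_tendstoD(2)) auto
  have "eventually (\<lambda>n. ?E n < r) sequentially"
    using ev1 ev2 eventually_ge_at_top[of "2 * K"]
  proof eventually_elim
    case (elim n)
    have Kn: "2 * K \<le> n" "K < n" using elim K by auto
    have "?E n \<le> (\<integral>\<omega>. mst_length n \<omega> \<partial>env_measure n) - z + 2 * ((z - S K) + b n)"
      using mst_mean_error[of K n "\<tau> n" z] K Kn elim Sz[of K]
      by (simp add: S_def b_def z_def \<tau>_def add.assoc)
    moreover have "(\<integral>\<omega>. mst_length n \<omega> \<partial>env_measure n) \<le> a n + S K + 48 / K + 12 / 2 ^ K"
      using expectation_mst_upper(2)[OF K(2) Kn(2)] by (simp add: a_def)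
    ultimately have "?E n \<le> a n + S K + 48 / K + 12 / 2 ^ K - z + 2 * ((z - S K) + b n)" by linarith
    also have "\<dots> \<le> (2 * (z - S K) + 48 / K + 12 / 2 ^ K) + (a n + 2 * b n)"
      using Sz[of K] by (simp add: distrib_left)
    finally show "?E n < r" using elim K by linarith
  qed
  then obtain N where N: "\<And>n. n \<ge> N \<Longrightarrow> ?E n < r" by (auto simp: eventually_sequentially)
  show "\<exists>N. \<forall>n\<ge>N. norm (?E n - 0) < r"
    by (intro exI[of _ N] allI impI) (use N in simp)
qed

text \<open>The mean length exceeds the minimal one by at most n ln n / \<open>\<beta>\<close>,
  which \<open>\<rho>\<close> dominates as soon as ln n >= 1, and the minimal length converges in
  L1.\<close>

lemma mean_length_large_beta:
  assumes "(\<lambda>n. real n * ln (real n) ^ 5) \<in> o(\<beta>)" "\<And>n. 0 \<le> \<beta> n"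
  shows "whp_asymp_equiv env_measure (\<lambda>n. rstre_mean_length n (\<beta> n)) (\<lambda>_. \<Sum>k. 1 / real (Suc k) ^ 3)"
    and "(\<lambda>n. \<integral>\<omega>. rstre_mean_length n (\<beta> n) \<omega> \<partial>env_measure n) \<sim>[sequentially] (\<lambda>_. \<Sum>k. 1 / real (Suc k) ^ 3)"
proof -
  define z where "z = (\<Sum>k. 1 / real (Suc k) ^ 3)"
  have "summable (\<lambda>k. inverse (real k ^ 3))" by (rule inverse_power_summable) auto
  then have sm: "summable (\<lambda>k. 1 / real (Suc k) ^ 3)"
    by (subst (asm) summable_Suc_iff[symmetric]) (simp add: divide_inverse)
  have "(\<Sum>k<1. 1 / real (Suc k) ^ 3) \<le> z" unfolding z_def by (intro sum_le_suminf sm) auto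
  then have z: "0 < z" by simp
  let ?X = "\<lambda>n. rstre_mean_length n (\<beta> n)"
  define \<rho> where "\<rho> n = \<bar>real n * ln (real n) ^ 5 / \<beta> n\<bar>" for n
  have "(\<lambda>n. (real n * ln (real n) ^ 5) / \<beta> n) \<longlonglongrightarrow> 0" by (rule smalloD_tendsto[OF assms(1)])
  then have \<rho>: "(\<lambda>n. \<rho> n) \<longlonglongrightarrow> 0" unfolding \<rho>_def by (rule tendsto_rabs_zero)
  \<comment> \<open>Dominating an eventually positive sequence forces \<open>\<beta> n\<close> to be
    nonzero for large n.\<close>
  have pos: "eventually (\<lambda>n. 0 < \<beta> n) sequentially"
  proof -
    have "eventually (\<lambda>n. norm (real n * ln (real n) ^ 5) \<le> 1 * norm (\<beta> n)) sequentially"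
      by (rule landau_o.smallD[OF assms(1)]) simp
    moreover have "eventually (\<lambda>n :: nat. 0 < real n * ln (real n) ^ 5) sequentially" by real_asymp
    ultimately show ?thesis
    proof eventually_elim
      case (elim n)
      then have "\<beta> n \<noteq> 0" by auto
      then show ?case using assms(2)[of n] by (simp add: less_le)
    qed
  qed
  have "(\<lambda>n. \<integral>\<omega>. \<bar>?X n \<omega> / z - 1\<bar> \<partial>env_measure n) \<longlonglongrightarrow> 0"
  proof (rule tendsto_sandwich[of "\<lambda>_. 0"])
    have "(\<lambda>n. ((\<integral>\<omega>. \<bar>mst_length n \<omega> - z\<bar> \<partial>env_measure n) + \<rho> n) / z) \<longlonglongrightarrow> (0 + 0) / z"
      using z by (intro tendsto_intros \<rho> mst_length_tendsto[folded z_def]) auto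
    then show "(\<lambda>n. ((\<integral>\<omega>. \<bar>mst_length n \<omega> - z\<bar> \<partial>env_measure n) + \<rho> n) / z) \<longlonglongrightarrow> 0" by simp
    have "eventually (\<lambda>n :: nat. 1 \<le> ln (real n)) sequentially" by real_asymp
    then show "eventually (\<lambda>n. (\<integral>\<omega>. \<bar>?X n \<omega> / z - 1\<bar> \<partial>env_measure n) \<le>
        ((\<integral>\<omega>. \<bar>mst_length n \<omega> - z\<bar> \<partial>env_measure n) + \<rho> n) / z) sequentially"
      using pos eventually_ge_at_top[of 2]
    proof eventually_elim
      case (elim n)
      interpret prob_space "env_measure n" by (rule prob_space_env_measure)
      have n1: "1 \<le> n" "1 < n" using elim by auto
      note iY = expectation_mst_upper(1)[OF order_refl n1(2)]
      have le: "real n * ln (real n) / \<beta> n \<le> \<rho> n"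
      proof -
        have "ln (real n) ^ 1 \<le> ln (real n) ^ 5" using elim(1) by (intro power_increasing) auto
        then have "real n * ln (real n) \<le> real n * ln (real n) ^ 5" by (intro mult_left_mono) auto
        then have "real n * ln (real n) / \<beta> n \<le> real n * ln (real n) ^ 5 / \<beta> n"
          using elim(2) by (intro divide_right_mono) auto
        also have "\<dots> \<le> \<rho> n" unfolding \<rho>_def by (rule abs_ge_self)
        finally show ?thesis .
      qed
      have "AE \<omega> in env_measure n. \<bar>?X n \<omega> / z - 1\<bar> \<le> (\<bar>mst_length n \<omega> - z\<bar> + real n * ln (real n) / \<beta> n) / z"
        using AE_env
      proof eventually_elim
        case (elim \<omega>)
        have b: "mst_length n \<omega> \<le> ?X n \<omega>" "?X n \<omega> \<le> mst_length n \<omega> + real n * ln (real n) / \<beta> n"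
          using mean_length_mst_bounds[OF n1(1) \<open>0 < \<beta> n\<close>, of \<omega>] elim by auto
        have "?X n \<omega> / z - 1 = (?X n \<omega> - z) / z" using z by (simp add: diff_divide_distrib)
        then have "\<bar>?X n \<omega> / z - 1\<bar> = \<bar>?X n \<omega> - z\<bar> / z" using z by (simp only: abs_divide abs_of_pos)
        also have "\<dots> \<le> (\<bar>mst_length n \<omega> - z\<bar> + real n * ln (real n) / \<beta> n) / z"
          using b z by (intro divide_right_mono) (auto simp: abs_if)
        finally show ?case .
      qed
      then have "(\<integral>\<omega>. \<bar>?X n \<omega> / z - 1\<bar> \<partial>env_measure n) \<le>
          (\<integral>\<omega>. (\<bar>mst_length n \<omega> - z\<bar> + real n * ln (real n) / \<beta> n) / z \<partial>env_measure n)"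
        using integrable_mean_length[of n "\<beta> n"] iY by (intro integral_mono_AE) auto
      also have "\<dots> = ((\<integral>\<omega>. \<bar>mst_length n \<omega> - z\<bar> \<partial>env_measure n) + real n * ln (real n) / \<beta> n) / z"
        using iY by (simp add: prob_space)
      also have "\<dots> \<le> ((\<integral>\<omega>. \<bar>mst_length n \<omega> - z\<bar> \<partial>env_measure n) + \<rho> n) / z"
        using le z by (intro divide_right_mono add_left_mono) auto
      finally show ?case .
    qed
  qed auto
  note * = mean_convergence_imp[where M = env_measure and X = ?X and a = "\<lambda>_. z",
      OF prob_space_env_measure integrable_mean_length this]
  have nz: "eventually (\<lambda>n. z \<noteq> 0) (sequentially :: nat filter)" using z by simp
  show "whp_asymp_equiv env_measure ?X (\<lambda>_. \<Sum>k. 1 / real (Suc k) ^ 3)"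
    using *(1)[OF nz] by (simp only: z_def)
  show "(\<lambda>n. \<integral>\<omega>. ?X n \<omega> \<partial>env_measure n) \<sim>[sequentially] (\<lambda>_. \<Sum>k. 1 / real (Suc k) ^ 3)"
    using *(2)[OF nz] by (simp only: z_def)
qed

theorem theorem4p1p4:
  fixes \<beta> :: "nat \<Rightarrow> real"
  assumes "\<And>n. 0 \<le> \<beta> n"
  shows
    "((\<forall>n. 0 < \<beta> n) \<and> \<beta> \<in> o(\<lambda>n. real n / ln (real n)) \<longrightarrow>
        whp_asymp_equiv env_measure (\<lambda>n. rstre_mean_length n (\<beta> n))
          (\<lambda>n. real n / \<beta> n *
             ((1 - \<beta> n * exp (- \<beta> n) - exp (- \<beta> n)) / (1 - exp (- \<beta> n)))) \<and>
        (\<lambda>n. \<integral>\<omega>. rstre_mean_length n (\<beta> n) \<omega> \<partial>env_measure n) \<sim>[sequentially]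
          (\<lambda>n. real n / \<beta> n *
             ((1 - \<beta> n * exp (- \<beta> n) - exp (- \<beta> n)) / (1 - exp (- \<beta> n))))) \<and>
     ((\<lambda>n. real n * ln (real n) ^ 5) \<in> o(\<beta>) \<longrightarrow>
        whp_asymp_equiv env_measure (\<lambda>n. rstre_mean_length n (\<beta> n))
          (\<lambda>_. \<Sum>k. 1 / real (Suc k) ^ 3) \<and>
        (\<lambda>n. \<integral>\<omega>. rstre_mean_length n (\<beta> n) \<omega> \<partial>env_measure n) \<sim>[sequentially]
          (\<lambda>_. \<Sum>k. 1 / real (Suc k) ^ 3))"
proof -
  have eq: "(\<lambda>n. real n * tilted_mean (\<beta> n)) = (\<lambda>n. real n / \<beta> n *
      ((1 - \<beta> n * exp (- \<beta> n) - exp (- \<beta> n)) / (1 - exp (- \<beta> n))))"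
    by (simp add: tilted_mean_def)
  show ?thesis
    using mean_length_small_beta[of \<beta>, unfolded eq] mean_length_large_beta[of \<beta>] assms by blast
qed

end
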